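(* Let $p$ be a prime, let $G$ be a pro-$p$ group which is the restricted free pro-$p$ product $G=\coprod_{i\in I}^{r,p}G_i$ of a family $\{G_i\}_{i\in I}$ of closed subgroups of $G$, and let $H\leq G$ be a closed subgroup. Assume that: (1) the double coset space $H\backslash G/G_i$ is finite for every $i\in I$; and (2) there exist sets $D_i\subseteq G$ ($i\in I$), with $D_i$ a set of representatives of the double cosets $H\backslash G/G_i$, such that $H$ is topologically generated by the subgroups $H\cap xG_ix^{-1}$, $i\in I$, $x\in D_i$. Then the family $\{H\cap xG_ix^{-1}: i\in I, x\in D_i\}$ of subgroups of $H$ (indexed by the pairs $(i,x)$) converges to $1$ in $H$, and $H$ is the restricted free pro-$p$ product $$H=\coprod_{i\in I,\,x\in D_i}^{r,p}\left(H\cap xG_ix^{-1}\right).$$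
   Context: A family $\{G_i\}_{i\in I}$ of closed subgroups of a profinite group $G$, indexed by a set $I$, *converges to 1* if every open subgroup $U\leq_o G$ contains $G_i$ for all but finitely many $i\in I$. A pro-$p$ group $G$ is the (internal) *restricted free pro-$p$ product* of a family $\{G_i\}_{i\in I}$ of closed subgroups, written $G=\coprod_{i\in I}^{r,p}G_i$, if: (1) $\{G_i\}_{i\in I}$ converges to 1; (2) $G_i\cap G_j=\{e\}$ for all $i\neq j$ in $I$; (3) $G=\overline{\langle G_i: i\in I\rangle}$; (4) for every pro-$p$ group $P$ and every family of continuous homomorphisms $f_i:G_i\to P$ ($i\in I$) that converges to 1 (i.e. every open subgroup of $P$ contains $f_i(G_i)$ for all but finitely many $i$), there is a unique continuous homomorphism $f:G\to P$ with $f|_{G_i}=f_i$ for all $i\in I$. A profinite group being generated by a family of subgroups is meant topologically: it is the closure of the abstract subgroup they generate. *)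

theory Defs
  imports
    "HOL-Analysis.Analysis"
    "HOL-Algebra.Coset"
    "HOL-Algebra.Generated_Groups"
    "HOL-Library.Infinite_Typeclass"
begin

locale profinite_group = group G
  for G :: "('a, 'm) monoid_scheme" (structure) +
  fixes T :: "'a topology"
  assumes topspace_eq: "topspace T = carrier G"
    and continuous_mult:
      "continuous_map (prod_topology T T) T (\<lambda>(x, y). x \<otimes> y)"
    and continuous_inv: "continuous_map T T (\<lambda>x. inv x)"
    and compact: "compact_space T"
    and hausdorff: "Hausdorff_space T"
    and totally_disconnected:
      "\<And>x. x \<in> carrier G \<Longrightarrow> connected_component_of_set T x = {x}"

text \<open>In the following condition, \<open>card\<close> being a power of \<open>p\<close>
  also forces the index to be finite, as infinite sets have cardinality 0.\<close>

locale pro_p_group = profinite_group G T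
  for p :: nat and G :: "('a, 'm) monoid_scheme" (structure) and T +
  assumes open_normal_index:
    "\<And>N. N \<lhd> G \<Longrightarrow> openin T N \<Longrightarrow> \<exists>k. card (rcosets N) = p ^ k"

definition closed_subgroup ::
    "'a set \<Rightarrow> ('a, 'm) monoid_scheme \<Rightarrow> 'a topology \<Rightarrow> bool" where
  "closed_subgroup H G T \<longleftrightarrow> subgroup H G \<and> closedin T H"

definition converges_to_1 ::
    "('a, 'm) monoid_scheme \<Rightarrow> 'a topology \<Rightarrow> 'i set \<Rightarrow> ('i \<Rightarrow> 'a set) \<Rightarrow> bool" where
  "converges_to_1 G T I S \<longleftrightarrow>
    (\<forall>U. subgroup U G \<longrightarrow> openin T U \<longrightarrow> finite {i \<in> I. \<not> S i \<subseteq> U})"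

definition topologically_generated_by ::
    "('a, 'm) monoid_scheme \<Rightarrow> 'a topology \<Rightarrow> 'a set \<Rightarrow> bool" where
  "topologically_generated_by G T X \<longleftrightarrow> T closure_of (generate G X) = carrier G"

definition continuous_hom ::
    "('a, 'm) monoid_scheme \<Rightarrow> 'a topology \<Rightarrow> ('b, 'n) monoid_scheme \<Rightarrow> 'b topology
      \<Rightarrow> ('a \<Rightarrow> 'b) set" where
  "continuous_hom G T P TP = {f \<in> hom G P. continuous_map T TP f}"

text \<open>
  HOL cannot quantify over types inside a formula, so the universal property is stated
  relative to a type \<open>'u\<close> (passed as \<open>TYPE('u)\<close>) containing the carriers of
  the pro-\<open>p\<close> groups \<open>P\<close>; the property of the mathematical literature is its
  validity for all \<open>'u\<close>.
  For infinite \<open>'u\<close> this loses nothing: \<open>'u\<close> then contains copies of all finite \<open>p\<close>-groups,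
  and every pro-\<open>p\<close> group is an inverse limit of these. Using \<open>extensional\<close> makes uniqueness of \<open>f\<close> refer
  to its values on the carrier only.
\<close>

definition restricted_free_pro_p_product ::
    "'u itself \<Rightarrow> nat \<Rightarrow> ('a, 'm) monoid_scheme \<Rightarrow> 'a topology
      \<Rightarrow> 'i set \<Rightarrow> ('i \<Rightarrow> 'a set) \<Rightarrow> bool" where
  "restricted_free_pro_p_product (TYPE('u)) p G T I S \<longleftrightarrow>
    pro_p_group p G T \<and>
    (\<forall>i\<in>I. closed_subgroup (S i) G T) \<and>
    converges_to_1 G T I S \<and>
    (\<forall>i\<in>I. \<forall>j\<in>I. i \<noteq> j \<longrightarrow> S i \<inter> S j = {\<one>\<^bsub>G\<^esub>}) \<and>
    topologically_generated_by G T (\<Union>i\<in>I. S i) \<and>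
    (\<forall>(P :: 'u monoid) TP f.
      pro_p_group p P TP \<longrightarrow>
      (\<forall>i\<in>I. f i \<in> continuous_hom (G\<lparr>carrier := S i\<rparr>) (subtopology T (S i)) P TP) \<longrightarrow>
      converges_to_1 P TP I (\<lambda>i. f i ` S i) \<longrightarrow>
      (\<exists>!g. g \<in> continuous_hom G T P TP \<and> g \<in> extensional (carrier G) \<and>
            (\<forall>i\<in>I. \<forall>x\<in>S i. g x = f i x)))"

definition double_coset ::
    "('a, 'm) monoid_scheme \<Rightarrow> 'a set \<Rightarrow> 'a set \<Rightarrow> 'a \<Rightarrow> 'a set" where
  "double_coset G H K x = (H #>\<^bsub>G\<^esub> x) <#>\<^bsub>G\<^esub> K"

definition double_cosets ::
    "('a, 'm) monoid_scheme \<Rightarrow> 'a set \<Rightarrow> 'a set \<Rightarrow> 'a set set" where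
  "double_cosets G H K = double_coset G H K ` carrier G"

definition double_coset_representatives ::
    "('a, 'm) monoid_scheme \<Rightarrow> 'a set \<Rightarrow> 'a set \<Rightarrow> 'a set \<Rightarrow> bool" where
  "double_coset_representatives G H K D \<longleftrightarrow>
    D \<subseteq> carrier G \<and> bij_betw (double_coset G H K) D (double_cosets G H K)"

definition conjugate ::
    "('a, 'm) monoid_scheme \<Rightarrow> 'a \<Rightarrow> 'a set \<Rightarrow> 'a set" where
  "conjugate G x K = (x <#\<^bsub>G\<^esub> K) #>\<^bsub>G\<^esub> (inv\<^bsub>G\<^esub> x)"

end

theory Submission
  imports Defs "HOL-Algebra.Group_Action" "HOL-Algebra.Product_Groups" "HOL-Algebra.Zassenhaus"
begin

text \<open>
  To extend homomorphisms \<open>u\<close> from the groups \<open>H \<inter> x S i x\<^sup>-\<^sup>1\<close> to \<open>H\<close>, take first a finite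
  \<open>p\<close>-group \<open>Q\<close> as target.  A homomorphism from \<open>G\<close> to the wreath product of \<open>Q\<close> with a finite quotient
  of \<open>G\<close>, acting on the cosets of an open subgroup \<open>H'\<close> containing \<open>H\<close>, is a cocycle on the coset space with
  values in \<open>Q\<close>, and restricts to a homomorphism on \<open>H\<close>.  As \<open>S i\<close> has one orbit on \<open>H \ G\<close> for each
  \<open>x \<in> D i\<close>, with stabilizer conjugate to \<open>H \<inter> x S i x\<^sup>-\<^sup>1\<close>, the \<open>u\<close> define cocycles on the \<open>S i\<close>, and
  freeness of \<open>G\<close> glues them.  The resulting homomorphism on \<open>H\<close> agrees with each \<open>u\<close> only up to
  conjugation by some element of \<open>Q\<close>.  To remove the conjugation, apply this not to \<open>u\<close> but to the
  family of all conjugates of \<open>u\<close>, with values in a subgroup \<open>M\<close> of a finite power of \<open>Q\<close> generated by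
  its image: conjugating the members of this family amounts to permuting, not necessarily bijectively,
  the coordinates, which is an endomorphism of \<open>M\<close>, and in a finite \<open>p\<close>-group conjugates of generators still
  generate, so this endomorphism is an automorphism, whose inverse corrects the homomorphism.
  Compactness passes from finite to pro-\<open>p\<close> targets; sending one factor identically and the others
  trivially shows that the factors intersect trivially.
\<close>

section \<open>Finite p-groups\<close>

text \<open>\<open>H\<close> is only closed, so its coset space may be infinite, and a wreath
  product over it would not be a finite \<open>p\<close>-group. This is why an open
  \<open>H' = H <#> V\<close> takes its place. The price is that \<open>V\<close> must be so small
  that the finitely many relevant \<open>S i\<close> still have one orbit per representative, and
  that the larger stabilizers differ from those of \<open>H\<close> only by elements on which
  everything is trivial. The conjugation has a geometric origin: the base point
  \<open>H' #> x\<close> of an orbit of \<open>S i\<close> is in general not reached from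
  \<open>H'\<close> by an element of \<open>S i\<close>, so moving between the two costs a value of
  the global cocycle, which comes out of freeness and cannot be prescribed. The correction therefore
  has to work for all possible values at once, and the family of all conjugates is stable under
  every such change. For finite targets, continuity and convergence to 1 are both expressed by a
  single open normal subgroup on which all members of a family are trivial.\<close>

lemma (in group) mult_inv_cancel [simp]:
  assumes "x \<in> carrier G" "y \<in> carrier G"
  shows "x \<otimes> (inv x \<otimes> y) = y" "inv x \<otimes> (x \<otimes> y) = y"
  using assms by (simp_all flip: m_assoc)

locale finite_p_group = group Q for p :: nat and Q :: "('q, 'w) monoid_scheme" (structure) +
  assumes prime: "prime p" and order_power: "\<exists>n. order Q = p ^ n"
begin

lemma finite_carrier: "finite (carrier Q)"
proof -
  have "order Q > 0" using order_power prime prime_gt_0_nat by fastforce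
  then show ?thesis by (simp add: order_gt_0_iff_finite)
qed

lemma subgroup_finite_p_group:
  assumes "subgroup S Q" shows "finite_p_group p (Q\<lparr>carrier := S\<rparr>)"
proof -
  obtain n where n: "order Q = p ^ n" using order_power by blast
  have "card S dvd p ^ n" using lagrange[OF assms] n by (metis dvd_triv_right)
  then obtain m where "card S = p ^ m" using divides_primepow_nat[OF prime] by blast
  then show ?thesis
    using subgroup_imp_group[OF assms] prime
    by (auto simp: finite_p_group_def finite_p_group_axioms_def order_def)
qed

end

text \<open>Orbits have \<open>p\<close>-power size, and those of size 1 are the fixed points, so
  their number is congruent to \<open>card E\<close> modulo \<open>p\<close>. If \<open>x\<close>
  were the only one, \<open>p\<close> would divide 1.\<close>

lemma (in group_action) p_group_fixed_point_not_unique: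
  assumes "finite_p_group p G" "finite E" "p dvd card E" "x \<in> E" "\<And>g. g \<in> carrier G \<Longrightarrow> \<phi> g x = x"
  obtains y where "y \<in> E" "y \<noteq> x" "\<And>g. g \<in> carrier G \<Longrightarrow> \<phi> g y = y"
proof (rule ccontr)
  interpret finite_p_group p G by fact
  assume "\<not> thesis"
  note nofix = \<open>\<not> thesis\<close> that
  then have no: "\<exists>g\<in>carrier G. \<phi> g y \<noteq> y" if "y \<in> E" "y \<noteq> x" for y
    using that nofix by blast
  have part: "partition E (orbits G E \<phi>)" by (rule orbit_partition)
  have fin: "finite (orbits G E \<phi>)" unfolding orbits_def using assms(2) by (simp add: setcompr_eq_image)
  have ox: "orbit G \<phi> x = {x}" using assms(5) unfolding orbit_def by (auto intro: exI[of _ \<one>])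
  have xin: "{x} \<in> orbits G E \<phi>" using ox assms(4) unfolding orbits_def by force
  have dvd: "p dvd card O'" if "O' \<in> orbits G E \<phi> - {{x}}" for O'
  proof -
    have "\<exists>y\<in>E. O' = orbit G \<phi> y" using that unfolding orbits_def by blast
    then obtain y where y: "y \<in> E" "O' = orbit G \<phi> y" by blast
    with that ox have "y \<noteq> x" by auto
    then obtain g where g: "g \<in> carrier G" "\<phi> g y \<noteq> y" using no y by blast
    have sub: "O' \<subseteq> E" using y element_image unfolding orbit_def by blast
    then have finO: "finite O'" using assms(2) finite_subset by blast
    have "{y, \<phi> g y} \<subseteq> O'" using y g orbit_refl unfolding orbit_def by blast
    then have "card {y, \<phi> g y} \<le> card O'" using finO card_mono by blast
    then have "card O' \<noteq> 1" using g by simp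
    moreover obtain n where "order G = p ^ n" using order_power by blast
    then have "card O' dvd p ^ n" using orbit_stabilizer_theorem[OF y(1)] y(2) by (metis dvd_triv_left)
    then obtain m where "card O' = p ^ m" using divides_primepow_nat[OF prime] by blast
    ultimately show ?thesis by (cases m) auto
  qed
  have "card E = (\<Sum>O'\<in>orbits G E \<phi>. \<Sum>y\<in>O'. 1)"
    using partition.disjoint_sum[OF part assms(2), of "\<lambda>_. 1::nat"] by simp
  also have "\<dots> = sum card (orbits G E \<phi>)" by simp
  also have "\<dots> = card {x} + sum card (orbits G E \<phi> - {{x}})"
    using fin xin by (rule sum.remove)
  finally have "card E = 1 + sum card (orbits G E \<phi> - {{x}})" by simp
  moreover have "p dvd sum card (orbits G E \<phi> - {{x}})" using dvd by (rule dvd_sum)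
  ultimately have "p dvd 1" using assms(3) by (metis dvd_add_left_iff)
  then show False using prime by auto
qed

text \<open>The inverse turns right multiplication into a left action; the restriction to
  \<open>rcosets S\<close> is there because elements of \<open>BijGroup\<close> are
  extensional.\<close>

lemma (in group) right_mult_action_on_rcosets:
  assumes S: "subgroup S G"
  shows "group_action (G\<lparr>carrier := S\<rparr>) (rcosets S) (\<lambda>s. \<lambda>C\<in>rcosets S. C #> inv s)"
proof -
  have sub: "S \<subseteq> carrier G" using S subgroup.subset by blast
  have car: "C \<subseteq> carrier G" if "C \<in> rcosets S" for C
    using that S rcosets_subset_PowG by blast
  have cl: "C #> g \<in> rcosets S" if "C \<in> rcosets S" "g \<in> carrier G" for C g
    using that sub unfolding RCOSETS_def by (auto simp: coset_mult_assoc)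
  have bij: "(\<lambda>C\<in>rcosets S. C #> g) \<in> Bij (rcosets S)" if g: "g \<in> carrier G" for g
  proof -
    have "bij_betw (\<lambda>C\<in>rcosets S. C #> g) (rcosets S) (rcosets S)"
      by (rule bij_betwI[where g = "\<lambda>C. C #> inv g"])
         (use g cl car in \<open>auto simp: coset_mult_assoc\<close>)
    then show ?thesis by (simp add: Bij_def)
  qed
  have "(\<lambda>s. \<lambda>C\<in>rcosets S. C #> inv s) \<in> hom (G\<lparr>carrier := S\<rparr>) (BijGroup (rcosets S))"
  proof (rule homI)
    fix s assume "s \<in> carrier (G\<lparr>carrier := S\<rparr>)"
    then show "(\<lambda>C\<in>rcosets S. C #> inv s) \<in> carrier (BijGroup (rcosets S))"
      using bij sub by (auto simp: BijGroup_def)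
  next
    fix s t assume "s \<in> carrier (G\<lparr>carrier := S\<rparr>)" "t \<in> carrier (G\<lparr>carrier := S\<rparr>)"
    then have st: "s \<in> carrier G" "t \<in> carrier G" using sub by auto
    have "(\<lambda>C\<in>rcosets S. C #> inv (s \<otimes> t)) =
        compose (rcosets S) (\<lambda>C\<in>rcosets S. C #> inv s) (\<lambda>C\<in>rcosets S. C #> inv t)"
      unfolding compose_def using st cl car
      by (intro restrict_ext) (simp add: coset_mult_assoc inv_mult_group)
    then show "(\<lambda>C\<in>rcosets S. C #> inv (s \<otimes>\<^bsub>G\<lparr>carrier := S\<rparr>\<^esub> t)) =
        (\<lambda>C\<in>rcosets S. C #> inv s) \<otimes>\<^bsub>BijGroup (rcosets S)\<^esub> (\<lambda>C\<in>rcosets S. C #> inv t)"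
      using bij st by (simp add: BijGroup_def)
  qed
  then show ?thesis
    unfolding group_action_def group_hom_def group_hom_axioms_def
    using subgroup_imp_group[OF S] group_BijGroup by blast
qed

context finite_p_group
begin

text \<open>\<open>S\<close> acts on its right cosets by right multiplication and fixes the coset
  \<open>S\<close>. As the number of cosets is a positive power of \<open>p\<close>, a second coset
  \<open>S #> x\<close> is fixed, and this says that \<open>x\<close> conjugates \<open>S\<close>
  into itself.\<close>

lemma normalizer_grows:
  assumes S: "subgroup S Q" and ne: "S \<noteq> carrier Q"
  obtains x where "x \<in> carrier Q" "x \<notin> S" "\<And>s. s \<in> S \<Longrightarrow> x \<otimes> s \<otimes> inv x \<in> S"
proof -
  have sub: "S \<subseteq> carrier Q" using S subgroup.subset by blast
  interpret act: group_action "Q\<lparr>carrier := S\<rparr>" "rcosets S" "\<lambda>s. \<lambda>C\<in>rcosets S. C #> inv s"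
    by (rule right_mult_action_on_rcosets[OF S])
  obtain n where n: "order Q = p ^ n" using order_power by blast
  have lag: "card (rcosets S) * card S = p ^ n" using lagrange[OF S] n by simp
  then have "card (rcosets S) dvd p ^ n" by (metis dvd_triv_left)
  then obtain m where m: "card (rcosets S) = p ^ m" using divides_primepow_nat[OF prime] by blast
  have "card S < order Q"
    unfolding order_def using sub ne finite_carrier by (meson psubsetI psubset_card_mono)
  then have "m \<noteq> 0" using lag m n by (intro notI) auto
  then have dvd: "p dvd card (rcosets S)" using m by (simp add: dvd_power)
  have fin: "finite (rcosets S)" using finite_carrier sub rcosets_subset_PowG[OF S]
    by (meson finite_Pow_iff finite_subset)
  have SS: "S \<in> rcosets S" using subgroup.subgroup_in_rcosets[OF S is_group] .
  have fixS: "(\<lambda>C\<in>rcosets S. C #> inv s) S = S" if "s \<in> carrier (Q\<lparr>carrier := S\<rparr>)" for s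
    using that SS S sub by (simp add: coset_join2 subgroup.m_inv_closed subset_iff)
  obtain C where C: "C \<in> rcosets S" "C \<noteq> S"
    "\<And>s. s \<in> carrier (Q\<lparr>carrier := S\<rparr>) \<Longrightarrow> (\<lambda>C\<in>rcosets S. C #> inv s) C = C"
    using act.p_group_fixed_point_not_unique[OF subgroup_finite_p_group[OF S] fin dvd SS fixS] by blast
  obtain x where x: "x \<in> carrier Q" "C = S #> x" using C(1) unfolding RCOSETS_def by blast
  have "x \<notin> S" using C(2) x S by (metis coset_join2)
  moreover have "x \<otimes> s \<otimes> inv x \<in> S" if s: "s \<in> S" for s
  proof -
    have sc: "s \<in> carrier Q" using s sub by blast
    have "S #> x #> inv (inv s) = S #> x"
      using C(1) C(3)[of "inv s"] x s S by (simp add: subgroup.m_inv_closed)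
    then have "S #> (x \<otimes> s) = S #> x" using sc x sub by (simp add: coset_mult_assoc)
    then have "x \<otimes> s \<in> S #> x" using rcos_self[OF _ S, of "x \<otimes> s"] sc x by auto
    then show ?thesis using subgroup.rcos_module_imp[OF S is_group x(1)] by blast
  qed
  ultimately show thesis using that x by blast
qed

text \<open>A maximal proper subgroup \<open>N\<close> above \<open>S\<close> is normal: by
  \<open>normalizer_grows\<close> its normalizer \<open>K\<close> is strictly larger than
  \<open>N\<close>, hence the whole group.\<close>

lemma proper_subgroup_in_proper_normal:
  assumes "subgroup S Q" "S \<noteq> carrier Q"
  shows "\<exists>N. N \<lhd> Q \<and> S \<subseteq> N \<and> N \<noteq> carrier Q"
proof -
  define M where "M = {N. subgroup N Q \<and> S \<subseteq> N \<and> N \<noteq> carrier Q}"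
  have "M \<subseteq> Pow (carrier Q)" unfolding M_def using subgroup.subset by blast
  then have "finite M" using finite_carrier finite_subset by blast
  moreover have "S \<in> M" using assms M_def by blast
  ultimately obtain N where N: "N \<in> M" and max: "\<And>N'. N' \<in> M \<Longrightarrow> N \<subseteq> N' \<Longrightarrow> N = N'"
    using finite_has_maximal[of M] by (metis empty_iff)
  have sN: "subgroup N Q" using N M_def by blast
  then have subN: "N \<subseteq> carrier Q" using subgroup.subset by blast
  \<comment> \<open>Equality instead of inclusion makes closure under inverses immediate; for the
    element supplied by \<open>normalizer_grows\<close>, finiteness of \<open>N\<close> upgrades
    inclusion to equality.\<close>
  define K where "K = {x \<in> carrier Q. (\<lambda>s. x \<otimes> s \<otimes> inv x) ` N = N}"
  have "subgroup K Q"
  proof (rule subgroupI)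
    show "K \<subseteq> carrier Q" unfolding K_def by blast
    have "(\<lambda>s. \<one> \<otimes> s \<otimes> inv \<one>) ` N = (\<lambda>s. s) ` N"
      using subN by (intro image_cong) auto
    then have "\<one> \<in> K" unfolding K_def by simp
    then show "K \<noteq> {}" by blast
  next
    fix a assume "a \<in> K"
    then have a: "a \<in> carrier Q" "(\<lambda>s. a \<otimes> s \<otimes> inv a) ` N = N" unfolding K_def by auto
    have "(\<lambda>s. inv a \<otimes> s \<otimes> inv (inv a)) ` N = (\<lambda>s. inv a \<otimes> s \<otimes> inv (inv a)) ` (\<lambda>s. a \<otimes> s \<otimes> inv a) ` N"
      using a by simp
    also have "\<dots> = (\<lambda>s. s) ` N"
      unfolding image_image using a(1) subN
      by (intro image_cong) (auto simp: m_assoc subset_iff)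
    finally show "inv a \<in> K" using a unfolding K_def by simp
  next
    fix a b assume "a \<in> K" "b \<in> K"
    then have a: "a \<in> carrier Q" "(\<lambda>s. a \<otimes> s \<otimes> inv a) ` N = N"
      and b: "b \<in> carrier Q" "(\<lambda>s. b \<otimes> s \<otimes> inv b) ` N = N" unfolding K_def by auto
    have "(\<lambda>s. a \<otimes> b \<otimes> s \<otimes> inv (a \<otimes> b)) ` N = (\<lambda>s. a \<otimes> s \<otimes> inv a) ` (\<lambda>s. b \<otimes> s \<otimes> inv b) ` N"
      unfolding image_image using a(1) b(1) subN
      by (intro image_cong) (auto simp: m_assoc subset_iff inv_mult_group)
    then show "a \<otimes> b \<in> K" using a b unfolding K_def by simp
  qed
  moreover have "N \<subseteq> K"
  proof
    fix x assume x: "x \<in> N"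
    have "s \<in> (\<lambda>s. x \<otimes> s \<otimes> inv x) ` N" if "s \<in> N" for s
      using that x sN subN
      by (intro image_eqI[of _ _ "inv x \<otimes> s \<otimes> x"])
         (auto simp: m_assoc subset_iff subgroup.m_closed subgroup.m_inv_closed)
    then show "x \<in> K" unfolding K_def using x sN subN
      by (auto simp: subgroup.m_closed subgroup.m_inv_closed)
  qed
  moreover obtain x where x: "x \<in> carrier Q" "x \<notin> N" "\<And>s. s \<in> N \<Longrightarrow> x \<otimes> s \<otimes> inv x \<in> N"
    using normalizer_grows[OF sN] N M_def by blast
  moreover have "x \<in> K"
  proof -
    have "inj_on (\<lambda>s. x \<otimes> s \<otimes> inv x) N" using x(1) subN by (auto simp: inj_on_def subset_iff)
    moreover have "(\<lambda>s. x \<otimes> s \<otimes> inv x) ` N \<subseteq> N" using x by blast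
    moreover have "finite N" using subN finite_carrier finite_subset by blast
    ultimately have "(\<lambda>s. x \<otimes> s \<otimes> inv x) ` N = N" using endo_inj_surj by blast
    then show ?thesis using x K_def by blast
  qed
  ultimately have "K = carrier Q" using max[of K] N unfolding M_def by blast
  then have "N \<lhd> Q"
    unfolding normal_inv_iff using sN unfolding K_def by blast
  then show ?thesis using N M_def by blast
qed

text \<open>A normal subgroup that contains a conjugate of an element contains the element. So a
  proper normal subgroup around the conjugates would contain all \<open>A i\<close>, even though the
  conjugator changes with \<open>i\<close>.\<close>

lemma generate_conjugates:
  assumes A: "\<And>i. i \<in> I \<Longrightarrow> A i \<subseteq> carrier Q" and a: "\<And>i. i \<in> I \<Longrightarrow> a i \<in> carrier Q"
    and gen: "generate Q (\<Union>i\<in>I. A i) = carrier Q"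
  shows "generate Q (\<Union>i\<in>I. (\<lambda>x. a i \<otimes> x \<otimes> inv (a i)) ` A i) = carrier Q"
proof (rule ccontr)
  let ?B = "\<Union>i\<in>I. (\<lambda>x. a i \<otimes> x \<otimes> inv (a i)) ` A i"
  assume ne: "generate Q ?B \<noteq> carrier Q"
  have "?B \<subseteq> carrier Q" using A a by fastforce
  then obtain N where N: "N \<lhd> Q" "generate Q ?B \<subseteq> N" "N \<noteq> carrier Q"
    using proper_subgroup_in_proper_normal[OF generate_is_subgroup ne] by blast
  have "x \<in> N" if "i \<in> I" "x \<in> A i" for i x
  proof -
    have c: "x \<in> carrier Q" "a i \<in> carrier Q" using that A a by blast+
    have "a i \<otimes> x \<otimes> inv (a i) \<in> N" using that N(2) by (blast intro: generate.incl)
    then have "inv (a i) \<otimes> (a i \<otimes> x \<otimes> inv (a i)) \<otimes> a i \<in> N"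
      using normal.inv_op_closed1[OF N(1) c(2)] by blast
    moreover have "inv (a i) \<otimes> (a i \<otimes> x \<otimes> inv (a i)) \<otimes> a i = x"
      using c by (simp add: m_assoc)
    ultimately show ?thesis by simp
  qed
  then have "generate Q (\<Union>i\<in>I. A i) \<subseteq> N"
    by (intro generate_subgroup_incl normal_imp_subgroup[OF N(1)]) blast
  then show False using gen N normal_imp_subgroup subgroup.subset by blast
qed

end

section \<open>Profinite groups\<close>

definition open_normal :: "'a set \<Rightarrow> ('a, 'm) monoid_scheme \<Rightarrow> 'a topology \<Rightarrow> bool" where
  "open_normal V G T \<longleftrightarrow> V \<lhd> G \<and> openin T V"

context profinite_group
begin

lemma continuous_map_mult:
  assumes "continuous_map Z T f" "continuous_map Z T g"
  shows "continuous_map Z T (\<lambda>z. f z \<otimes> g z)"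
proof -
  have "continuous_map Z (prod_topology T T) (\<lambda>z. (f z, g z))"
    using assms by (simp add: continuous_map_pairedI)
  from continuous_map_compose[OF this continuous_mult] show ?thesis by (simp add: o_def)
qed

lemma continuous_map_right_mult: "x \<in> carrier G \<Longrightarrow> continuous_map T T (\<lambda>y. y \<otimes> x)"
  and continuous_map_left_mult: "x \<in> carrier G \<Longrightarrow> continuous_map T T (\<lambda>y. x \<otimes> y)"
  using continuous_map_mult[OF continuous_map_id[unfolded id_def], of "\<lambda>_. x"]
    continuous_map_mult[OF _ continuous_map_id[unfolded id_def], of "\<lambda>_. x"]
  by (simp_all add: topspace_eq)

text \<open>In a compact Hausdorff space components are quasi-components, so \<open>{\<one>}\<close>
  is one, and a clopen set separates it from the compact complement of \<open>U\<close>.\<close>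

lemma clopen_in_open:
  assumes "openin T U" "\<one> \<in> U"
  obtains C where "closedin T C" "openin T C" "\<one> \<in> C" "C \<subseteq> U"
proof -
  have "quasi_components_of T = connected_components_of T"
    using quasi_eq_connected_components_of compact hausdorff by blast
  then have "connected_component_of_set T \<one> \<in> quasi_components_of T"
    unfolding connected_components_of_def topspace_eq using one_closed by blast
  then have q: "{\<one>} \<in> quasi_components_of T"
    unfolding totally_disconnected[OF one_closed] .
  have "compactin T (topspace T - U)"
    using compact assms(1) by (intro closedin_compact_space) auto
  then have "separated_between T {\<one>} (topspace T - U)"
    unfolding separated_between_quasi_component_compact[OF q \<open>compactin T (topspace T - U)\<close>]
    using assms(2) by (simp add: disjnt_def)
  then obtain C where "closedin T C" "openin T C" "{\<one>} \<subseteq> C" "topspace T - U \<subseteq> topspace T - C"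
    unfolding separated_between by blast
  moreover from this have "C \<subseteq> U" using openin_subset by blast
  ultimately show thesis using that by blast
qed

lemma open_normal_basis:
  assumes "openin T U" "\<one> \<in> U"
  obtains V where "open_normal V G T" "V \<subseteq> U"
proof -
  obtain C where C: "closedin T C" "openin T C" "\<one> \<in> C" "C \<subseteq> U" using clopen_in_open[OF assms] .
  \<comment> \<open>The elements that can be inserted into any product of two factors without
    changing its membership in \<open>C\<close>. The condition is two-sided, so \<open>N\<close> is
    a normal subgroup at once, and \<open>a = b = \<one>\<close> gives
    \<open>N \<subseteq> C\<close>.\<close>
  define N where "N = {g \<in> carrier G. \<forall>a\<in>carrier G. \<forall>b\<in>carrier G. a \<otimes> g \<otimes> b \<in> C \<longleftrightarrow> a \<otimes> b \<in> C}"
  have "subgroup N G"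
  proof (rule subgroupI)
    show "N \<subseteq> carrier G" by (auto simp: N_def)
    show "N \<noteq> {}" unfolding N_def by (auto intro!: exI[of _ \<one>])
    fix g assume g: "g \<in> N"
    then have gc: "g \<in> carrier G" by (simp add: N_def)
    have "a \<otimes> inv g \<otimes> b \<in> C \<longleftrightarrow> a \<otimes> b \<in> C" if "a \<in> carrier G" "b \<in> carrier G" for a b
    proof -
      have "a \<otimes> g \<otimes> (inv g \<otimes> b) \<in> C \<longleftrightarrow> a \<otimes> (inv g \<otimes> b) \<in> C" using g gc that by (simp add: N_def)
      then show ?thesis using gc that by (simp add: m_assoc)
    qed
    then show "inv g \<in> N" using gc by (simp add: N_def)
    fix h assume h: "h \<in> N"
    then have hc: "h \<in> carrier G" by (simp add: N_def)
    have "a \<otimes> (g \<otimes> h) \<otimes> b \<in> C \<longleftrightarrow> a \<otimes> b \<in> C" if ab: "a \<in> carrier G" "b \<in> carrier G" for a b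
    proof -
      have "a \<otimes> g \<otimes> (h \<otimes> b) \<in> C \<longleftrightarrow> a \<otimes> (h \<otimes> b) \<in> C" using g hc ab by (simp add: N_def)
      moreover have "a \<otimes> h \<otimes> b \<in> C \<longleftrightarrow> a \<otimes> b \<in> C" using h ab by (simp add: N_def)
      ultimately show ?thesis using gc hc ab by (simp add: m_assoc)
    qed
    then show "g \<otimes> h \<in> N" using gc hc by (simp add: N_def)
  qed
  moreover have "x \<otimes> g \<otimes> inv x \<in> N" if x: "x \<in> carrier G" and g: "g \<in> N" for x g
  proof -
    have gc: "g \<in> carrier G" using g by (simp add: N_def)
    have "a \<otimes> (x \<otimes> g \<otimes> inv x) \<otimes> b \<in> C \<longleftrightarrow> a \<otimes> b \<in> C" if ab: "a \<in> carrier G" "b \<in> carrier G" for a b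
    proof -
      have "(a \<otimes> x) \<otimes> g \<otimes> (inv x \<otimes> b) \<in> C \<longleftrightarrow> (a \<otimes> x) \<otimes> (inv x \<otimes> b) \<in> C" using g x ab by (simp add: N_def)
      then show ?thesis using gc x ab by (simp add: m_assoc)
    qed
    then show ?thesis using gc x by (simp add: N_def)
  qed
  ultimately have "N \<lhd> G" using normal_inv_iff by blast
  \<comment> \<open>The complement of \<open>N\<close> is the projection of the set of triples
    \<open>(g, a, b)\<close> at which the two memberships differ. This set is closed because
    \<open>C\<close> is clopen, and projecting along the compact space of pairs
    \<open>(a, b)\<close> is a closed map.\<close>
  moreover have "openin T N"
  proof -
    let ?X = "prod_topology T (prod_topology T T)"
    let ?f = "\<lambda>z. fst (snd z) \<otimes> fst z \<otimes> snd (snd z)" and ?h = "\<lambda>z. fst (snd z) \<otimes> snd (snd z)"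
    have c1: "continuous_map ?X T (\<lambda>z. fst (snd z))" and c2: "continuous_map ?X T (\<lambda>z. snd (snd z))"
      and c3: "continuous_map ?X T fst"
      using continuous_map_compose[OF continuous_map_snd[of T "prod_topology T T"] continuous_map_fst[of T T]]
        continuous_map_compose[OF continuous_map_snd[of T "prod_topology T T"] continuous_map_snd[of T T]]
        continuous_map_fst[of T "prod_topology T T"]
      by (simp_all add: o_def)
    have f: "continuous_map ?X T ?f" and h: "continuous_map ?X T ?h"
      by (intro continuous_map_mult c1 c2 c3)+
    let ?A = "{z \<in> topspace ?X. ?f z \<in> C}" and ?B = "{z \<in> topspace ?X. ?h z \<in> C}"
    have "closedin ?X ?A" "openin ?X ?A" "closedin ?X ?B" "openin ?X ?B"
      by (rule closedin_continuous_map_preimage[OF f C(1)] openin_continuous_map_preimage[OF f C(2)]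
          closedin_continuous_map_preimage[OF h C(1)] openin_continuous_map_preimage[OF h C(2)])+
    then have "closedin ?X ((?A - ?B) \<union> (?B - ?A))" by (intro closedin_Un closedin_diff)
    moreover have "closed_map ?X T fst"
      using compact by (intro closed_map_fst) (simp add: compact_space_prod_topology)
    ultimately have cl: "closedin T (fst ` ((?A - ?B) \<union> (?B - ?A)))" by (simp only: closed_map_def)
    have "N = topspace T - fst ` ((?A - ?B) \<union> (?B - ?A))"
    proof -
      have "g \<in> fst ` ((?A - ?B) \<union> (?B - ?A)) \<longleftrightarrow> g \<in> carrier G \<and> g \<notin> N" for g
      proof
        assume "g \<in> fst ` ((?A - ?B) \<union> (?B - ?A))"
        then obtain z where "z \<in> (?A - ?B) \<union> (?B - ?A)" "g = fst z" by (rule imageE)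
        then show "g \<in> carrier G \<and> g \<notin> N"
          unfolding N_def by (cases z) (auto simp: topspace_eq)
      next
        assume "g \<in> carrier G \<and> g \<notin> N"
        then obtain a b where "g \<in> carrier G" "a \<in> carrier G" "b \<in> carrier G" "\<not> (a \<otimes> g \<otimes> b \<in> C \<longleftrightarrow> a \<otimes> b \<in> C)"
          unfolding N_def by blast
        then show "g \<in> fst ` ((?A - ?B) \<union> (?B - ?A))"
          by (intro image_eqI[of _ _ "(g, a, b)"]) (auto simp: topspace_eq)
      qed
      moreover have "N \<subseteq> carrier G" unfolding N_def by blast
      ultimately show ?thesis by (auto simp: topspace_eq simp del: topspace_prod_topology)
    qed
    then show ?thesis using openin_diff[OF openin_topspace cl] by simp
  qed
  moreover have "N \<subseteq> C"
  proof
    fix g assume "g \<in> N"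
    then have "g \<in> carrier G" "\<one> \<otimes> g \<otimes> \<one> \<in> C \<longleftrightarrow> \<one> \<otimes> \<one> \<in> C" unfolding N_def by blast+
    then show "g \<in> C" using C(3) by simp
  qed
  ultimately show thesis using that C(4) unfolding open_normal_def by blast
qed

lemma open_normal_subgroup: "open_normal V G T \<Longrightarrow> subgroup V G"
  unfolding open_normal_def by (simp add: normal_imp_subgroup)

lemma open_normal_subset: "open_normal V G T \<Longrightarrow> V \<subseteq> carrier G"
  using open_normal_subgroup subgroup.subset by blast

lemma open_normal_Int:
  "open_normal V G T \<Longrightarrow> open_normal W G T \<Longrightarrow> open_normal (V \<inter> W) G T"
  unfolding open_normal_def by (simp add: normal_subgroup_intersect openin_Int)

lemma open_normal_carrier: "open_normal (carrier G) G T"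
  unfolding open_normal_def using normal_self by (metis openin_topspace topspace_eq)

lemma open_normal_finite_refine:
  assumes "finite F" "open_normal V0 G T"
    and "\<And>x. x \<in> F \<Longrightarrow> \<exists>V. open_normal V G T \<and> P x V"
    and "\<And>x V W. P x V \<Longrightarrow> W \<subseteq> V \<Longrightarrow> P x W"
  shows "\<exists>V. open_normal V G T \<and> V \<subseteq> V0 \<and> (\<forall>x\<in>F. P x V)"
  using assms(1,3)
proof (induction F)
  case empty
  then show ?case using assms(2) by blast
next
  case (insert x F)
  then obtain V W where "open_normal V G T" "V \<subseteq> V0" "\<forall>x\<in>F. P x V" "open_normal W G T" "P x W" by blast
  then show ?case using assms(4) open_normal_Int by (intro exI[of _ "V \<inter> W"]) blast
qed

text \<open>Both \<open>A\<close> and its complement are unions of left cosets of \<open>V\<close>,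
  each of them open. Topological conditions thereby become algebraic ones.\<close>

lemma
  assumes V: "open_normal V G T" and A: "A \<subseteq> carrier G" "\<And>a v. a \<in> A \<Longrightarrow> v \<in> V \<Longrightarrow> a \<otimes> v \<in> A"
  shows openin_saturated: "openin T A" and closedin_saturated: "closedin T A"
proof -
  have op: "openin T B" if B: "B \<subseteq> carrier G" "\<And>a v. a \<in> B \<Longrightarrow> v \<in> V \<Longrightarrow> a \<otimes> v \<in> B" for B
  proof (subst openin_subopen, intro ballI exI conjI)
    fix b assume b: "b \<in> B"
    then have bc: "b \<in> carrier G" using B by blast
    show "openin T {y \<in> topspace T. inv b \<otimes> y \<in> V}"
      using V bc by (intro openin_continuous_map_preimage[OF continuous_map_left_mult]) (auto simp: open_normal_def)
    show "b \<in> {y \<in> topspace T. inv b \<otimes> y \<in> V}"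
      using bc subgroup.one_closed[OF open_normal_subgroup[OF V]] by (simp add: topspace_eq)
    show "{y \<in> topspace T. inv b \<otimes> y \<in> V} \<subseteq> B"
    proof
      fix y assume "y \<in> {y \<in> topspace T. inv b \<otimes> y \<in> V}"
      then have "b \<otimes> (inv b \<otimes> y) \<in> B" "y \<in> carrier G" using B(2)[OF b] by (auto simp: topspace_eq)
      then show "y \<in> B" using bc by simp
    qed
  qed
  show "openin T A" using op A by blast
  have "a \<otimes> v \<notin> A" if "a \<in> carrier G - A" "v \<in> V" for a v
  proof
    assume "a \<otimes> v \<in> A"
    moreover have vc: "v \<in> carrier G" using that open_normal_subset[OF V] by blast
    ultimately have "a \<otimes> v \<otimes> inv v \<in> A" using A(2) that(2) open_normal_subgroup[OF V] subgroup.m_inv_closed by metis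
    then show False using that(1) vc by (simp add: m_assoc)
  qed
  then have "openin T (carrier G - A)" using op[of "carrier G - A"] open_normal_subset[OF V] by blast
  then show "closedin T A" using A(1) by (simp add: closedin_def topspace_eq)
qed

text \<open>The compactness behind the passage from \<open>H\<close> to \<open>H <#> V\<close>. Each
  point \<open>c\<close> of the compact set \<open>C - U\<close> has a neighbourhood
  \<open>c <# V c\<close> that misses \<open>H\<close>. Finitely many of these cover
  \<open>C - U\<close>, and each absorbs right multiplication by the intersection \<open>W\<close>
  of the \<open>V c\<close>, so \<open>H <#> W\<close> misses \<open>C - U\<close> too.\<close>

lemma closed_separate:
  assumes C: "closedin T C" and H: "closedin T H" and U: "openin T U" and CHU: "C \<inter> H \<subseteq> U"
  shows "\<exists>V. open_normal V G T \<and> (\<forall>h\<in>H. \<forall>v\<in>V. h \<otimes> v \<in> C \<longrightarrow> h \<otimes> v \<in> U)"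
proof -
  have cpt: "compactin T (C - U)" using C U compact by (intro closedin_compact_space closedin_diff)
  have Hc: "H \<subseteq> carrier G" using H closedin_subset topspace_eq by blast
  have CU: "C - U \<subseteq> carrier G" using C closedin_subset topspace_eq by blast
  have "\<exists>V. open_normal V G T \<and> (\<forall>v\<in>V. c \<otimes> v \<notin> H)" if c: "c \<in> C - U" for c
  proof -
    have cc: "c \<in> carrier G" using c CU by blast
    have "openin T {y \<in> topspace T. c \<otimes> y \<in> topspace T - H}"
      using H by (intro openin_continuous_map_preimage[OF continuous_map_left_mult[OF cc]]) auto
    moreover have "\<one> \<in> {y \<in> topspace T. c \<otimes> y \<in> topspace T - H}"
      using cc c CHU by (auto simp: topspace_eq)
    ultimately obtain V where "open_normal V G T" "V \<subseteq> {y \<in> topspace T. c \<otimes> y \<in> topspace T - H}"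
      by (rule open_normal_basis)
    then show ?thesis by blast
  qed
  then have "\<forall>c\<in>C - U. \<exists>V. open_normal V G T \<and> (\<forall>v\<in>V. c \<otimes> v \<notin> H)" by (rule ballI)
  from bchoice[OF this] obtain V where "\<forall>c\<in>C - U. open_normal (V c) G T \<and> (\<forall>v\<in>V c. c \<otimes> v \<notin> H)" ..
  then have V: "\<And>c. c \<in> C - U \<Longrightarrow> open_normal (V c) G T"
    "\<And>c v. c \<in> C - U \<Longrightarrow> v \<in> V c \<Longrightarrow> c \<otimes> v \<notin> H" by simp_all
  define O' where "O' c = {y \<in> topspace T. inv c \<otimes> y \<in> V c}" for c
  have "openin T (O' c)" if "c \<in> C - U" for c
    unfolding O'_def using V(1)[OF that] that CU
    by (intro openin_continuous_map_preimage[OF continuous_map_left_mult]) (auto simp: open_normal_def)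
  moreover have "C - U \<subseteq> \<Union>(O' ` (C - U))"
  proof
    fix c assume c: "c \<in> C - U"
    then have "c \<in> O' c" unfolding O'_def using CU subgroup.one_closed[OF open_normal_subgroup[OF V(1)[OF c]]]
      by (auto simp: topspace_eq subset_iff)
    then show "c \<in> \<Union>(O' ` (C - U))" using c by blast
  qed
  ultimately obtain F where F: "finite F" "F \<subseteq> O' ` (C - U)" "C - U \<subseteq> \<Union>F"
    using compactinD[OF cpt, of "O' ` (C - U)"] by blast
  obtain E where E: "finite E" "E \<subseteq> C - U" "F = O' ` E" using finite_subset_image[OF F(1,2)] by blast
  have "\<exists>W. open_normal W G T \<and> W \<subseteq> carrier G \<and> (\<forall>c\<in>E. W \<subseteq> V c)"
    using V(1) E(2) by (intro open_normal_finite_refine[OF E(1) open_normal_carrier]) blast+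
  then obtain W where W: "open_normal W G T" "\<And>c. c \<in> E \<Longrightarrow> W \<subseteq> V c" by blast
  have "h \<otimes> v \<in> U" if hv: "h \<in> H" "v \<in> W" "h \<otimes> v \<in> C" for h v
  proof (rule ccontr)
    assume "h \<otimes> v \<notin> U"
    then obtain c where c: "c \<in> E" "h \<otimes> v \<in> O' c" using hv F(3) E(3) by blast
    then have cm: "c \<in> C - U" "c \<in> carrier G" using E CU by blast+
    have vc: "v \<in> carrier G" "h \<in> carrier G" using hv open_normal_subset[OF W(1)] Hc by blast+
    note sg = open_normal_subgroup[OF V(1)[OF cm(1)]]
    have "inv c \<otimes> (h \<otimes> v) \<in> V c" using c(2) unfolding O'_def by blast
    moreover have "inv v \<in> V c" using subgroup.m_inv_closed[OF sg] W(2)[OF c(1)] hv(2) by blast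
    ultimately have "inv c \<otimes> (h \<otimes> v) \<otimes> inv v \<in> V c" by (rule subgroup.m_closed[OF sg])
    then have "c \<otimes> (inv c \<otimes> (h \<otimes> v) \<otimes> inv v) \<notin> H" using V(2)[OF cm(1)] by blast
    then show False using cm vc hv(1) by (simp add: m_assoc)
  qed
  then show ?thesis using W(1) by blast
qed

section \<open>Continuous homomorphisms and closed subgroups\<close>

lemma continuous_hom_kernel_nbhd:
  assumes f: "f \<in> continuous_hom (G\<lparr>carrier := K\<rparr>) (subtopology T K) P TP" and K: "subgroup K G"
    and P: "group P" and N: "openin TP N" "\<one>\<^bsub>P\<^esub> \<in> N"
  obtains V where "open_normal V G T" "\<And>v. v \<in> V \<inter> K \<Longrightarrow> f v \<in> N"
proof -
  have Kc: "K \<subseteq> carrier G" using K subgroup.subset by blast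
  have "openin (subtopology T K) {y \<in> topspace (subtopology T K). f y \<in> N}"
    using f N(1) unfolding continuous_hom_def by (blast intro: openin_continuous_map_preimage)
  then obtain U where U: "openin T U" "{y \<in> topspace (subtopology T K). f y \<in> N} = U \<inter> K"
    unfolding openin_subtopology by blast
  have "group_hom (G\<lparr>carrier := K\<rparr>) P f"
    using f P subgroup_imp_group[OF K] by (simp add: group_hom_def group_hom_axioms_def continuous_hom_def)
  then have "f \<one> = \<one>\<^bsub>P\<^esub>" using group_hom.hom_one by fastforce
  then have "\<one> \<in> U \<inter> K"
    using N(2) subgroup.one_closed[OF K] Kc unfolding U(2)[symmetric] by (auto simp: topspace_eq)
  then obtain V where "open_normal V G T" "V \<subseteq> U" using open_normal_basis[OF U(1)] by blast
  then show thesis using that U(2) by blast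
qed

lemma profinite_group_closed_subgroup:
  assumes "closed_subgroup H G T"
  shows "profinite_group (G\<lparr>carrier := H\<rparr>) (subtopology T H)"
proof -
  have H: "subgroup H G" "closedin T H" using assms by (auto simp: closed_subgroup_def)
  have Hc: "H \<subseteq> carrier G" using H subgroup.subset by blast
  show ?thesis
  proof (intro profinite_group.intro profinite_group_axioms.intro)
    show "group (G\<lparr>carrier := H\<rparr>)" by (rule subgroup_imp_group[OF H(1)])
    show tH: "topspace (subtopology T H) = carrier (G\<lparr>carrier := H\<rparr>)"
      using Hc by (auto simp: topspace_eq)
    have "continuous_map (subtopology (prod_topology T T) (H \<times> H)) T (\<lambda>(x, y). x \<otimes> y)"
      by (rule continuous_map_from_subtopology[OF continuous_mult])
    then show "continuous_map (prod_topology (subtopology T H) (subtopology T H)) (subtopology T H)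
        (\<lambda>(x, y). x \<otimes>\<^bsub>G\<lparr>carrier := H\<rparr>\<^esub> y)"
      unfolding subtopology_Times[symmetric] continuous_map_in_subtopology
      using H(1) by (auto simp: subgroup.m_closed)
    have "continuous_map (subtopology T H) (subtopology T H) (\<lambda>x. inv x)"
      unfolding continuous_map_in_subtopology
      using continuous_map_from_subtopology[OF continuous_inv] H(1) by (auto simp: subgroup.m_inv_closed)
    then show "continuous_map (subtopology T H) (subtopology T H) (\<lambda>x. inv\<^bsub>G\<lparr>carrier := H\<rparr>\<^esub> x)"
      by (rule continuous_map_eq) (simp add: m_inv_consistent[OF H(1)])
    show "compact_space (subtopology T H)"
      using compact H(2) closedin_compact_space compact_space_subtopology by blast
    show "Hausdorff_space (subtopology T H)" using hausdorff Hausdorff_space_subtopology by blast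
    fix x assume x: "x \<in> carrier (G\<lparr>carrier := H\<rparr>)"
    then have xc: "x \<in> carrier G" "x \<in> topspace (subtopology T H)" using Hc tH by auto
    have "connected_component_of_set (subtopology T H) x \<subseteq> connected_component_of_set T x"
      unfolding connected_component_of_def by (auto simp: connectedin_subtopology)
    then have "connected_component_of_set (subtopology T H) x \<subseteq> {x}"
      using totally_disconnected[OF xc(1)] by simp
    moreover have "x \<in> connected_component_of_set (subtopology T H) x"
      using xc by (simp add: connected_component_of_refl)
    ultimately show "connected_component_of_set (subtopology T H) x = {x}" by blast
  qed
qed

end

lemma hom_comp: "f \<in> hom G H \<Longrightarrow> g \<in> hom H K \<Longrightarrow> (\<lambda>x. g (f x)) \<in> hom G K"
  by (simp add: hom_def Pi_iff)

text \<open>With the kernel inside \<open>N\<close>, cosets of \<open>N\<close> are unions of fibres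
  of \<open>h\<close>, so distinct cosets keep distinct images. This serves to read off the index of
  \<open>N\<close> in a finite quotient.\<close>

lemma (in group_hom) bij_betw_rcosets_image:
  assumes N: "subgroup N G" and ker: "kernel G H h \<subseteq> N"
  shows "bij_betw ((`) h) (rcosets\<^bsub>G\<^esub> N) (rcosets\<^bsub>H\<lparr>carrier := h ` carrier G\<rparr>\<^esub> (h ` N))"
proof -
  have Nc: "N \<subseteq> carrier G" using N subgroup.subset by blast
  have im: "h ` (N #>\<^bsub>G\<^esub> x) = h ` N #>\<^bsub>H\<^esub> h x" if "x \<in> carrier G" for x
    using that Nc unfolding r_coset_def by (force simp: subset_iff)
  show ?thesis
  proof (rule bij_betw_imageI)
    show "inj_on ((`) h) (rcosets\<^bsub>G\<^esub> N)"
    proof (rule inj_onI)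
      fix A B assume "A \<in> rcosets\<^bsub>G\<^esub> N" "B \<in> rcosets\<^bsub>G\<^esub> N" and eq: "h ` A = h ` B"
      then obtain x y where xy: "x \<in> carrier G" "y \<in> carrier G" "A = N #>\<^bsub>G\<^esub> x" "B = N #>\<^bsub>G\<^esub> y"
        unfolding RCOSETS_def by blast
      have "x \<in> A" using xy G.rcos_self[OF _ N] by blast
      then have "h x \<in> h ` B" using eq by blast
      then obtain n where n: "n \<in> N" "h x = h (n \<otimes>\<^bsub>G\<^esub> y)" unfolding xy(4) r_coset_def by blast
      have nc: "n \<in> carrier G" using n Nc by blast
      have "x \<otimes>\<^bsub>G\<^esub> inv\<^bsub>G\<^esub> (n \<otimes>\<^bsub>G\<^esub> y) \<in> kernel G H h"
        unfolding kernel_def using n(2) nc xy by (simp del: hom_mult add: hom_mult[of x])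
      then have "x \<otimes>\<^bsub>G\<^esub> inv\<^bsub>G\<^esub> (n \<otimes>\<^bsub>G\<^esub> y) \<in> N" using ker by blast
      then have "x \<otimes>\<^bsub>G\<^esub> inv\<^bsub>G\<^esub> (n \<otimes>\<^bsub>G\<^esub> y) \<otimes>\<^bsub>G\<^esub> n \<in> N" using n N subgroup.m_closed by metis
      moreover have "x \<otimes>\<^bsub>G\<^esub> inv\<^bsub>G\<^esub> (n \<otimes>\<^bsub>G\<^esub> y) \<otimes>\<^bsub>G\<^esub> n = x \<otimes>\<^bsub>G\<^esub> inv\<^bsub>G\<^esub> y"
        using xy nc by (simp add: G.inv_mult_group G.m_assoc)
      ultimately have "x \<in> N #>\<^bsub>G\<^esub> y" using subgroup.rcos_module_rev[OF N] xy by (simp add: G.is_group)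
      then show "A = B" using xy G.repr_independence[OF _ xy(2) N] by metis
    qed
    show "(`) h ` (rcosets\<^bsub>G\<^esub> N) = rcosets\<^bsub>H\<lparr>carrier := h ` carrier G\<rparr>\<^esub> (h ` N)"
      unfolding RCOSETS_def using im by auto
  qed
qed

context pro_p_group
begin

lemma finite_p_group_Mod:
  assumes "prime p" "open_normal V G T"
  shows "finite_p_group p (G Mod V)"
  using assms open_normal_index normal.factorgroup_is_group unfolding open_normal_def
  by (auto simp: finite_p_group_def finite_p_group_axioms_def order_def FactGroup_def)

text \<open>An open normal subgroup \<open>N\<close> of \<open>H\<close> contains
  \<open>V \<inter> H\<close> for some open normal \<open>V\<close> of \<open>G\<close>. Its index
  can then be computed in the image of \<open>H\<close> in \<open>G Mod V\<close>, a subgroup of a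
  finite \<open>p\<close>-group.\<close>

lemma pro_p_group_closed_subgroup:
  assumes p: "prime p" and "closed_subgroup H G T"
  shows "pro_p_group p (G\<lparr>carrier := H\<rparr>) (subtopology T H)"
proof (intro pro_p_group.intro pro_p_group_axioms.intro)
  show "profinite_group (G\<lparr>carrier := H\<rparr>) (subtopology T H)"
    by (rule profinite_group_closed_subgroup[OF assms(2)])
  then interpret H: profinite_group "G\<lparr>carrier := H\<rparr>" "subtopology T H" .
  have H: "subgroup H G" using assms(2) by (simp add: closed_subgroup_def)
  have Hc: "H \<subseteq> carrier G" using H subgroup.subset by blast
  fix N assume N: "N \<lhd> G\<lparr>carrier := H\<rparr>" "openin (subtopology T H) N"
  have sN: "subgroup N (G\<lparr>carrier := H\<rparr>)" using N(1) normal_imp_subgroup by blast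
  have NH: "N \<subseteq> H" using subgroup.subset[OF sN] by simp
  obtain U where U: "openin T U" "N = U \<inter> H" using N(2) unfolding openin_subtopology by blast
  have "\<one> \<in> U" using subgroup.one_closed[OF sN] U(2) by simp
  then obtain V where V: "open_normal V G T" "V \<subseteq> U" using open_normal_basis[OF U(1)] by blast
  interpret B: finite_p_group p "G Mod V" by (rule finite_p_group_Mod[OF p V(1)])
  have nV: "V \<lhd> G" using V(1) unfolding open_normal_def by blast
  interpret h: group_hom "G\<lparr>carrier := H\<rparr>" "G Mod V" "\<lambda>x. V #> x"
  proof (intro group_hom.intro group_hom_axioms.intro)
    show "(\<lambda>x. V #> x) \<in> hom (G\<lparr>carrier := H\<rparr>) (G Mod V)"
      using normal.r_coset_hom_Mod[OF nV] Hc unfolding hom_def by (simp add: Pi_iff subset_iff)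
  qed (rule H.is_group B.is_group)+
  have "kernel (G\<lparr>carrier := H\<rparr>) (G Mod V) (\<lambda>x. V #> x) \<subseteq> N"
  proof
    fix x assume "x \<in> kernel (G\<lparr>carrier := H\<rparr>) (G Mod V) (\<lambda>x. V #> x)"
    then have x: "x \<in> H" "V #> x = V" by (auto simp: kernel_def)
    then have "x \<in> V" using rcos_self[OF _ open_normal_subgroup[OF V(1)], of x] Hc by blast
    then show "x \<in> N" using x V(2) U(2) by blast
  qed
  from bij_betw_same_card[OF h.bij_betw_rcosets_image[OF sN this]]
  have c: "card (rcosets\<^bsub>G\<lparr>carrier := H\<rparr>\<^esub> N) =
    card (rcosets\<^bsub>(G Mod V)\<lparr>carrier := (\<lambda>x. V #> x) ` H\<rparr>\<^esub> ((\<lambda>x. V #> x) ` N))" by simp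
  have "subgroup ((\<lambda>x. V #> x) ` H) (G Mod V)" using h.img_is_subgroup by simp
  then interpret C: finite_p_group p "(G Mod V)\<lparr>carrier := (\<lambda>x. V #> x) ` H\<rparr>"
    by (rule B.subgroup_finite_p_group)
  have "subgroup ((\<lambda>x. V #> x) ` N) (G Mod V)" using h.subgroup_img_is_subgroup[OF sN] .
  then have "subgroup ((\<lambda>x. V #> x) ` N) ((G Mod V)\<lparr>carrier := (\<lambda>x. V #> x) ` H\<rparr>)"
    using NH C.is_group by (intro group.subgroup_incl[OF B.is_group _ \<open>subgroup ((\<lambda>x. V #> x) ` H) (G Mod V)\<close>]) auto
  then have "card (rcosets\<^bsub>G\<lparr>carrier := H\<rparr>\<^esub> N) dvd order ((G Mod V)\<lparr>carrier := (\<lambda>x. V #> x) ` H\<rparr>)"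
    unfolding c using C.lagrange by (metis dvd_triv_left)
  then show "\<exists>k. card (rcosets\<^bsub>G\<lparr>carrier := H\<rparr>\<^esub> N) = p ^ k"
    using C.order_power divides_primepow_nat[OF p] by metis
qed

end

context profinite_group
begin

lemma open_normal_Int_subgroup:
  assumes "open_normal V G T" "subgroup K G"
  shows "open_normal (V \<inter> K) (G\<lparr>carrier := K\<rparr>) (subtopology T K)"
  using assms normal_Int_subgroup[of K V] unfolding open_normal_def
  by (metis Int_commute openin_subtopology_Int)

text \<open>The two homomorphisms agree on a subgroup that is a union of cosets of \<open>V\<close>,
  hence closed. Asking for agreement on \<open>V\<close> in place of continuity keeps the target
  free of any topology.\<close>

lemma homs_eq_if_eq_on_generators:
  assumes gen: "topologically_generated_by G T X" and X: "X \<subseteq> carrier G"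
    and Q: "group Q" and g: "g \<in> hom G Q" and g': "g' \<in> hom G Q"
    and V: "open_normal V G T" "\<And>v. v \<in> V \<Longrightarrow> g v = g' v"
    and eq: "\<And>x. x \<in> X \<Longrightarrow> g x = g' x" and x: "x \<in> carrier G"
  shows "g x = g' x"
proof -
  interpret g: group_hom G Q g using Q g by (simp add: group_hom_def group_hom_axioms_def)
  interpret g': group_hom G Q g' using Q g' by (simp add: group_hom_def group_hom_axioms_def)
  define E where "E = {y \<in> carrier G. g y = g' y}"
  have E: "subgroup E G"
    by (rule subgroupI) (auto simp: E_def intro: exI[of _ \<one>])
  have "generate G X \<subseteq> E" using eq X by (intro generate_subgroup_incl[OF _ E]) (auto simp: E_def)
  moreover have "closedin T E"
    using V open_normal_subset[OF V(1)]
    by (intro closedin_saturated[OF V(1)]) (auto simp: E_def)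
  ultimately have "carrier G \<subseteq> E"
    using gen closure_of_minimal unfolding topologically_generated_by_def by metis
  then show ?thesis using x E_def by blast
qed

text \<open>Translations reduce continuity to continuity at 1, where the open normal subgroups of
  the target form a basis of neighbourhoods.\<close>

lemma continuous_homI:
  assumes P: "profinite_group P TP" and f: "f \<in> hom G P"
    and N: "\<And>N. open_normal N P TP \<Longrightarrow> \<exists>V. open_normal V G T \<and> f ` V \<subseteq> N"
  shows "f \<in> continuous_hom G T P TP"
proof -
  interpret P: profinite_group P TP by fact
  interpret f: group_hom G P f using f by (simp add: group_hom_def group_hom_axioms_def)
  have "openin T {x \<in> topspace T. f x \<in> U}" if U: "openin TP U" for U
  proof (subst openin_subopen, intro ballI)
    fix x assume "x \<in> {x \<in> topspace T. f x \<in> U}"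
    then have x: "x \<in> carrier G" "f x \<in> U" by (auto simp: topspace_eq)
    have "openin TP {y \<in> topspace TP. f x \<otimes>\<^bsub>P\<^esub> y \<in> U}"
      by (intro openin_continuous_map_preimage[OF P.continuous_map_left_mult U]) (simp add: x)
    moreover have "\<one>\<^bsub>P\<^esub> \<in> {y \<in> topspace TP. f x \<otimes>\<^bsub>P\<^esub> y \<in> U}" using x by (simp add: P.topspace_eq)
    ultimately obtain M where M: "open_normal M P TP" "M \<subseteq> {y \<in> topspace TP. f x \<otimes>\<^bsub>P\<^esub> y \<in> U}"
      by (rule P.open_normal_basis)
    then obtain V where V: "open_normal V G T" "f ` V \<subseteq> M" using N by blast
    have Vc: "V \<subseteq> carrier G" by (rule open_normal_subset[OF V(1)])
    let ?A = "x <# V"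
    have "openin T ?A"
    proof (rule openin_saturated[OF V(1)])
      show "?A \<subseteq> carrier G" using x Vc by (simp add: l_coset_subset_G)
      fix a v assume "a \<in> ?A" and v: "v \<in> V"
      then obtain w where w: "w \<in> V" "a = x \<otimes> w" unfolding l_coset_def by blast
      have "w \<otimes> v \<in> V" using w v open_normal_subgroup[OF V(1)] subgroup.m_closed by metis
      moreover have "a \<otimes> v = x \<otimes> (w \<otimes> v)" using w v x Vc by (auto simp: m_assoc subset_iff)
      ultimately show "a \<otimes> v \<in> ?A" unfolding l_coset_def by blast
    qed
    moreover have "x \<in> ?A"
      using x subgroup.one_closed[OF open_normal_subgroup[OF V(1)]] unfolding l_coset_def by force
    moreover have "?A \<subseteq> {x \<in> topspace T. f x \<in> U}"
      using x V(2) M(2) Vc unfolding l_coset_def by (force simp: topspace_eq subset_iff)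
    ultimately show "\<exists>A. openin T A \<and> x \<in> A \<and> A \<subseteq> {x \<in> topspace T. f x \<in> U}" by blast
  qed
  moreover have "f ` topspace T \<subseteq> topspace TP" by (auto simp: topspace_eq P.topspace_eq)
  ultimately have "continuous_map T TP f" by (auto simp: continuous_map)
  then show ?thesis using f by (simp add: continuous_hom_def)
qed

end

section \<open>Finite \<open>p\<close>-groups as discrete targets\<close>

lemma (in finite_p_group) pro_p_group_discrete: "pro_p_group p Q (discrete_topology (carrier Q))"
proof (intro pro_p_group.intro pro_p_group_axioms.intro profinite_group.intro profinite_group_axioms.intro)
  show "continuous_map (prod_topology (discrete_topology (carrier Q)) (discrete_topology (carrier Q)))
      (discrete_topology (carrier Q)) (\<lambda>(x, y). x \<otimes> y)"
    by (auto simp flip: prod_topology_discrete_topology)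
  show "compact_space (discrete_topology (carrier Q))"
    using finite_carrier by (simp add: compact_space_discrete_topology)
  fix x assume "x \<in> carrier Q"
  then show "connected_component_of_set (discrete_topology (carrier Q)) x = {x}"
    by (metis connected_component_of_discrete_topology)
next
  fix N assume "N \<lhd> Q"
  then have "card (rcosets N) dvd order Q" using lagrange normal_imp_subgroup by (metis dvd_triv_left)
  then show "\<exists>k. card (rcosets N) = p ^ k"
    using order_power divides_primepow_nat[OF prime] by metis
qed (auto simp: is_group)

context pro_p_group
begin

text \<open>Carries the universal property from the type \<open>'u\<close> to a finite
  \<open>p\<close>-group of any type: the infinite type \<open>'u\<close> has a subset of the right
  size, onto which the group structure is copied. All later uses of the universal property of
  \<open>G\<close> go through this lemma, so the targets for \<open>H\<close> may live in a type
  unrelated to \<open>'u\<close>. The subgroup \<open>V\<close> yields continuity of the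
  \<open>f i\<close> and, since almost all \<open>S i\<close> lie in \<open>V\<close>, also their
  convergence to 1.\<close>

lemma finite_universal_property:
  fixes Q :: "('q, 'w) monoid_scheme" and I :: "'i set"
  assumes free: "restricted_free_pro_p_product TYPE('u::infinite) p G T I S"
    and Q: "finite_p_group p Q" and f: "\<And>i. i \<in> I \<Longrightarrow> f i \<in> hom (G\<lparr>carrier := S i\<rparr>) Q"
    and V: "open_normal V G T" and fV: "\<And>i v. i \<in> I \<Longrightarrow> v \<in> V \<inter> S i \<Longrightarrow> f i v = \<one>\<^bsub>Q\<^esub>"
  shows "\<exists>g W. g \<in> hom G Q \<and> open_normal W G T \<and> (\<forall>w\<in>W. g w = \<one>\<^bsub>Q\<^esub>) \<and>
    (\<forall>i\<in>I. \<forall>x\<in>S i. g x = f i x)"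
proof -
  interpret Q: finite_p_group p Q by fact
  have S: "closed_subgroup (S i) G T" if "i \<in> I" for i
    using free that by (simp add: restricted_free_pro_p_product_def)
  have conv: "converges_to_1 G T I S" using free by (simp add: restricted_free_pro_p_product_def)
  obtain E :: "'u set" where E: "finite E" "card E = card (carrier Q)"
    using infinite_arbitrarily_large[OF infinite_UNIV] by blast
  obtain e where e: "bij_betw e (carrier Q) E"
    using finite_same_card_bij[OF Q.finite_carrier E(1)] E(2) by metis
  define d where "d = inv_into (carrier Q) e"
  have de: "d (e q) = q" if "q \<in> carrier Q" for q
    unfolding d_def using e that by (simp add: bij_betw_def)
  define P :: "'u monoid" where
    "P = \<lparr>carrier = E, monoid.mult = (\<lambda>x y. e (d x \<otimes>\<^bsub>Q\<^esub> d y)), one = e \<one>\<^bsub>Q\<^esub>\<rparr>"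
  have carP: "carrier P = E" and oneP: "\<one>\<^bsub>P\<^esub> = e \<one>\<^bsub>Q\<^esub>"
    and multP: "\<And>x y. x \<otimes>\<^bsub>P\<^esub> y = e (d x \<otimes>\<^bsub>Q\<^esub> d y)" by (simp_all add: P_def)
  have eE: "e q \<in> E" if "q \<in> carrier Q" for q using e that bij_betwE by blast
  have dE: "d y \<in> carrier Q" "e (d y) = y" if "y \<in> E" for y
    unfolding d_def using e that by (auto simp: bij_betw_def inv_into_into f_inv_into_f)
  have "group P"
  proof (rule groupI)
    fix x assume "x \<in> carrier P"
    then show "\<exists>y\<in>carrier P. y \<otimes>\<^bsub>P\<^esub> x = \<one>\<^bsub>P\<^esub>"
      by (intro bexI[of _ "e (inv\<^bsub>Q\<^esub> d x)"]) (simp_all add: carP multP oneP de dE eE)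
  qed (simp_all add: carP multP oneP de dE eE Q.m_assoc)
  moreover have "order P = order Q" unfolding order_def carP using E by simp
  ultimately have P: "finite_p_group p P"
    using Q.prime Q.order_power by (simp add: finite_p_group_def finite_p_group_axioms_def)
  interpret P: finite_p_group p P by (rule P)
  interpret PP: pro_p_group p P "discrete_topology (carrier P)" by (rule P.pro_p_group_discrete)
  have eh: "e \<in> hom Q P" by (rule homI) (simp_all add: carP multP eE de)
  have dh: "d \<in> hom P Q" by (rule homI) (simp_all add: carP multP dE de)
  have ef: "(\<lambda>x. e (f i x)) \<in> hom (G\<lparr>carrier := S i\<rparr>) P" if "i \<in> I" for i
    using hom_comp[OF f[OF that] eh] .
  have "(\<lambda>x. e (f i x)) \<in> continuous_hom (G\<lparr>carrier := S i\<rparr>) (subtopology T (S i)) P (discrete_topology (carrier P))"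
    if i: "i \<in> I" for i
  proof -
    interpret Si: profinite_group "G\<lparr>carrier := S i\<rparr>" "subtopology T (S i)"
      by (rule profinite_group_closed_subgroup[OF S[OF i]])
    show ?thesis
    proof (rule Si.continuous_homI[OF PP.profinite_group_axioms ef[OF i]])
      fix N assume "open_normal N P (discrete_topology (carrier P))"
      then have "\<one>\<^bsub>P\<^esub> \<in> N" using PP.open_normal_subgroup subgroup.one_closed by metis
      then show "\<exists>V. open_normal V (G\<lparr>carrier := S i\<rparr>) (subtopology T (S i)) \<and> (\<lambda>x. e (f i x)) ` V \<subseteq> N"
        using open_normal_Int_subgroup[OF V, of "S i"] S[OF i] fV[OF i] unfolding closed_subgroup_def
        by (intro exI[of _ "V \<inter> S i"]) (auto simp: oneP)
    qed
  qed
  moreover have "converges_to_1 P (discrete_topology (carrier P)) I (\<lambda>i. (\<lambda>x. e (f i x)) ` S i)"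
    unfolding converges_to_1_def
  proof (intro allI impI)
    fix U assume U: "subgroup U P"
    have "finite {i \<in> I. \<not> S i \<subseteq> V}"
      using conv V open_normal_subgroup[OF V] unfolding converges_to_1_def open_normal_def by blast
    moreover have "(\<lambda>x. e (f i x)) ` S i \<subseteq> U" if "i \<in> I" "S i \<subseteq> V" for i
      using fV[OF that(1)] that(2) subgroup.one_closed[OF U] oneP by auto
    ultimately show "finite {i \<in> I. \<not> (\<lambda>x. e (f i x)) ` S i \<subseteq> U}"
      by (elim rev_finite_subset) blast
  qed
  ultimately have "\<exists>!g. g \<in> continuous_hom G T P (discrete_topology (carrier P)) \<and> g \<in> extensional (carrier G) \<and>
      (\<forall>i\<in>I. \<forall>x\<in>S i. g x = e (f i x))"
    using free PP.pro_p_group_axioms unfolding restricted_free_pro_p_product_def by simp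
  then obtain g where g: "g \<in> continuous_hom G T P (discrete_topology (carrier P))"
    "\<And>i x. i \<in> I \<Longrightarrow> x \<in> S i \<Longrightarrow> g x = e (f i x)"
    by blast
  have "subtopology T (carrier G) = T" by (metis subtopology_topspace topspace_eq)
  then have g': "g \<in> continuous_hom (G\<lparr>carrier := carrier G\<rparr>) (subtopology T (carrier G)) P (discrete_topology (carrier P))"
    using g(1) by simp
  obtain W where W: "open_normal W G T" "\<And>v. v \<in> W \<inter> carrier G \<Longrightarrow> g v \<in> {\<one>\<^bsub>P\<^esub>}"
    by (rule continuous_hom_kernel_nbhd[OF g' subgroup_self P.is_group, of "{\<one>\<^bsub>P\<^esub>}"]) auto
  have gh: "g \<in> hom G P" using g(1) by (simp add: continuous_hom_def)
  show ?thesis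
  proof (intro exI[of _ "\<lambda>x. d (g x)"] exI[of _ W] conjI ballI)
    show "(\<lambda>x. d (g x)) \<in> hom G Q" using hom_comp[OF gh dh] .
    show "d (g w) = \<one>\<^bsub>Q\<^esub>" if "w \<in> W" for w
      using W(2)[of w] that open_normal_subset[OF W(1)] oneP de by auto
    show "d (g x) = f i x" if "i \<in> I" "x \<in> S i" for i x
      using g(2)[OF that] de hom_in_carrier[OF f[OF that(1)], of x] that by simp
  qed (rule W(1))
qed

end

section \<open>Wreath products and conjugate subgroups\<close>

text \<open>\<open>act\<close> is a right action. With this product,
  \<open>g \<mapsto> (C g, \<pi> g)\<close> is a homomorphism when \<open>\<pi>\<close> is one and
  \<open>C (g h) w = C g w \<otimes> C h (act w (\<pi> g))\<close>, which is the cocycle rule.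
  Extensional functions keep the carrier finite for finite data.\<close>

definition wreath_product ::
    "('q, 'w) monoid_scheme \<Rightarrow> ('b, 'v) monoid_scheme \<Rightarrow> 'x set \<Rightarrow> ('x \<Rightarrow> 'b \<Rightarrow> 'x)
      \<Rightarrow> (('x \<Rightarrow> 'q) \<times> 'b) monoid" where
  "wreath_product Q B \<Omega> act =
    \<lparr>carrier = (\<Omega> \<rightarrow>\<^sub>E carrier Q) \<times> carrier B,
     monoid.mult = (\<lambda>(c, s) (d, t). (\<lambda>w\<in>\<Omega>. c w \<otimes>\<^bsub>Q\<^esub> d (act w s), s \<otimes>\<^bsub>B\<^esub> t)),
     one = (\<lambda>w\<in>\<Omega>. \<one>\<^bsub>Q\<^esub>, \<one>\<^bsub>B\<^esub>)\<rparr>"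

lemma finite_p_group_wreath_product:
  assumes Q: "finite_p_group p Q" and B: "finite_p_group p B" and \<Omega>: "finite \<Omega>"
    and act: "\<And>w s. w \<in> \<Omega> \<Longrightarrow> s \<in> carrier B \<Longrightarrow> act w s \<in> \<Omega>"
      "\<And>w s t. w \<in> \<Omega> \<Longrightarrow> s \<in> carrier B \<Longrightarrow> t \<in> carrier B \<Longrightarrow> act (act w s) t = act w (s \<otimes>\<^bsub>B\<^esub> t)"
      "\<And>w. w \<in> \<Omega> \<Longrightarrow> act w \<one>\<^bsub>B\<^esub> = w"
  shows "finite_p_group p (wreath_product Q B \<Omega> act)"
proof -
  interpret Q: finite_p_group p Q by fact
  interpret B: finite_p_group p B by fact
  let ?W = "wreath_product Q B \<Omega> act"
  have "group ?W"
  proof (rule groupI)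
    fix x y assume "x \<in> carrier ?W" "y \<in> carrier ?W"
    then show "x \<otimes>\<^bsub>?W\<^esub> y \<in> carrier ?W"
      by (auto simp: wreath_product_def act PiE_iff)
  next
    show "\<one>\<^bsub>?W\<^esub> \<in> carrier ?W" by (auto simp: wreath_product_def)
  next
    fix x y z assume "x \<in> carrier ?W" "y \<in> carrier ?W" "z \<in> carrier ?W"
    then show "x \<otimes>\<^bsub>?W\<^esub> y \<otimes>\<^bsub>?W\<^esub> z = x \<otimes>\<^bsub>?W\<^esub> (y \<otimes>\<^bsub>?W\<^esub> z)"
      by (auto simp: wreath_product_def act PiE_iff Q.m_assoc B.m_assoc)
  next
    fix x assume "x \<in> carrier ?W"
    then obtain c s where x: "x = (c, s)" "c \<in> \<Omega> \<rightarrow>\<^sub>E carrier Q" "s \<in> carrier B"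
      by (auto simp: wreath_product_def)
    have "(\<lambda>w\<in>\<Omega>. \<one>\<^bsub>Q\<^esub> \<otimes>\<^bsub>Q\<^esub> c (act w \<one>\<^bsub>B\<^esub>)) = c"
    proof
      fix w show "(\<lambda>w\<in>\<Omega>. \<one>\<^bsub>Q\<^esub> \<otimes>\<^bsub>Q\<^esub> c (act w \<one>\<^bsub>B\<^esub>)) w = c w"
        using x(2) by (cases "w \<in> \<Omega>") (auto simp: act PiE_iff extensional_def)
    qed
    then show "\<one>\<^bsub>?W\<^esub> \<otimes>\<^bsub>?W\<^esub> x = x"
      using x by (simp add: wreath_product_def cong: restrict_cong)
    show "\<exists>y\<in>carrier ?W. y \<otimes>\<^bsub>?W\<^esub> x = \<one>\<^bsub>?W\<^esub>"
      using x by (intro bexI[of _ "(\<lambda>w\<in>\<Omega>. inv\<^bsub>Q\<^esub> c (act w (inv\<^bsub>B\<^esub> s)), inv\<^bsub>B\<^esub> s)"])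
        (auto simp: wreath_product_def act PiE_iff)
  qed
  moreover obtain m n where "order Q = p ^ m" "order B = p ^ n"
    using Q.order_power B.order_power by blast
  then have "order ?W = p ^ (m * card \<Omega> + n)"
    using \<Omega> by (simp add: order_def wreath_product_def card_cartesian_product card_PiE power_add power_mult)
  ultimately show ?thesis
    using Q.prime unfolding finite_p_group_def finite_p_group_axioms_def by blast
qed

text \<open>\<open>L <#> V\<close> modulo \<open>V\<close> is \<open>L\<close> modulo
  \<open>V \<inter> L\<close>, through which \<open>u\<close> factors. Needed because stabilizers
  formed with \<open>H'\<close> lie only in \<open>L i x <#> V0\<close>, and \<open>u\<close> is
  given on \<open>L i x\<close>.\<close>

lemma (in group) hom_extend_along_normal:
  assumes L: "subgroup L G" and V: "V \<lhd> G" and Q: "group Q" and u: "u \<in> hom (G\<lparr>carrier := L\<rparr>) Q"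
    and uV: "\<And>v. v \<in> V \<inter> L \<Longrightarrow> u v = \<one>\<^bsub>Q\<^esub>"
  shows "\<exists>u'. u' \<in> hom (G\<lparr>carrier := L <#> V\<rparr>) Q \<and> (\<forall>l\<in>L. u' l = u l) \<and> (\<forall>v\<in>V. u' v = \<one>\<^bsub>Q\<^esub>)"
proof -
  interpret Q: group Q by fact
  interpret V: normal V G by fact
  interpret L: subgroup L G by fact
  interpret u: group_hom "G\<lparr>carrier := L\<rparr>" Q u
    using u Q subgroup_imp_group[OF L] by (simp add: group_hom_def group_hom_axioms_def)
  define u' where "u' y = u (SOME l. l \<in> L \<and> inv l \<otimes> y \<in> V)" for y
  have u'_eq: "u' y = u l" if "l \<in> L" "inv l \<otimes> y \<in> V" "y \<in> carrier G" for l y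
  proof -
    define l' where "l' = (SOME l. l \<in> L \<and> inv l \<otimes> y \<in> V)"
    have l': "l' \<in> L" "inv l' \<otimes> y \<in> V"
      using someI[of "\<lambda>l. l \<in> L \<and> inv l \<otimes> y \<in> V" l] that unfolding l'_def by blast+
    have "(inv l' \<otimes> y) \<otimes> inv (inv l \<otimes> y) \<in> V" using l' that by blast
    moreover have "(inv l' \<otimes> y) \<otimes> inv (inv l \<otimes> y) = inv l' \<otimes> l"
      using l' that by (simp add: inv_mult_group m_assoc)
    ultimately have "inv l' \<otimes> l \<in> V \<inter> L" using l' that by simp
    then have "u (inv l' \<otimes> l) = \<one>\<^bsub>Q\<^esub>" by (rule uV)
    moreover have "u l = u (l' \<otimes> (inv l' \<otimes> l))" using l' that by simp
    moreover have "u (l' \<otimes> (inv l' \<otimes> l)) = u l' \<otimes>\<^bsub>Q\<^esub> u (inv l' \<otimes> l)"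
      using u.hom_mult[of l' "inv l' \<otimes> l"] l' that by simp
    ultimately have "u l = u l'" using l' by simp
    then show ?thesis by (simp add: u'_def l'_def)
  qed
  show ?thesis
  proof (intro exI[of _ u'] conjI ballI)
    show "u' \<in> hom (G\<lparr>carrier := L <#> V\<rparr>) Q"
    proof (rule homI)
      fix y assume "y \<in> carrier (G\<lparr>carrier := L <#> V\<rparr>)"
      then obtain l v where y: "l \<in> L" "v \<in> V" "y = l \<otimes> v" unfolding set_mult_def by auto
      then have "u' y = u l" by (intro u'_eq) auto
      then show "u' y \<in> carrier Q" using y by simp
      fix z assume "z \<in> carrier (G\<lparr>carrier := L <#> V\<rparr>)"
      then obtain m w where z: "m \<in> L" "w \<in> V" "z = m \<otimes> w" unfolding set_mult_def by auto
      have c: "l \<in> carrier G" "v \<in> carrier G" "m \<in> carrier G" "w \<in> carrier G" using y z by auto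
      have "u' z = u m" using z by (intro u'_eq) auto
      moreover have "(inv m \<otimes> v \<otimes> m) \<otimes> w \<in> V" using y z c V.inv_op_closed1 by blast
      then have "inv (l \<otimes> m) \<otimes> (y \<otimes> z) \<in> V" using c unfolding y z by (simp add: inv_mult_group m_assoc)
      then have "u' (y \<otimes> z) = u (l \<otimes> m)" using y z c by (intro u'_eq) auto
      ultimately show "u' (y \<otimes>\<^bsub>G\<lparr>carrier := L <#> V\<rparr>\<^esub> z) = u' y \<otimes>\<^bsub>Q\<^esub> u' z"
        using \<open>u' y = u l\<close> u.hom_mult[of l m] y z by simp
    qed
    show "u' l = u l" if "l \<in> L" for l using that by (intro u'_eq) auto
    show "u' v = \<one>\<^bsub>Q\<^esub>" if "v \<in> V" for v
      using that u'_eq[of \<one> v] u.hom_one by simp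
  qed
qed

lemma (in group) mem_conjugate_iff:
  assumes "x \<in> carrier G" "K \<subseteq> carrier G"
  shows "y \<in> conjugate G x K \<longleftrightarrow> y \<in> carrier G \<and> inv x \<otimes> y \<otimes> x \<in> K"
proof
  assume "y \<in> conjugate G x K"
  then obtain k where "k \<in> K" "y = x \<otimes> k \<otimes> inv x" unfolding conjugate_def l_coset_def r_coset_def by blast
  then show "y \<in> carrier G \<and> inv x \<otimes> y \<otimes> x \<in> K" using assms by (auto simp: m_assoc subset_iff)
next
  assume y: "y \<in> carrier G \<and> inv x \<otimes> y \<otimes> x \<in> K"
  then have "y = x \<otimes> (inv x \<otimes> y \<otimes> x) \<otimes> inv x" using assms by (simp add: m_assoc)
  then show "y \<in> conjugate G x K" using y unfolding conjugate_def l_coset_def r_coset_def by blast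
qed

lemma (in group) subgroup_conjugate:
  assumes "x \<in> carrier G" "subgroup K G" shows "subgroup (conjugate G x K) G"
proof -
  interpret K: subgroup K G by fact
  note mem = mem_conjugate_iff[OF assms(1) K.subset]
  show ?thesis
  proof (rule subgroupI)
    show "conjugate G x K \<subseteq> carrier G" using mem by blast
    have "\<one> \<in> conjugate G x K" using mem assms by simp
    then show "conjugate G x K \<noteq> {}" by blast
  next
    fix a assume "a \<in> conjugate G x K"
    then have a: "a \<in> carrier G" "inv x \<otimes> a \<otimes> x \<in> K" using mem by blast+
    then have "inv (inv x \<otimes> a \<otimes> x) \<in> K" by blast
    then show "inv a \<in> conjugate G x K" using a assms(1) by (simp add: mem inv_mult_group m_assoc)
    fix b assume "b \<in> conjugate G x K"
    then have b: "b \<in> carrier G" "inv x \<otimes> b \<otimes> x \<in> K" using mem by blast+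
    then have "(inv x \<otimes> a \<otimes> x) \<otimes> (inv x \<otimes> b \<otimes> x) \<in> K" using a by blast
    then show "a \<otimes> b \<in> conjugate G x K" using a b assms(1) by (simp add: mem m_assoc)
  qed
qed

lemma (in profinite_group) closedin_double_translate:
  assumes "closedin T K" "x \<in> carrier G" "y \<in> carrier G"
  shows "closedin T {g \<in> carrier G. x \<otimes> g \<otimes> y \<in> K}"
proof -
  have "continuous_map T T (\<lambda>g. x \<otimes> g \<otimes> y)"
    using continuous_map_compose[OF continuous_map_left_mult[OF assms(2)] continuous_map_right_mult[OF assms(3)]]
    by (simp add: o_def)
  from closedin_continuous_map_preimage[OF this assms(1)] show ?thesis by (simp add: topspace_eq)
qed

lemma (in profinite_group) closed_subgroup_conjugate:
  assumes "closed_subgroup K G T" "x \<in> carrier G"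
  shows "closed_subgroup (conjugate G x K) G T"
proof -
  have K: "subgroup K G" "closedin T K" using assms by (auto simp: closed_subgroup_def)
  have "conjugate G x K = {g \<in> carrier G. inv x \<otimes> g \<otimes> x \<in> K}"
    using mem_conjugate_iff[OF assms(2) subgroup.subset[OF K(1)]] by blast
  then show ?thesis
    using closedin_double_translate[OF K(2), of "inv x" x] subgroup_conjugate[OF assms(2) K(1)] assms(2)
    by (simp add: closed_subgroup_def)
qed

section \<open>The subgroup \<open>H\<close> with its double coset representatives, and its open
  enlargements\<close>

locale subgroup_with_representatives = pro_p_group p G T
  for p and G :: "('a, 'm) monoid_scheme" (structure) and T +
  fixes I :: "'i set" and S :: "'i \<Rightarrow> 'a set" and H :: "'a set" and D :: "'i \<Rightarrow> 'a set"
  assumes prime: "prime p"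
    and H: "closed_subgroup H G T"
    and S: "\<And>i. i \<in> I \<Longrightarrow> closed_subgroup (S i) G T"
    and converges: "converges_to_1 G T I S"
    and generated: "topologically_generated_by G T (\<Union>i\<in>I. S i)"
    and D_finite: "\<And>i. i \<in> I \<Longrightarrow> finite (D i)"
    and D_carrier: "\<And>i. i \<in> I \<Longrightarrow> D i \<subseteq> carrier G"
    and D_cover: "\<And>i g. i \<in> I \<Longrightarrow> g \<in> carrier G \<Longrightarrow> \<exists>x\<in>D i. \<exists>h\<in>H. \<exists>k\<in>S i. g = h \<otimes> x \<otimes> k"
    and D_unique: "\<And>i x y h k. i \<in> I \<Longrightarrow> x \<in> D i \<Longrightarrow> y \<in> D i \<Longrightarrow> h \<in> H \<Longrightarrow> k \<in> S i
      \<Longrightarrow> y = h \<otimes> x \<otimes> k \<Longrightarrow> x = y"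
begin

abbreviation L :: "'i \<Rightarrow> 'a \<Rightarrow> 'a set" where
  "L i x \<equiv> H \<inter> conjugate G x (S i)"

lemma H_subgroup: "subgroup H G" and H_closed: "closedin T H"
  using H by (auto simp: closed_subgroup_def)

lemma H_carrier: "h \<in> H \<Longrightarrow> h \<in> carrier G"
  using H_subgroup subgroup.mem_carrier by metis

lemma S_subgroup: "i \<in> I \<Longrightarrow> subgroup (S i) G" and S_closed: "i \<in> I \<Longrightarrow> closedin T (S i)"
  using S by (auto simp: closed_subgroup_def)

lemma S_carrier: "i \<in> I \<Longrightarrow> k \<in> S i \<Longrightarrow> k \<in> carrier G"
  using S_subgroup subgroup.mem_carrier by metis

lemma D_in_carrier: "i \<in> I \<Longrightarrow> x \<in> D i \<Longrightarrow> x \<in> carrier G"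
  using D_carrier by blast

lemma L_subgroup: "i \<in> I \<Longrightarrow> x \<in> D i \<Longrightarrow> subgroup (L i x) G"
  using subgroups_Inter_pair[OF H_subgroup subgroup_conjugate[OF D_in_carrier S_subgroup]] .

lemma conjugate_closed: "i \<in> I \<Longrightarrow> x \<in> D i \<Longrightarrow> closedin T (conjugate G x (S i))"
  using closed_subgroup_conjugate[OF S D_in_carrier] by (simp add: closed_subgroup_def)

lemma mem_conjugate: "i \<in> I \<Longrightarrow> x \<in> D i \<Longrightarrow> y \<in> conjugate G x (S i) \<longleftrightarrow> y \<in> carrier G \<and> inv x \<otimes> y \<otimes> x \<in> S i"
  by (rule mem_conjugate_iff[OF D_in_carrier subgroup.subset[OF S_subgroup]])

text \<open>Enlarging \<open>H\<close> by a small open normal subgroup keeps the double cosets of the finitely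
  many \<open>S i\<close> not contained in \<open>V0\<close> apart, and enlarges \<open>H \<inter> x S i x\<^sup>-\<^sup>1\<close> by elements of \<open>V0\<close> only.\<close>

lemma separating_open_normal:
  assumes V0: "open_normal V0 G T" and J: "finite J" "J \<subseteq> I"
  shows "\<exists>V. open_normal V G T \<and> V \<subseteq> V0 \<and>
    (\<forall>i\<in>J. \<forall>x\<in>D i. \<forall>h\<in>H. \<forall>v\<in>V. h \<otimes> v \<in> conjugate G x (S i) \<longrightarrow> h \<otimes> v \<in> L i x <#> V0) \<and>
    (\<forall>i\<in>J. \<forall>x\<in>D i. \<forall>y\<in>D i. \<forall>h\<in>H. \<forall>v\<in>V. \<forall>k\<in>S i. h \<otimes> v = x \<otimes> k \<otimes> inv y \<longrightarrow> x = y)"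
proof -
  define A where "A V i x \<longleftrightarrow> (\<forall>h\<in>H. \<forall>v\<in>V. h \<otimes> v \<in> conjugate G x (S i) \<longrightarrow> h \<otimes> v \<in> L i x <#> V0)" for V i x
  define B where "B V i x y \<longleftrightarrow> (\<forall>h\<in>H. \<forall>v\<in>V. \<forall>k\<in>S i. h \<otimes> v = x \<otimes> k \<otimes> inv y \<longrightarrow> x = y)" for V i x y
  define P where "P z V \<longleftrightarrow> (case z of (i, x, y) \<Rightarrow> A V i x \<and> B V i x y)" for z V
  define F where "F = (SIGMA i:J. D i \<times> D i)"
  have F: "finite F" unfolding F_def using J D_finite by (intro finite_SigmaI finite_cartesian_product) auto
  have ex: "\<exists>V. open_normal V G T \<and> P z V" if z_in: "z \<in> F" for z
  proof -
    obtain i x y where z: "z = (i, x, y)" and "i \<in> J" and x: "x \<in> D i" and y: "y \<in> D i"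
      using z_in unfolding F_def by (cases z) auto
    then have i: "i \<in> I" using J by blast
    have xy: "x \<in> carrier G" "y \<in> carrier G" using x y D_in_carrier[OF i] by auto
    have Lc: "L i x \<subseteq> carrier G" using subgroup.subset[OF L_subgroup[OF i x]] .
    have op: "openin T (L i x <#> V0)"
    proof (rule openin_saturated[OF V0])
      show "L i x <#> V0 \<subseteq> carrier G" using Lc open_normal_subset[OF V0] by (rule setmult_subset_G)
      fix a v assume "a \<in> L i x <#> V0" and v: "v \<in> V0"
      then obtain l w where lw: "l \<in> L i x" "w \<in> V0" "a = l \<otimes> w" unfolding set_mult_def by blast
      then have "a \<otimes> v = l \<otimes> (w \<otimes> v)" using v Lc open_normal_subset[OF V0] by (auto simp: m_assoc subset_iff)
      moreover have "w \<otimes> v \<in> V0" using lw v subgroup.m_closed[OF open_normal_subgroup[OF V0]] by blast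
      ultimately show "a \<otimes> v \<in> L i x <#> V0" using lw unfolding set_mult_def by blast
    qed
    have sub: "conjugate G x (S i) \<inter> H \<subseteq> L i x <#> V0"
    proof
      fix l assume l: "l \<in> conjugate G x (S i) \<inter> H"
      then have "l = l \<otimes> \<one>" using H_carrier by simp
      then show "l \<in> L i x <#> V0"
        using l subgroup.one_closed[OF open_normal_subgroup[OF V0]] unfolding set_mult_def by blast
    qed
    obtain V1 where V1: "open_normal V1 G T"
      "\<And>h v. h \<in> H \<Longrightarrow> v \<in> V1 \<Longrightarrow> h \<otimes> v \<in> conjugate G x (S i) \<Longrightarrow> h \<otimes> v \<in> L i x <#> V0"
      using closed_separate[OF conjugate_closed[OF i x] H_closed op sub] by blast
    obtain V2 where V2: "open_normal V2 G T" "B V2 i x y"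
    proof (cases "x = y")
      case True
      then show ?thesis using that[OF open_normal_carrier] by (simp add: B_def)
    next
      case False
      \<comment> \<open>This is \<open>x (S i) y\<^sup>-\<^sup>1\<close>. It misses \<open>H\<close>
        because \<open>x\<close> and \<open>y\<close> represent different double cosets, so
        \<open>closed_separate\<close> with the empty open set makes it miss a whole
        \<open>H <#> V2\<close>.\<close>
      let ?C = "{g \<in> carrier G. inv x \<otimes> g \<otimes> y \<in> S i}"
      have cl: "closedin T ?C" using xy by (intro closedin_double_translate S_closed i) auto
      have sub': "?C \<inter> H \<subseteq> {}"
      proof
        fix h assume "h \<in> ?C \<inter> H"
        then have h: "h \<in> H" "h \<in> carrier G" "inv x \<otimes> h \<otimes> y \<in> S i" by auto
        have "y = inv h \<otimes> x \<otimes> (inv x \<otimes> h \<otimes> y)" using h xy by (simp add: m_assoc)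
        then have "x = y" using D_unique[OF i x y _ h(3)] subgroup.m_inv_closed[OF H_subgroup h(1)] by blast
        then show "h \<in> {}" using False by blast
      qed
      obtain V2 where V2: "open_normal V2 G T" "\<And>h v. h \<in> H \<Longrightarrow> v \<in> V2 \<Longrightarrow> h \<otimes> v \<notin> ?C"
        using closed_separate[OF cl H_closed openin_empty sub'] by blast
      have "B V2 i x y"
      proof -
        have "h \<otimes> v \<noteq> x \<otimes> k \<otimes> inv y" if hvk: "h \<in> H" "v \<in> V2" "k \<in> S i" for h v k
        proof
          assume "h \<otimes> v = x \<otimes> k \<otimes> inv y"
          moreover have "x \<otimes> k \<otimes> inv y \<in> ?C"
            using hvk(3) xy S_carrier[OF i hvk(3)] by (simp add: m_assoc)
          ultimately show False using V2(2)[OF hvk(1,2)] by simp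
        qed
        then show ?thesis unfolding B_def by simp
      qed
      then show ?thesis using that V2(1) by blast
    qed
    have "A (V1 \<inter> V2) i x" "B (V1 \<inter> V2) i x y" using V1 V2 unfolding A_def B_def by blast+
    then show ?thesis using open_normal_Int[OF V1(1) V2(1)] unfolding P_def z by auto
  qed
  have mono: "P z W" if P: "P z V" "W \<subseteq> V" for z V W
  proof -
    have "A W i x" if "A V i x" for i x using that P(2) unfolding A_def by (simp add: subset_iff)
    moreover have "B W i x y" if B: "B V i x y" for i x y
      unfolding B_def
    proof (intro ballI impI)
      fix h v k assume "h \<in> H" "v \<in> W" "k \<in> S i" "h \<otimes> v = x \<otimes> k \<otimes> inv y"
      with B P(2) show "x = y" unfolding B_def by blast
    qed
    ultimately show ?thesis using P(1) unfolding P_def by (cases z) simp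
  qed
  have "\<exists>V. open_normal V G T \<and> V \<subseteq> V0 \<and> (\<forall>z\<in>F. P z V)"
    by (rule open_normal_finite_refine[OF F V0 ex mono])
  then obtain V where V: "open_normal V G T" "V \<subseteq> V0" "\<And>z. z \<in> F \<Longrightarrow> P z V"
    by blast
  have AB: "A V i x \<and> B V i x y" if "i \<in> J" "x \<in> D i" "y \<in> D i" for i x y
  proof -
    have "P (i, x, y) V" using that by (intro V(3)) (simp add: F_def)
    then show ?thesis unfolding P_def by simp
  qed
  then have "\<forall>i\<in>J. \<forall>x\<in>D i. A V i x" "\<forall>i\<in>J. \<forall>x\<in>D i. \<forall>y\<in>D i. B V i x y" by simp_all
  then show ?thesis using V(1,2) unfolding A_def B_def by (intro exI[of _ V]) simp
qed

end

section \<open>Extension to \<open>H\<close> up to conjugation, for finite targets\<close>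

lemma (in monoid) set_multI: "h \<in> H \<Longrightarrow> k \<in> K \<Longrightarrow> h \<otimes> k \<in> H <#> K"
  unfolding set_mult_def by blast

context subgroup_with_representatives
begin

text \<open>Only the \<open>S i\<close> with \<open>i\<close> in the finite set \<open>J\<close> can
  carry a nontrivial \<open>u i x\<close>, because for the others \<open>L i x\<close> lies in
  \<open>V0\<close>. So finitely many conditions on \<open>V\<close> suffice, and one finite wreath
  product serves all \<open>i\<close>. The element \<open>a i x\<close> records the passage from the
  coset \<open>H'\<close> to the base point \<open>H' #> x\<close>.\<close>

lemma conjugate_extension:
  fixes Q :: "('q, 'w) monoid_scheme"
  assumes free: "restricted_free_pro_p_product TYPE('u::infinite) p G T I S"
    and Q: "finite_p_group p Q" and V0: "open_normal V0 G T"
    and u: "\<And>i x. i \<in> I \<Longrightarrow> x \<in> D i \<Longrightarrow> u i x \<in> hom (G\<lparr>carrier := L i x\<rparr>) Q"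
    and uV: "\<And>i x v. i \<in> I \<Longrightarrow> x \<in> D i \<Longrightarrow> v \<in> V0 \<inter> L i x \<Longrightarrow> u i x v = \<one>\<^bsub>Q\<^esub>"
  shows "\<exists>g W a. g \<in> hom (G\<lparr>carrier := H\<rparr>) Q \<and> open_normal W G T \<and> (\<forall>w\<in>W \<inter> H. g w = \<one>\<^bsub>Q\<^esub>) \<and>
    (\<forall>i\<in>I. \<forall>x\<in>D i. a i x \<in> carrier Q \<and> (\<forall>y\<in>L i x. g y = a i x \<otimes>\<^bsub>Q\<^esub> u i x y \<otimes>\<^bsub>Q\<^esub> inv\<^bsub>Q\<^esub> a i x))"
proof -
  interpret Q: finite_p_group p Q by fact
  have nV0: "V0 \<lhd> G" using V0 by (simp add: open_normal_def)
  interpret V0: normal V0 G by (rule nV0)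
  define J where "J = {i \<in> I. \<not> S i \<subseteq> V0}"
  have J: "finite J" "J \<subseteq> I"
    using converges V0 open_normal_subgroup[OF V0] unfolding converges_to_1_def open_normal_def J_def by auto
  obtain V where V: "open_normal V G T" "V \<subseteq> V0"
    and sep: "\<forall>i\<in>J. \<forall>x\<in>D i. \<forall>h\<in>H. \<forall>v\<in>V. h \<otimes> v \<in> conjugate G x (S i) \<longrightarrow> h \<otimes> v \<in> L i x <#> V0"
    "\<forall>i\<in>J. \<forall>x\<in>D i. \<forall>y\<in>D i. \<forall>h\<in>H. \<forall>v\<in>V. \<forall>k\<in>S i. h \<otimes> v = x \<otimes> k \<otimes> inv y \<longrightarrow> x = y"
    using separating_open_normal[OF V0 J] by (elim exE conjE)
  have nV: "V \<lhd> G" using V by (simp add: open_normal_def)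
  interpret V: normal V G by (rule nV)
  interpret B: finite_p_group p "G Mod V" by (rule finite_p_group_Mod[OF prime V(1)])
  have carB: "carrier (G Mod V) = (\<lambda>g. V #> g) ` carrier G" by (rule carrier_FactGroup)
  define H' where "H' = H <#> V"
  have H': "subgroup H' G"
    unfolding H'_def using mult_norm_subgroup[OF nV H_subgroup] commut_normal[OF H_subgroup nV] by simp
  interpret H': subgroup H' G by (rule H')
  have HH': "h \<in> H'" if "h \<in> H" for h
    using set_multI[OF that V.one_closed] H_carrier[OF that] by (simp add: H'_def)
  have VH': "v \<in> H'" if "v \<in> V" for v
    using set_multI[OF subgroup.one_closed[OF H_subgroup] that] V.subset that by (simp add: H'_def subset_iff)
  define \<Omega> where "\<Omega> = rcosets H'"
  \<comment> \<open>As \<open>V\<close> is normal and contained in \<open>H'\<close>, multiplying a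
    coset of \<open>H'\<close> by a coset of \<open>V\<close> as sets gives a single coset of
    \<open>H'\<close>; thus right multiplication by \<open>G\<close> descends to
    \<open>G Mod V\<close>.\<close>
  define act where "act w s = w <#> s" for w s
  have \<Omega>E: "\<exists>g\<in>carrier G. w = H' #> g" if "w \<in> \<Omega>" for w
    using that unfolding \<Omega>_def RCOSETS_def by blast
  have \<Omega>I: "H' #> g \<in> \<Omega>" if "g \<in> carrier G" for g
    using that unfolding \<Omega>_def RCOSETS_def by blast
  have act_eq: "(H' #> g) <#> (V #> t) = H' #> (g \<otimes> t)" if gt: "g \<in> carrier G" "t \<in> carrier G" for g t
  proof (intro equalityI subsetI)
    fix z assume "z \<in> (H' #> g) <#> (V #> t)"
    then obtain h v where z: "h \<in> H'" "v \<in> V" "z = (h \<otimes> g) \<otimes> (v \<otimes> t)"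
      unfolding set_mult_def r_coset_def by blast
    have "h \<otimes> (g \<otimes> v \<otimes> inv g) \<in> H'" using z VH' V.inv_op_closed2[OF gt(1)] by blast
    moreover have "z = h \<otimes> (g \<otimes> v \<otimes> inv g) \<otimes> (g \<otimes> t)" using z gt by (simp add: m_assoc)
    ultimately show "z \<in> H' #> (g \<otimes> t)" unfolding r_coset_def by blast
  next
    fix z assume "z \<in> H' #> (g \<otimes> t)"
    then obtain h where "h \<in> H'" "z = h \<otimes> (g \<otimes> t)" unfolding r_coset_def by blast
    then have "h \<in> H'" "z = (h \<otimes> g) \<otimes> (\<one> \<otimes> t)" using gt by (simp_all add: m_assoc)
    then show "z \<in> (H' #> g) <#> (V #> t)" unfolding set_mult_def r_coset_def using V.one_closed by blast
  qed
  have step: "H' #> g #> t = H' #> (g \<otimes> t)" if "g \<in> carrier G" "t \<in> carrier G" for g t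
    using that by (simp add: coset_mult_assoc H'.subset)
  have act_coset: "act w (V #> t) = w #> t" if w: "w \<in> \<Omega>" "t \<in> carrier G" for w t
  proof -
    obtain g where "g \<in> carrier G" "w = H' #> g" using \<Omega>E[OF w(1)] by blast
    then show ?thesis using act_eq[of g t] step[of g t] w(2) by (simp add: act_def)
  qed
  have rc: "w #> t \<in> \<Omega>" if w: "w \<in> \<Omega>" "t \<in> carrier G" for w t
  proof -
    obtain g where g: "g \<in> carrier G" "w = H' #> g" using \<Omega>E[OF w(1)] by blast
    then show ?thesis using w by (simp add: step \<Omega>I)
  qed
  have rc_mult: "w #> s #> t = w #> (s \<otimes> t)" if w: "w \<in> \<Omega>" "s \<in> carrier G" "t \<in> carrier G" for w s t
  proof -
    obtain g where g: "g \<in> carrier G" "w = H' #> g" using \<Omega>E[OF w(1)] by blast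
    then show ?thesis using w by (simp add: step m_assoc)
  qed
  have rc_one: "w #> \<one> = w" if w: "w \<in> \<Omega>" for w
  proof -
    obtain g where g: "g \<in> carrier G" "w = H' #> g" using \<Omega>E[OF w] by blast
    then show ?thesis by (simp add: step)
  qed
  have "\<Omega> \<subseteq> (\<lambda>s. act H' s) ` carrier (G Mod V)"
  proof
    fix w assume "w \<in> \<Omega>"
    then obtain g where g: "g \<in> carrier G" "w = H' #> g" using \<Omega>E by blast
    then have "w = act H' (V #> g)" using act_eq[of \<one> g] H'.subset by (simp add: act_def)
    then show "w \<in> (\<lambda>s. act H' s) ` carrier (G Mod V)" using g carB by blast
  qed
  then have \<Omega>fin: "finite \<Omega>" using B.finite_carrier finite_surj by blast
  define W where "W = wreath_product Q (G Mod V) \<Omega> act"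
  have W: "finite_p_group p W"
    unfolding W_def
  proof (rule finite_p_group_wreath_product[OF Q B.finite_p_group_axioms \<Omega>fin])
    fix w s assume w: "w \<in> \<Omega>" and "s \<in> carrier (G Mod V)"
    then obtain a where a: "a \<in> carrier G" "s = V #> a" using carB by blast
    then show "act w s \<in> \<Omega>" using w by (simp add: act_coset rc)
    fix t assume "t \<in> carrier (G Mod V)"
    then obtain b where b: "b \<in> carrier G" "t = V #> b" using carB by blast
    have "s \<otimes>\<^bsub>G Mod V\<^esub> t = V #> (a \<otimes> b)" using a b V.rcos_sum by simp
    then show "act (act w s) t = act w (s \<otimes>\<^bsub>G Mod V\<^esub> t)"
      using a b w by (simp add: act_coset rc rc_mult)
  next
    fix w assume w: "w \<in> \<Omega>"
    have "\<one>\<^bsub>G Mod V\<^esub> = V #> \<one>" using V.subset by simp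
    then show "act w \<one>\<^bsub>G Mod V\<^esub> = w" using w by (simp only: act_coset one_closed rc_one)
  qed
  interpret W: finite_p_group p W by (rule W)
  have carW: "carrier W = (\<Omega> \<rightarrow>\<^sub>E carrier Q) \<times> carrier (G Mod V)"
    and oneW: "\<one>\<^bsub>W\<^esub> = (\<lambda>w\<in>\<Omega>. \<one>\<^bsub>Q\<^esub>, V)"
    and multW: "\<And>c s d t. (c, s) \<otimes>\<^bsub>W\<^esub> (d, t) = (\<lambda>w\<in>\<Omega>. c w \<otimes>\<^bsub>Q\<^esub> d (act w s), s <#> t)"
    by (simp_all add: W_def wreath_product_def)

  have in_conj: "a \<otimes> inv b \<in> H'" if ab: "w \<in> \<Omega>" "a \<in> w" "b \<in> w" for w a b
  proof -
    obtain g where g: "g \<in> carrier G" "w = H' #> g" using \<Omega>E[OF ab(1)] by blast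
    then obtain h k where hk: "h \<in> H'" "k \<in> H'" "a = h \<otimes> g" "b = k \<otimes> g" using ab unfolding r_coset_def by blast
    then have "a \<otimes> inv b = h \<otimes> inv k" using g by (simp add: inv_mult_group m_assoc)
    then show ?thesis using hk by simp
  qed
  \<comment> \<open>The representatives in \<open>D i\<close> still lie in different double cosets
    after \<open>H\<close> is enlarged to \<open>H'\<close>.\<close>
  have uniq: "x = y" if a: "i \<in> J" "w \<in> \<Omega>" "x \<in> D i" "y \<in> D i" "k \<in> S i" "l \<in> S i" "x \<otimes> k \<in> w" "y \<otimes> l \<in> w" for i w x y k l
  proof -
    have i: "i \<in> I" using a(1) J by blast
    interpret Si: subgroup "S i" G by (rule S_subgroup[OF i])
    have "(x \<otimes> k) \<otimes> inv (y \<otimes> l) \<in> H'" using in_conj a(2,7,8) by blast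
    then obtain h v where hv: "h \<in> H" "v \<in> V" "(x \<otimes> k) \<otimes> inv (y \<otimes> l) = h \<otimes> v"
      unfolding H'_def set_mult_def by blast
    then have eq: "h \<otimes> v = x \<otimes> (k \<otimes> inv l) \<otimes> inv y"
      using a D_in_carrier[OF i] by (simp add: inv_mult_group m_assoc)
    have kl: "k \<otimes> inv l \<in> S i" using a(5,6) by simp
    show ?thesis by (rule sep(2)[rule_format, OF a(1,3,4) hv(1,2) kl eq])
  qed
  \<comment> \<open>A base point and a path to each coset:
    \<open>w = H' #> (\<xi> i w \<otimes> \<kappa> i w)\<close>. By \<open>uniq\<close> the
    representative \<open>\<xi> i w\<close> depends only on the orbit of \<open>w\<close> under
    \<open>S i\<close>, whereas \<open>\<kappa> i w\<close> is an arbitrary choice.\<close>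
  define z where "z i w = (SOME z. fst z \<in> D i \<and> snd z \<in> S i \<and> fst z \<otimes> snd z \<in> w)" for i w
  define \<xi> where "\<xi> i w = fst (z i w)" for i w
  define \<kappa> where "\<kappa> i w = snd (z i w)" for i w
  have z: "\<xi> i w \<in> D i" "\<kappa> i w \<in> S i" "\<xi> i w \<otimes> \<kappa> i w \<in> w" if iw: "i \<in> J" "w \<in> \<Omega>" for i w
  proof -
    have i: "i \<in> I" using iw J by blast
    obtain g where g: "g \<in> carrier G" "w = H' #> g" using \<Omega>E[OF iw(2)] by blast
    obtain x h k where x: "x \<in> D i" "h \<in> H" "k \<in> S i" "g = h \<otimes> x \<otimes> k" using D_cover[OF i g(1)] by blast
    have xc: "x \<in> carrier G" "h \<in> carrier G" "k \<in> carrier G"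
      by (rule D_in_carrier[OF i x(1)] H_carrier[OF x(2)] S_carrier[OF i x(3)])+
    have "x \<otimes> k = inv h \<otimes> g" unfolding x(4) using xc by (simp add: m_assoc)
    moreover have "inv h \<in> H'" by (rule H'.m_inv_closed[OF HH'[OF x(2)]])
    ultimately have "\<exists>h\<in>H'. x \<otimes> k = h \<otimes> g" by (intro bexI[of _ "inv h"])
    then have xk: "x \<otimes> k \<in> w" unfolding g(2) r_coset_def by simp
    have "fst (z i w) \<in> D i \<and> snd (z i w) \<in> S i \<and> fst (z i w) \<otimes> snd (z i w) \<in> w"
      unfolding z_def by (rule someI[of _ "(x, k)"]) (simp add: x xk)
    then show "\<xi> i w \<in> D i" "\<kappa> i w \<in> S i" "\<xi> i w \<otimes> \<kappa> i w \<in> w" by (simp_all add: \<xi>_def \<kappa>_def)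
  qed
  have mem_step: "a \<otimes> k \<in> w #> k" if "a \<in> w" for a k w using that unfolding r_coset_def by blast
  have \<xi>_step: "\<xi> i (w #> k) = \<xi> i w" if iw: "i \<in> J" "w \<in> \<Omega>" "k \<in> S i" for i w k
  proof -
    have i: "i \<in> I" using iw J by blast
    have kc: "k \<in> carrier G" by (rule S_carrier[OF i iw(3)])
    have w': "w #> k \<in> \<Omega>" using iw kc by (simp add: rc)
    have "\<xi> i w \<otimes> (\<kappa> i w \<otimes> k) \<in> w #> k"
      using mem_step[OF z(3)[OF iw(1,2)], of k] z(1,2)[OF iw(1,2)] D_in_carrier[OF i] S_carrier[OF i] kc
      by (simp add: m_assoc)
    moreover have "\<kappa> i w \<otimes> k \<in> S i" using z(2)[OF iw(1,2)] iw(3) S_subgroup[OF i] by (rule subgroup.m_closed[rotated])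
    ultimately show ?thesis
      using uniq[OF iw(1) w' z(1)[OF iw(1) w'] z(1)[OF iw(1,2)] z(2)[OF iw(1) w'] _ z(3)[OF iw(1) w']] by blast
  qed

  \<comment> \<open>The loops \<open>arg\<close> below stabilize \<open>H'\<close> and not
    necessarily \<open>H\<close>, so \<open>u\<close> has to be defined slightly beyond
    \<open>L i x\<close>.\<close>
  have "\<exists>U. U \<in> hom (G\<lparr>carrier := L i x <#> V0\<rparr>) Q \<and> (\<forall>l\<in>L i x. U l = u i x l) \<and> (\<forall>v\<in>V0. U v = \<one>\<^bsub>Q\<^esub>)"
    if "i \<in> I" "x \<in> D i" for i x
    by (rule hom_extend_along_normal[OF L_subgroup[OF that] nV0 Q.is_group u[OF that] uV[OF that]])
  then have "\<exists>U. \<forall>i x. i \<in> I \<longrightarrow> x \<in> D i \<longrightarrow> U i x \<in> hom (G\<lparr>carrier := L i x <#> V0\<rparr>) Q \<and>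
      (\<forall>l\<in>L i x. U i x l = u i x l) \<and> (\<forall>v\<in>V0. U i x v = \<one>\<^bsub>Q\<^esub>)"
    by (intro choice allI) simp
  then obtain U where U0: "\<forall>i x. i \<in> I \<longrightarrow> x \<in> D i \<longrightarrow> U i x \<in> hom (G\<lparr>carrier := L i x <#> V0\<rparr>) Q \<and>
      (\<forall>l\<in>L i x. U i x l = u i x l) \<and> (\<forall>v\<in>V0. U i x v = \<one>\<^bsub>Q\<^esub>)"
    by (rule exE)
  have U: "U i x \<in> hom (G\<lparr>carrier := L i x <#> V0\<rparr>) Q"
    "\<forall>l\<in>L i x. U i x l = u i x l" "\<forall>v\<in>V0. U i x v = \<one>\<^bsub>Q\<^esub>" if "i \<in> I" "x \<in> D i" for i x
    using U0 that by simp_all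
  \<comment> \<open>A loop at the base point \<open>H' #> \<xi> i w\<close>: go to \<open>w\<close>,
    apply \<open>k\<close>, and return from \<open>w #> k\<close>; the conjugation by
    \<open>\<xi> i w\<close> moves it into \<open>H'\<close>. In a product of two such loops the
    inner paths cancel, and this is the cocycle rule \<open>c_mult\<close>.\<close>
  define arg where "arg i k w = \<xi> i w \<otimes> \<kappa> i w \<otimes> k \<otimes> inv \<kappa> i (w #> k) \<otimes> inv \<xi> i w" for i k w
  have L_V0: "y \<in> L i x <#> V0" if y: "i \<in> J" "x \<in> D i" "y \<in> H'" "y \<in> conjugate G x (S i)" for i x y
  proof -
    obtain h v where hv: "h \<in> H" "v \<in> V" "y = h \<otimes> v" using y(3) unfolding H'_def set_mult_def by blast
    show ?thesis using sep(1)[rule_format, OF y(1,2) hv(1,2)] y(4) hv(3) by simp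
  qed
  have arg_in: "arg i k w \<in> L i (\<xi> i w) <#> V0" if iw: "i \<in> J" "w \<in> \<Omega>" "k \<in> S i" for i k w
  proof (rule L_V0[OF iw(1) z(1)[OF iw(1,2)]])
    have i: "i \<in> I" using iw J by blast
    interpret Si: subgroup "S i" G by (rule S_subgroup[OF i])
    have w': "w #> k \<in> \<Omega>" using iw by (simp add: rc)
    have c: "\<xi> i w \<in> carrier G" "\<kappa> i w \<in> carrier G" "k \<in> carrier G" "\<kappa> i (w #> k) \<in> carrier G"
      using z(1,2)[OF iw(1,2)] z(2)[OF iw(1) w'] D_in_carrier[OF i] iw(3) by auto
    have "(\<xi> i w \<otimes> \<kappa> i w \<otimes> k) \<otimes> inv (\<xi> i w \<otimes> \<kappa> i (w #> k)) \<in> H'"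
      using in_conj[OF w' mem_step[OF z(3)[OF iw(1,2)]] z(3)[OF iw(1) w']] \<xi>_step[OF iw] by simp
    then show "arg i k w \<in> H'" using c by (simp add: arg_def inv_mult_group m_assoc)
    have "inv \<xi> i w \<otimes> arg i k w \<otimes> \<xi> i w = \<kappa> i w \<otimes> k \<otimes> inv \<kappa> i (w #> k)"
      using c by (simp add: arg_def m_assoc)
    also have "\<dots> \<in> S i" using z(2)[OF iw(1,2)] z(2)[OF iw(1) w'] iw(3) by simp
    finally show "arg i k w \<in> conjugate G (\<xi> i w) (S i)"
      using mem_conjugate[OF i z(1)[OF iw(1,2)]] c by (simp add: arg_def)
  qed
  have U_mult: "U i x (y \<otimes> y') = U i x y \<otimes>\<^bsub>Q\<^esub> U i x y'" and U_car: "U i x y \<in> carrier Q"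
    if "i \<in> I" "x \<in> D i" "y \<in> L i x <#> V0" "y' \<in> L i x <#> V0" for i x y y'
    using hom_mult[OF U(1)[OF that(1,2)], of y y'] hom_in_carrier[OF U(1)[OF that(1,2)], of y] that by simp_all
  \<comment> \<open>For \<open>i\<close> outside \<open>J\<close>, all conjugates of
    \<open>S i\<close> lie in \<open>V0\<close>, where every \<open>u i x\<close> is trivial, so the
    constant 1 is a matching cocycle.\<close>
  define c where "c i k w = (if i \<in> J then U i (\<xi> i w) (arg i k w) else \<one>\<^bsub>Q\<^esub>)" for i k w
  define \<phi> where "\<phi> i k = (\<lambda>w\<in>\<Omega>. c i k w, V #> k)" for i k
  have c_car: "c i k w \<in> carrier Q" if "i \<in> I" "w \<in> \<Omega>" "k \<in> S i" for i k w
    using that arg_in[of i w k] U_car[OF that(1) z(1) arg_in arg_in] by (simp add: c_def)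
  have c_mult: "c i (k \<otimes> l) w = c i k w \<otimes>\<^bsub>Q\<^esub> c i l (w #> k)" if ikl: "i \<in> I" "w \<in> \<Omega>" "k \<in> S i" "l \<in> S i" for i k l w
  proof (cases "i \<in> J")
    case True
    interpret Si: subgroup "S i" G by (rule S_subgroup[OF ikl(1)])
    have w': "w #> k \<in> \<Omega>" using ikl by (simp add: rc)
    have w'': "w #> (k \<otimes> l) \<in> \<Omega>" using ikl by (simp add: rc)
    have "arg i (k \<otimes> l) w = arg i k w \<otimes> arg i l (w #> k)"
      using z(1,2)[OF True ikl(2)] z(2)[OF True w'] z(2)[OF True w''] D_in_carrier[OF ikl(1)] ikl
      by (simp add: arg_def \<xi>_step[OF True] rc rc_mult m_assoc)
    then show ?thesis
      using True U_mult[OF ikl(1) z(1)[OF True ikl(2)] arg_in[OF True ikl(2,3)], of "arg i l (w #> k)"]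
        arg_in[OF True w' ikl(4)] \<xi>_step[OF True ikl(2,3)]
      by (simp add: c_def)
  qed (simp add: c_def)
  have \<phi>: "\<phi> i \<in> hom (G\<lparr>carrier := S i\<rparr>) W" if i: "i \<in> I" for i
  proof (rule homI)
    interpret Si: subgroup "S i" G by (rule S_subgroup[OF i])
    fix k assume "k \<in> carrier (G\<lparr>carrier := S i\<rparr>)"
    then have k: "k \<in> S i" by simp
    then show "\<phi> i k \<in> carrier W" using c_car[OF i] by (auto simp: \<phi>_def carW carB)
    fix l assume "l \<in> carrier (G\<lparr>carrier := S i\<rparr>)"
    then have l: "l \<in> S i" by simp
    have "\<phi> i (k \<otimes> l) = \<phi> i k \<otimes>\<^bsub>W\<^esub> \<phi> i l"
      using k l by (auto simp: \<phi>_def multW act_coset rc rc_mult c_mult[OF i] V.rcos_sum intro!: restrict_ext)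
    then show "\<phi> i (k \<otimes>\<^bsub>G\<lparr>carrier := S i\<rparr>\<^esub> l) = \<phi> i k \<otimes>\<^bsub>W\<^esub> \<phi> i l" by simp
  qed
  have \<phi>V: "\<phi> i v = \<one>\<^bsub>W\<^esub>" if i: "i \<in> I" and v: "v \<in> V \<inter> S i" for i v
  proof -
    have vc: "v \<in> carrier G" using v V.subset by blast
    \<comment> \<open>\<open>V\<close> fixes every coset, so the return path is the outward path
      reversed and the loop is a conjugate of \<open>v\<close>, hence in \<open>V0\<close>.\<close>
    have "c i v w = \<one>\<^bsub>Q\<^esub>" if w: "w \<in> \<Omega>" for w
    proof (cases "i \<in> J")
      case True
      obtain g where g: "g \<in> carrier G" "w = H' #> g" using \<Omega>E[OF w] by blast
      have "g \<otimes> v \<otimes> inv g \<in> H'" using VH' V.inv_op_closed2[OF g(1)] v by blast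
      then have "H' #> (g \<otimes> v \<otimes> inv g) #> g = H' #> g" using coset_join2[OF _ H'] g vc by simp
      then have wv: "w #> v = w" using g vc by (simp add: step m_assoc)
      have cc: "\<xi> i w \<in> carrier G" "\<kappa> i w \<in> carrier G"
        using z(1,2)[OF True w] D_in_carrier[OF i] S_carrier[OF i] by auto
      have "arg i v w = (\<xi> i w \<otimes> \<kappa> i w) \<otimes> v \<otimes> inv (\<xi> i w \<otimes> \<kappa> i w)"
        unfolding arg_def wv using cc vc by (simp add: inv_mult_group m_assoc)
      also have "\<dots> \<in> V0"
        using v by (intro subsetD[OF V(2)] V.inv_op_closed2[OF m_closed[OF cc]]) simp
      finally show ?thesis using U(3)[OF i z(1)[OF True w]] True by (simp add: c_def)
    qed (simp add: c_def)
    moreover have "V #> v = V" using coset_join2[OF vc V.subgroup_axioms] v by blast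
    ultimately show ?thesis unfolding \<phi>_def oneW by (auto intro: restrict_ext)
  qed
  have "\<exists>\<Phi> W0. \<Phi> \<in> hom G W \<and> open_normal W0 G T \<and> (\<forall>w\<in>W0. \<Phi> w = \<one>\<^bsub>W\<^esub>) \<and>
      (\<forall>i\<in>I. \<forall>x\<in>S i. \<Phi> x = \<phi> i x)"
    by (rule finite_universal_property[OF free W \<phi> V(1) \<phi>V])
  then obtain \<Phi> W0 where \<Phi>: "\<Phi> \<in> hom G W" and W0: "open_normal W0 G T"
    and \<Phi>W0: "\<And>w. w \<in> W0 \<Longrightarrow> \<Phi> w = \<one>\<^bsub>W\<^esub>" and \<Phi>S: "\<And>i x. i \<in> I \<Longrightarrow> x \<in> S i \<Longrightarrow> \<Phi> x = \<phi> i x"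
    by (elim exE conjE) simp
  have \<Phi>_one: "\<Phi> \<one> = \<one>\<^bsub>W\<^esub>" using \<Phi>W0 subgroup.one_closed[OF open_normal_subgroup[OF W0]] by blast
  have sndW: "snd \<in> hom W (G Mod V)"
    by (rule homI) (auto simp: carW multW)
  have \<Phi>car: "\<Phi> g \<in> carrier W" if "g \<in> carrier G" for g by (rule hom_in_carrier[OF \<Phi> that])
  \<comment> \<open>Freeness prescribes \<open>\<Phi>\<close> on the \<open>S i\<close> only. That
    its second component is the projection everywhere follows from generation, and it turns the
    first component into a cocycle for the action of \<open>G\<close> on
    \<open>\<Omega>\<close>.\<close>
  have snd\<Phi>: "snd (\<Phi> g) = V #> g" if g: "g \<in> carrier G" for g
  proof (rule homs_eq_if_eq_on_generators[OF generated _ B.is_group hom_comp[OF \<Phi> sndW] V.r_coset_hom_Mod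
        open_normal_Int[OF W0 V(1)] _ _ g])
    show "(\<Union>i\<in>I. S i) \<subseteq> carrier G" using S_carrier by blast
    show "snd (\<Phi> v) = V #> v" if "v \<in> W0 \<inter> V" for v
      using that \<Phi>W0 coset_join2[OF _ V.subgroup_axioms, of v] V.subset by (auto simp: oneW)
    show "snd (\<Phi> x) = V #> x" if "x \<in> (\<Union>i\<in>I. S i)" for x
      using that \<Phi>S by (auto simp: \<phi>_def)
  qed
  define C where "C w g = fst (\<Phi> g) w" for w g
  have C_car: "C w g \<in> carrier Q" if "w \<in> \<Omega>" "g \<in> carrier G" for w g
    using \<Phi>car[OF that(2)] that(1) by (auto simp: C_def carW)
  have C_mult: "C w (g \<otimes> h) = C w g \<otimes>\<^bsub>Q\<^esub> C (w #> g) h" if "w \<in> \<Omega>" "g \<in> carrier G" "h \<in> carrier G" for w g h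
  proof -
    have "\<Phi> (g \<otimes> h) = (fst (\<Phi> g), snd (\<Phi> g)) \<otimes>\<^bsub>W\<^esub> (fst (\<Phi> h), snd (\<Phi> h))"
      using hom_mult[OF \<Phi> that(2,3)] by simp
    then show ?thesis unfolding multW using that by (simp add: C_def snd\<Phi> act_coset)
  qed
  have C_one: "C w \<one> = \<one>\<^bsub>Q\<^esub>" if "w \<in> \<Omega>" for w using that by (simp add: C_def \<Phi>_one oneW)
  have H'\<Omega>: "H' \<in> \<Omega>" using \<Omega>I[of \<one>] H'.subset by simp
  have H'h: "H' #> h = H'" if "h \<in> H" for h using coset_join2[OF H_carrier[OF that] H' HH'[OF that]] .
  \<comment> \<open>\<open>C H' x\<close> transports from \<open>H'\<close> to
    \<open>H' #> x\<close>; the second factor corrects for the path chosen at that base point, since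
    \<open>\<kappa> i (H' #> x)\<close> need not be 1.\<close>
  define a where "a i x = C H' x \<otimes>\<^bsub>Q\<^esub>
      (if i \<in> J then U i x (x \<otimes> \<kappa> i (H' #> x) \<otimes> inv x) else \<one>\<^bsub>Q\<^esub>)" for i x
  \<comment> \<open>\<open>H\<close> fixes the point \<open>H'\<close>, so on \<open>H\<close> the
    cocycle rule at this point is multiplicativity.\<close>
  have "C H' \<in> hom (G\<lparr>carrier := H\<rparr>) Q"
    using H_carrier C_car[OF H'\<Omega>] C_mult[OF H'\<Omega>] H'h by (intro homI) simp_all
  moreover have "C H' w = \<one>\<^bsub>Q\<^esub>" if "w \<in> W0 \<inter> H" for w
    using that \<Phi>W0 H'\<Omega> by (simp add: C_def oneW)
  moreover have "a i x \<in> carrier Q \<and> (\<forall>y\<in>L i x. C H' y = a i x \<otimes>\<^bsub>Q\<^esub> u i x y \<otimes>\<^bsub>Q\<^esub> inv\<^bsub>Q\<^esub> a i x)"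
    if i: "i \<in> I" and x: "x \<in> D i" for i x
  proof -
    interpret Si: subgroup "S i" G by (rule S_subgroup[OF i])
    have xc: "x \<in> carrier G" by (rule D_in_carrier[OF i x])
    define w where "w = H' #> x"
    have w: "w \<in> \<Omega>" unfolding w_def using xc by (rule \<Omega>I)
    have xw: "x \<otimes> \<one> \<in> w" unfolding w_def using rcos_self[OF xc H'] xc by simp
    define t where "t = x \<otimes> \<kappa> i w \<otimes> inv x"
    have \<xi>: "\<xi> i w = x" if "i \<in> J"
      using uniq[OF that w z(1)[OF that w] x z(2)[OF that w] Si.one_closed z(3)[OF that w] xw] .
    have t: "t \<in> L i x <#> V0" if iJ: "i \<in> J"
    proof (rule L_V0[OF iJ x])
      have kc: "\<kappa> i w \<in> carrier G" using z(2)[OF iJ w] by simp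
      show "t \<in> H'" using in_conj[OF w z(3)[OF iJ w] xw] xc kc \<xi>[OF iJ] by (simp add: t_def)
      have "inv x \<otimes> t \<otimes> x = \<kappa> i w" unfolding t_def using xc kc by (simp add: m_assoc)
      then show "t \<in> conjugate G x (S i)"
        using mem_conjugate[OF i x] z(2)[OF iJ w] xc kc by (simp add: t_def)
    qed
    define b where "b = (if i \<in> J then U i x t else \<one>\<^bsub>Q\<^esub>)"
    have ab: "a i x = C H' x \<otimes>\<^bsub>Q\<^esub> b" by (simp add: a_def b_def t_def w_def)
    have bc: "b \<in> carrier Q" unfolding b_def using U_car[OF i x t t] by simp
    have Cx: "C H' x \<in> carrier Q" by (rule C_car[OF H'\<Omega> xc])
    have "C H' y = a i x \<otimes>\<^bsub>Q\<^esub> u i x y \<otimes>\<^bsub>Q\<^esub> inv\<^bsub>Q\<^esub> a i x" if y: "y \<in> L i x" for y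
    proof -
      have yc: "y \<in> carrier G" "y \<in> H" using y H_carrier by auto
      define k where "k = inv x \<otimes> y \<otimes> x"
      have k: "k \<in> S i" unfolding k_def using y mem_conjugate[OF i x] by blast
      have yk: "y = x \<otimes> k \<otimes> inv x" unfolding k_def using xc yc by (simp add: m_assoc)
      have wk: "w #> k = w"
      proof -
        have "w #> k = H' #> (y \<otimes> x)" unfolding w_def k_def using xc yc by (simp add: step m_assoc)
        also have "\<dots> = H' #> y #> x" using xc yc by (simp add: step)
        finally show ?thesis unfolding w_def using H'h[OF yc(2)] by simp
      qed
      have uy: "u i x y \<in> carrier Q" using hom_in_carrier[OF u[OF i x], of y] y by simp
      have "C w k = c i k w" using \<Phi>S[OF i k] w by (simp add: C_def \<phi>_def)
      also have "\<dots> = b \<otimes>\<^bsub>Q\<^esub> u i x y \<otimes>\<^bsub>Q\<^esub> inv\<^bsub>Q\<^esub> b"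
      proof (cases "i \<in> J")
        case True
        have kc: "\<kappa> i w \<in> carrier G" using z(2)[OF True w] by simp
        have tc: "t \<in> carrier G" unfolding t_def using xc kc by simp
        have yL: "y \<in> L i x <#> V0" using set_multI[OF y V0.one_closed] yc by simp
        \<comment> \<open>The loop of \<open>k\<close> at the base point is
          \<open>t y t\<^sup>-\<^sup>1\<close>, so \<open>U i x\<close> sends it to
          \<open>u i x y\<close> conjugated by \<open>U i x t\<close>.\<close>
        have "arg i k w \<otimes> t = t \<otimes> y"
          unfolding arg_def wk \<xi>[OF True] t_def using xc kc k yk by (simp add: m_assoc)
        moreover have "arg i k w \<in> L i x <#> V0" using arg_in[OF True w k] \<xi>[OF True] by simp
        ultimately have "U i x (arg i k w) \<otimes>\<^bsub>Q\<^esub> U i x t = U i x t \<otimes>\<^bsub>Q\<^esub> U i x y" "U i x (arg i k w) \<in> carrier Q"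
          using U_mult[OF i x _ t[OF True], of "arg i k w"] U_mult[OF i x t[OF True] yL] U_car[OF i x] by auto
        moreover have "U i x y = u i x y" using U(2)[OF i x] y by blast
        ultimately have "U i x (arg i k w) = b \<otimes>\<^bsub>Q\<^esub> u i x y \<otimes>\<^bsub>Q\<^esub> inv\<^bsub>Q\<^esub> b"
          using True bc uy Q.inv_solve_right'[of "U i x (arg i k w)" "b \<otimes>\<^bsub>Q\<^esub> u i x y" b]
          by (simp add: b_def)
        then show ?thesis using True \<xi>[OF True] by (simp add: c_def)
      next
        case False
        then have "k \<in> V0" using k i J_def by blast
        then have "y \<in> V0 \<inter> L i x" using V0.inv_op_closed2[OF xc] yk y by simp
        then have "u i x y = \<one>\<^bsub>Q\<^esub>" by (rule uV[OF i x])
        then show ?thesis using False by (simp add: c_def b_def)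
      qed
      finally have Ck: "C w k = b \<otimes>\<^bsub>Q\<^esub> u i x y \<otimes>\<^bsub>Q\<^esub> inv\<^bsub>Q\<^esub> b" .
      have Cinv: "C w (inv x) \<in> carrier Q" using xc by (intro C_car[OF w]) simp
      have "C H' x \<otimes>\<^bsub>Q\<^esub> C w (inv x) = \<one>\<^bsub>Q\<^esub>"
        using C_mult[OF H'\<Omega> xc, of "inv x"] C_one[OF H'\<Omega>] xc unfolding w_def by simp
      then have "inv\<^bsub>Q\<^esub> C w (inv x) = C H' x" using Cx Cinv by (intro Q.inv_equality)
      then have "C w (inv x) = inv\<^bsub>Q\<^esub> C H' x" using Q.inv_inv[OF Cinv] by simp
      moreover have "C H' y = C H' x \<otimes>\<^bsub>Q\<^esub> C w k \<otimes>\<^bsub>Q\<^esub> C w (inv x)"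
      proof -
        have kc: "k \<in> carrier G" using k by simp
        have "H' #> (x \<otimes> k) = w" using step[OF xc kc] wk by (simp add: w_def)
        moreover have "C H' (x \<otimes> k \<otimes> inv x) = C H' (x \<otimes> k) \<otimes>\<^bsub>Q\<^esub> C (H' #> (x \<otimes> k)) (inv x)"
          using xc kc by (intro C_mult H'\<Omega>) simp_all
        moreover have "C H' (x \<otimes> k) = C H' x \<otimes>\<^bsub>Q\<^esub> C w k"
          unfolding w_def by (rule C_mult[OF H'\<Omega> xc kc])
        ultimately show ?thesis using yk by simp
      qed
      ultimately show ?thesis
        unfolding Ck ab using Cx bc uy by (simp add: Q.inv_mult_group Q.m_assoc)
    qed
    then show ?thesis using ab Cx bc by simp
  qed
  ultimately show ?thesis using W0 by (intro exI[of _ "C H'"] exI[of _ W0] exI[of _ a]) simp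
qed

end

section \<open>Removing the conjugation, for finite targets\<close>

lemma finite_p_group_product_group:
  assumes "finite X" "finite_p_group p Q"
  shows "finite_p_group p (product_group X (\<lambda>_. Q))"
proof -
  interpret Q: finite_p_group p Q by fact
  obtain n where "order Q = p ^ n" using Q.order_power by blast
  then have "order (product_group X (\<lambda>_. Q)) = p ^ (n * card X)"
    using assms(1) by (simp add: order_def card_PiE power_mult)
  then show ?thesis
    using Q.prime by (auto simp: finite_p_group_def finite_p_group_axioms_def Q.is_group)
qed

context subgroup_with_representatives
begin

text \<open>The elements \<open>a i x\<close> are known only after the extension has been built, so
  the coordinates \<open>b\<close> range over all families in \<open>Q\<close>: conjugating
  coordinate \<open>b\<close> of \<open>U i x y\<close> by \<open>a i x b\<close> gives its
  coordinate \<open>\<beta> b\<close>, which is present in any case. Families indexed by pairs with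
  \<open>i\<close> in \<open>J\<close> suffice, since the other \<open>u i x\<close> are trivial,
  and this keeps \<open>X\<close> finite.\<close>

lemma finite_extension:
  fixes Q :: "('q, 'w) monoid_scheme"
  assumes free: "restricted_free_pro_p_product TYPE('u::infinite) p G T I S"
    and Q: "finite_p_group p Q" and V0: "open_normal V0 G T"
    and u: "\<And>i x. i \<in> I \<Longrightarrow> x \<in> D i \<Longrightarrow> u i x \<in> hom (G\<lparr>carrier := L i x\<rparr>) Q"
    and uV: "\<And>i x v. i \<in> I \<Longrightarrow> x \<in> D i \<Longrightarrow> v \<in> V0 \<inter> L i x \<Longrightarrow> u i x v = \<one>\<^bsub>Q\<^esub>"
  shows "\<exists>g W. g \<in> hom (G\<lparr>carrier := H\<rparr>) Q \<and> open_normal W G T \<and> (\<forall>w\<in>W \<inter> H. g w = \<one>\<^bsub>Q\<^esub>) \<and>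
    (\<forall>i\<in>I. \<forall>x\<in>D i. \<forall>y\<in>L i x. g y = u i x y)"
proof -
  interpret Q: finite_p_group p Q by fact
  define J where "J = {i \<in> I. \<not> S i \<subseteq> V0}"
  have J: "finite J" "J \<subseteq> I"
    using converges V0 open_normal_subgroup[OF V0] unfolding converges_to_1_def open_normal_def J_def by auto
  have trivial: "u i x y = \<one>\<^bsub>Q\<^esub>" if i: "i \<in> I" "i \<notin> J" and x: "x \<in> D i" and y: "y \<in> L i x" for i x y
  proof -
    have "inv x \<otimes> y \<otimes> x \<in> V0" using y mem_conjugate[OF i(1) x] i unfolding J_def by blast
    moreover have yx: "y \<in> carrier G" "x \<in> carrier G" using y H_carrier D_in_carrier[OF i(1) x] by auto
    ultimately have "x \<otimes> (inv x \<otimes> y \<otimes> x) \<otimes> inv x \<in> V0"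
      using V0 normal.inv_op_closed2 unfolding open_normal_def by metis
    then have "y \<in> V0 \<inter> L i x" using yx y by (simp add: m_assoc)
    then show ?thesis by (rule uV[OF i(1) x])
  qed
  define \<Lambda> where "\<Lambda> = (SIGMA i:J. D i)"
  have \<Lambda>: "finite \<Lambda>" unfolding \<Lambda>_def using J D_finite by (intro finite_SigmaI) auto
  define X where "X = (\<Lambda> \<rightarrow>\<^sub>E carrier Q)"
  have X: "finite X" unfolding X_def using \<Lambda> Q.finite_carrier by (intro finite_PiE)
  define R where "R = product_group X (\<lambda>_. Q)"
  interpret R: finite_p_group p R unfolding R_def by (rule finite_p_group_product_group[OF X Q])
  have carR: "carrier R = (X \<rightarrow>\<^sub>E carrier Q)" by (simp add: R_def)
  have multR: "r \<otimes>\<^bsub>R\<^esub> s = (\<lambda>b\<in>X. r b \<otimes>\<^bsub>Q\<^esub> s b)" for r s by (simp add: R_def)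
  have oneR: "\<one>\<^bsub>R\<^esub> = (\<lambda>b\<in>X. \<one>\<^bsub>Q\<^esub>)" by (simp add: R_def)
  have invR: "inv\<^bsub>R\<^esub> r = (\<lambda>b\<in>X. inv\<^bsub>Q\<^esub> r b)" if "r \<in> carrier R" for r
    using that unfolding R_def by (intro inv_product_group) (simp_all add: Q.is_group)
  \<comment> \<open>the universal family: coordinate \<open>b\<close> is the family \<open>u\<close> conjugated by \<open>b\<close>\<close>
  define U where "U i x y = (\<lambda>b\<in>X. if i \<in> J then b (i, x) \<otimes>\<^bsub>Q\<^esub> u i x y \<otimes>\<^bsub>Q\<^esub> inv\<^bsub>Q\<^esub> b (i, x) else \<one>\<^bsub>Q\<^esub>)" for i x y
  have bX: "b (i, x) \<in> carrier Q" if "b \<in> X" "i \<in> J" "x \<in> D i" for b i x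
    using that unfolding X_def \<Lambda>_def by (auto simp: PiE_iff)
  have u_car: "u i x y \<in> carrier Q" if "i \<in> I" "x \<in> D i" "y \<in> L i x" for i x y
    using hom_in_carrier[OF u[OF that(1,2)], of y] that(3) by simp
  have u_mult: "u i x (y \<otimes> z) = u i x y \<otimes>\<^bsub>Q\<^esub> u i x z" if "i \<in> I" "x \<in> D i" "y \<in> L i x" "z \<in> L i x" for i x y z
    using hom_mult[OF u[OF that(1,2)], of y z] that(3,4) by simp
  have U_car: "U i x y \<in> carrier R" if "i \<in> I" "x \<in> D i" "y \<in> L i x" for i x y
    using that u_car[OF that] bX unfolding U_def carR by auto
  define A where "A = (\<lambda>(i, x). U i x ` L i x)"
  define \<Lambda>' where "\<Lambda>' = (SIGMA i:I. D i)"
  \<comment> \<open>Taking \<open>M\<close> and not all of \<open>R\<close> as target forces the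
    elements \<open>a i x\<close> into \<open>M\<close>, as \<open>generate_conjugates\<close>
    requires.\<close>
  define M where "M = generate R (\<Union>z\<in>\<Lambda>'. A z)"
  have A_car: "A z \<subseteq> carrier R" if "z \<in> \<Lambda>'" for z
    using that U_car unfolding A_def \<Lambda>'_def by (cases z) auto
  have Asub: "(\<Union>z\<in>\<Lambda>'. A z) \<subseteq> carrier R" using A_car by (rule UN_least)
  have M: "subgroup M R" unfolding M_def by (rule R.generate_is_subgroup[OF Asub])
  have MR: "M \<subseteq> carrier R" by (rule subgroup.subset[OF M])
  let ?R = "R\<lparr>carrier := M\<rparr>"
  interpret M: finite_p_group p ?R by (rule R.subgroup_finite_p_group[OF M])
  have A_M: "A z \<subseteq> M" if "z \<in> \<Lambda>'" for z
    using that unfolding M_def by (auto intro: generate.incl)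
  have U_M: "U i x y \<in> M" if "i \<in> I" "x \<in> D i" "y \<in> L i x" for i x y
    using A_M[of "(i, x)"] that unfolding A_def \<Lambda>'_def by auto
  have "U i x \<in> hom (G\<lparr>carrier := L i x\<rparr>) ?R" if ix: "i \<in> I" "x \<in> D i" for i x
  proof (rule homI)
    fix y assume "y \<in> carrier (G\<lparr>carrier := L i x\<rparr>)"
    then have y: "y \<in> L i x" by simp
    then show "U i x y \<in> carrier ?R" using U_M[OF ix] by simp
    fix y' assume "y' \<in> carrier (G\<lparr>carrier := L i x\<rparr>)"
    then have y': "y' \<in> L i x" by simp
    have "U i x (y \<otimes> y') = U i x y \<otimes>\<^bsub>R\<^esub> U i x y'"
      unfolding U_def multR
    proof (rule restrict_ext)
      fix b assume b: "b \<in> X"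
      show "(if i \<in> J then b (i, x) \<otimes>\<^bsub>Q\<^esub> u i x (y \<otimes> y') \<otimes>\<^bsub>Q\<^esub> inv\<^bsub>Q\<^esub> b (i, x) else \<one>\<^bsub>Q\<^esub>) =
        (\<lambda>b\<in>X. if i \<in> J then b (i, x) \<otimes>\<^bsub>Q\<^esub> u i x y \<otimes>\<^bsub>Q\<^esub> inv\<^bsub>Q\<^esub> b (i, x) else \<one>\<^bsub>Q\<^esub>) b \<otimes>\<^bsub>Q\<^esub>
        (\<lambda>b\<in>X. if i \<in> J then b (i, x) \<otimes>\<^bsub>Q\<^esub> u i x y' \<otimes>\<^bsub>Q\<^esub> inv\<^bsub>Q\<^esub> b (i, x) else \<one>\<^bsub>Q\<^esub>) b"
        using b bX[OF b _ ix(2)] u_car[OF ix y] u_car[OF ix y'] u_mult[OF ix y y'] by (simp add: Q.m_assoc)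
    qed
    then show "U i x (y \<otimes>\<^bsub>G\<lparr>carrier := L i x\<rparr>\<^esub> y') = U i x y \<otimes>\<^bsub>?R\<^esub> U i x y'" by simp
  qed
  note U_hom = this
  have U_V: "U i x v = \<one>\<^bsub>?R\<^esub>" if "i \<in> I" "x \<in> D i" "v \<in> V0 \<inter> L i x" for i x v
  proof -
    have "U i x v = \<one>\<^bsub>R\<^esub>" unfolding U_def oneR
    proof (rule restrict_ext)
      fix b assume b: "b \<in> X"
      show "(if i \<in> J then b (i, x) \<otimes>\<^bsub>Q\<^esub> u i x v \<otimes>\<^bsub>Q\<^esub> inv\<^bsub>Q\<^esub> b (i, x) else \<one>\<^bsub>Q\<^esub>) = \<one>\<^bsub>Q\<^esub>"
        using bX[OF b _ that(2)] uV[OF that] by simp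
    qed
    then show ?thesis by simp
  qed
  have "\<exists>g W a. g \<in> hom (G\<lparr>carrier := H\<rparr>) ?R \<and> open_normal W G T \<and> (\<forall>w\<in>W \<inter> H. g w = \<one>\<^bsub>?R\<^esub>) \<and>
    (\<forall>i\<in>I. \<forall>x\<in>D i. a i x \<in> carrier ?R \<and> (\<forall>y\<in>L i x. g y = a i x \<otimes>\<^bsub>?R\<^esub> U i x y \<otimes>\<^bsub>?R\<^esub> inv\<^bsub>?R\<^esub> a i x))"
    by (rule conjugate_extension[OF free M.finite_p_group_axioms V0 U_hom U_V])
  then obtain g W a where g: "g \<in> hom (G\<lparr>carrier := H\<rparr>) ?R" and W: "open_normal W G T" "\<forall>w\<in>W \<inter> H. g w = \<one>\<^bsub>?R\<^esub>"
    and ga: "\<forall>i\<in>I. \<forall>x\<in>D i. a i x \<in> carrier ?R \<and> (\<forall>y\<in>L i x. g y = a i x \<otimes>\<^bsub>?R\<^esub> U i x y \<otimes>\<^bsub>?R\<^esub> inv\<^bsub>?R\<^esub> a i x)"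
    by (elim exE conjE)
  have aM: "a i x \<in> M" if "i \<in> I" "x \<in> D i" for i x using ga that by simp
  have gU: "g y = a i x \<otimes>\<^bsub>R\<^esub> U i x y \<otimes>\<^bsub>R\<^esub> inv\<^bsub>R\<^esub> a i x" if "i \<in> I" "x \<in> D i" "y \<in> L i x" for i x y
    using ga that R.m_inv_consistent[OF M aM[OF that(1,2)]] by simp
  \<comment> \<open>conjugating by \<open>a\<close> is a reindexing of the coordinates of the product\<close>
  define \<beta> where "\<beta> b = (\<lambda>(i, x)\<in>\<Lambda>. a i x b \<otimes>\<^bsub>Q\<^esub> b (i, x))" for b
  define \<alpha> where "\<alpha> r = (\<lambda>b\<in>X. r (\<beta> b))" for r :: "('i \<times> 'a \<Rightarrow> 'q) \<Rightarrow> 'q"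
  have aX: "a i x b \<in> carrier Q" if "i \<in> I" "x \<in> D i" "b \<in> X" for i x b
    using aM[OF that(1,2)] MR that(3) unfolding carR by auto
  have \<beta>: "\<beta> b \<in> X" if b: "b \<in> X" for b
    unfolding X_def
  proof (rule PiE_I)
    fix z assume "z \<in> \<Lambda>"
    then obtain i x where z: "z = (i, x)" "i \<in> J" "x \<in> D i" unfolding \<Lambda>_def by auto
    then show "\<beta> b z \<in> carrier Q" using \<open>z \<in> \<Lambda>\<close> aX[of i x b] bX[OF b, of i x] b J by (auto simp: \<beta>_def)
  qed (simp add: \<beta>_def)
  have \<alpha>_hom: "\<alpha> \<in> hom R R"
    by (rule homI) (use \<beta> in \<open>auto simp: carR multR \<alpha>_def intro!: restrict_ext\<close>)
  have \<alpha>U: "\<alpha> (U i x y) = a i x \<otimes>\<^bsub>R\<^esub> U i x y \<otimes>\<^bsub>R\<^esub> inv\<^bsub>R\<^esub> a i x" if ix: "i \<in> I" "x \<in> D i" "y \<in> L i x" for i x y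
  proof -
    have aR: "a i x \<in> carrier R" using aM[OF ix(1,2)] MR by blast
    show ?thesis
      unfolding \<alpha>_def multR invR[OF aR]
    proof (rule restrict_ext)
      fix b assume b: "b \<in> X"
      note ab = aX[OF ix(1,2) b]
      have "\<beta> b (i, x) = a i x b \<otimes>\<^bsub>Q\<^esub> b (i, x)" if "i \<in> J" using that ix(2) by (simp add: \<beta>_def \<Lambda>_def)
      then show "U i x y (\<beta> b) = (\<lambda>b\<in>X. a i x b \<otimes>\<^bsub>Q\<^esub> U i x y b) b \<otimes>\<^bsub>Q\<^esub> (\<lambda>b\<in>X. inv\<^bsub>Q\<^esub> a i x b) b"
        using b \<beta>[OF b] ab bX[OF b _ ix(2)] u_car[OF ix] by (simp add: U_def Q.m_assoc Q.inv_mult_group)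
    qed
  qed
  interpret \<alpha>: group_hom R R \<alpha> by unfold_locales (rule \<alpha>_hom)
  define A' where "A' = (\<lambda>(i, x). (\<lambda>r. a i x \<otimes>\<^bsub>?R\<^esub> r \<otimes>\<^bsub>?R\<^esub> inv\<^bsub>?R\<^esub> a i x) ` A (i, x))"
  have img: "\<alpha> ` A z = A' z" if z_in: "z \<in> \<Lambda>'" for z
  proof -
    obtain i x where z: "z = (i, x)" "i \<in> I" "x \<in> D i" using z_in unfolding \<Lambda>'_def by auto
    have "\<alpha> (U i x y) = a i x \<otimes>\<^bsub>?R\<^esub> U i x y \<otimes>\<^bsub>?R\<^esub> inv\<^bsub>?R\<^esub> a i x" if "y \<in> L i x" for y
      using \<alpha>U[OF z(2,3) that] R.m_inv_consistent[OF M aM[OF z(2,3)]] by simp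
    then show ?thesis unfolding A'_def A_def z(1) by (simp add: image_image)
  qed
  have genM: "generate ?R (\<Union>z\<in>\<Lambda>'. A z) = M"
    using R.generate_consistent[OF _ M, of "\<Union>z\<in>\<Lambda>'. A z"] A_M unfolding M_def by blast
  have "generate ?R (\<Union>z\<in>\<Lambda>'. (\<lambda>r. a (fst z) (snd z) \<otimes>\<^bsub>?R\<^esub> r \<otimes>\<^bsub>?R\<^esub> inv\<^bsub>?R\<^esub> a (fst z) (snd z)) ` A z) = carrier ?R"
  proof (rule M.generate_conjugates)
    show "A z \<subseteq> carrier ?R" if "z \<in> \<Lambda>'" for z using A_M[OF that] by simp
    show "a (fst z) (snd z) \<in> carrier ?R" if "z \<in> \<Lambda>'" for z using that aM unfolding \<Lambda>'_def by auto
    show "generate ?R (\<Union>z\<in>\<Lambda>'. A z) = carrier ?R" using genM by simp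
  qed
  moreover have "(\<lambda>r. a (fst z) (snd z) \<otimes>\<^bsub>?R\<^esub> r \<otimes>\<^bsub>?R\<^esub> inv\<^bsub>?R\<^esub> a (fst z) (snd z)) ` A z = \<alpha> ` A z" if "z \<in> \<Lambda>'" for z
    unfolding img[OF that] A'_def by (simp add: split_beta)
  ultimately have gen': "generate ?R (\<Union>z\<in>\<Lambda>'. \<alpha> ` A z) = M" by simp
  \<comment> \<open>\<open>\<alpha>\<close> maps the generators of \<open>M\<close> to conjugates by
    elements of \<open>M\<close>, which generate \<open>M\<close> again. Finiteness then gives
    injectivity on \<open>M\<close>, although \<open>\<alpha>\<close> may fail to be injective on
    \<open>R\<close>.\<close>
  have "\<alpha> ` M = generate R (\<alpha> ` (\<Union>z\<in>\<Lambda>'. A z))" unfolding M_def by (rule \<alpha>.generate_img[OF Asub, symmetric])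
  also have "\<alpha> ` (\<Union>z\<in>\<Lambda>'. A z) = (\<Union>z\<in>\<Lambda>'. \<alpha> ` A z)" by (rule image_UN)
  also have "generate R (\<Union>z\<in>\<Lambda>'. \<alpha> ` A z) = M"
  proof -
    have "(\<Union>z\<in>\<Lambda>'. \<alpha> ` A z) \<subseteq> generate ?R (\<Union>z\<in>\<Lambda>'. \<alpha> ` A z)" by (rule subsetI) (rule generate.incl)
    then have "(\<Union>z\<in>\<Lambda>'. \<alpha> ` A z) \<subseteq> M" unfolding gen' .
    then show ?thesis using R.generate_consistent[OF _ M] gen' by metis
  qed
  finally have \<alpha>M: "\<alpha> ` M = M" .
  have "finite M" using MR R.finite_carrier by (rule finite_subset)
  then have inj: "inj_on \<alpha> M" using \<alpha>M by (simp add: eq_card_imp_inj_on)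
  define \<alpha>' where "\<alpha>' = inv_into M \<alpha>"
  have \<alpha>': "\<alpha>' r \<in> M" "\<alpha> (\<alpha>' r) = r" if "r \<in> M" for r
    unfolding \<alpha>'_def using inv_into_into[of r \<alpha> M] f_inv_into_f[of r \<alpha> M] that \<alpha>M by simp_all
  have \<alpha>'\<alpha>: "\<alpha>' (\<alpha> r) = r" if "r \<in> M" for r unfolding \<alpha>'_def using inj that by (rule inv_into_f_f)
  have \<alpha>'_mult: "\<alpha>' (r \<otimes>\<^bsub>R\<^esub> s) = \<alpha>' r \<otimes>\<^bsub>R\<^esub> \<alpha>' s" if rs: "r \<in> M" "s \<in> M" for r s
  proof -
    have "\<alpha>' r \<in> carrier R" "\<alpha>' s \<in> carrier R" using \<alpha>'(1) rs MR by blast+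
    then have "\<alpha> (\<alpha>' r \<otimes>\<^bsub>R\<^esub> \<alpha>' s) = r \<otimes>\<^bsub>R\<^esub> s" using \<alpha>'(2) rs by simp
    moreover have "\<alpha>' r \<otimes>\<^bsub>R\<^esub> \<alpha>' s \<in> M" using \<alpha>'(1) rs by (simp add: subgroup.m_closed[OF M])
    ultimately show ?thesis using \<alpha>'\<alpha> by metis
  qed
  \<comment> \<open>The coordinate that conjugates by 1, where the universal family \<open>U\<close>
    is \<open>u\<close> itself.\<close>
  define e where "e = (\<lambda>z\<in>\<Lambda>. \<one>\<^bsub>Q\<^esub>)"
  have e: "e \<in> X" unfolding e_def X_def by auto
  have g_M: "g h \<in> M" if "h \<in> H" for h using hom_in_carrier[OF g, of h] that by simp
  have g_mult: "g (h \<otimes> k) = g h \<otimes>\<^bsub>R\<^esub> g k" if "h \<in> H" "k \<in> H" for h k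
    using hom_mult[OF g, of h k] that by simp
  have "(\<lambda>h. \<alpha>' (g h) e) \<in> hom (G\<lparr>carrier := H\<rparr>) Q"
  proof (rule homI)
    fix h assume "h \<in> carrier (G\<lparr>carrier := H\<rparr>)"
    then have h: "h \<in> H" by simp
    have "\<alpha>' (g h) \<in> carrier R" using \<alpha>'(1)[OF g_M[OF h]] MR by blast
    then show "\<alpha>' (g h) e \<in> carrier Q" using e unfolding carR by (rule PiE_mem)
    fix k assume "k \<in> carrier (G\<lparr>carrier := H\<rparr>)"
    then have k: "k \<in> H" by simp
    show "\<alpha>' (g (h \<otimes>\<^bsub>G\<lparr>carrier := H\<rparr>\<^esub> k)) e = \<alpha>' (g h) e \<otimes>\<^bsub>Q\<^esub> \<alpha>' (g k) e"
      using e by (simp add: g_mult[OF h k] \<alpha>'_mult[OF g_M[OF h] g_M[OF k]]) (simp add: multR)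
  qed
  moreover have "\<alpha>' (g w) e = \<one>\<^bsub>Q\<^esub>" if "w \<in> W \<inter> H" for w
  proof -
    have "g w = \<alpha> \<one>\<^bsub>R\<^esub>" using W(2) that by simp
    then have "\<alpha>' (g w) = \<one>\<^bsub>R\<^esub>" using \<alpha>'\<alpha>[OF subgroup.one_closed[OF M]] by simp
    then show ?thesis using e by (simp add: oneR)
  qed
  moreover have "\<alpha>' (g y) e = u i x y" if ix: "i \<in> I" "x \<in> D i" "y \<in> L i x" for i x y
  proof -
    have "\<alpha>' (g y) = U i x y" unfolding gU[OF ix] \<alpha>U[OF ix, symmetric] by (rule \<alpha>'\<alpha>[OF U_M[OF ix]])
    moreover have "U i x y e = u i x y"
      using e u_car[OF ix] trivial[OF ix(1) _ ix(2,3)] ix(2) by (simp add: U_def e_def \<Lambda>_def)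
    ultimately show ?thesis by simp
  qed
  ultimately show ?thesis using W(1) by (intro exI[of _ "\<lambda>h. \<alpha>' (g h) e"] exI[of _ W]) simp
qed

end

section \<open>Double cosets and pro-p targets\<close>

lemma (in group) mem_double_coset_iff:
  "y \<in> double_coset G H K x \<longleftrightarrow> (\<exists>h\<in>H. \<exists>k\<in>K. y = h \<otimes> x \<otimes> k)"
  unfolding double_coset_def set_mult_def r_coset_def by blast

lemma (in group) double_coset_eq:
  assumes "subgroup H G" "subgroup K G" "x \<in> carrier G" "y \<in> double_coset G H K x"
  shows "double_coset G H K y = double_coset G H K x"
proof -
  interpret H: subgroup H G by fact
  interpret K: subgroup K G by fact
  obtain h k where hk: "h \<in> H" "k \<in> K" "y = h \<otimes> x \<otimes> k" using assms(4) unfolding mem_double_coset_iff by blast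
  have "h' \<otimes> y \<otimes> k' = (h' \<otimes> h) \<otimes> x \<otimes> (k \<otimes> k')" if "h' \<in> H" "k' \<in> K" for h' k'
    using that hk assms(3) by (simp add: m_assoc)
  moreover have "h' \<otimes> x \<otimes> k' = (h' \<otimes> inv h) \<otimes> y \<otimes> (inv k \<otimes> k')" if "h' \<in> H" "k' \<in> K" for h' k'
    using that hk assms(3) by (simp add: m_assoc)
  ultimately show ?thesis
    using hk unfolding set_eq_iff mem_double_coset_iff
    by (metis H.m_closed H.m_inv_closed K.m_closed K.m_inv_closed)
qed

lemma (in group) double_coset_representatives_cover:
  assumes "subgroup H G" "subgroup K G" "double_coset_representatives G H K D" "g \<in> carrier G"
  shows "\<exists>x\<in>D. \<exists>h\<in>H. \<exists>k\<in>K. g = h \<otimes> x \<otimes> k"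
proof -
  have "double_coset G H K g \<in> double_coset G H K ` D"
    using assms(3,4) unfolding double_coset_representatives_def double_cosets_def bij_betw_def by blast
  moreover have "g = \<one> \<otimes> g \<otimes> \<one>" using assms(4) by simp
  then have "g \<in> double_coset G H K g"
    using subgroup.one_closed[OF assms(1)] subgroup.one_closed[OF assms(2)] unfolding mem_double_coset_iff by blast
  ultimately show ?thesis unfolding mem_double_coset_iff[symmetric] by blast
qed

lemma (in group) double_coset_representatives_unique:
  assumes "subgroup H G" "subgroup K G" "double_coset_representatives G H K D" "x \<in> D" "y \<in> D"
    "h \<in> H" "k \<in> K" "y = h \<otimes> x \<otimes> k"
  shows "x = y"
proof -
  have x: "x \<in> carrier G" using assms(3,4) unfolding double_coset_representatives_def by blast
  have "y \<in> double_coset G H K x" unfolding mem_double_coset_iff using assms(6-8) by blast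
  then have "double_coset G H K y = double_coset G H K x" by (rule double_coset_eq[OF assms(1,2) x])
  then show ?thesis
    using assms(3-5) unfolding double_coset_representatives_def bij_betw_def inj_on_def by simp
qed

section \<open>Separating elements by open normal subgroups\<close>

context profinite_group
begin

lemma open_normal_separates:
  assumes "x \<in> carrier G" "x \<noteq> \<one>"
  obtains V where "open_normal V G T" "x \<notin> V"
proof -
  have "closedin T {x}" using hausdorff assms(1) by (simp add: closedin_Hausdorff_singleton topspace_eq)
  then have "openin T (topspace T - {x})" by blast
  then obtain V where "open_normal V G T" "V \<subseteq> topspace T - {x}"
    by (rule open_normal_basis) (use assms in \<open>simp add: topspace_eq\<close>)
  then show thesis using that by blast
qed

lemma eq_if_eq_mod_open_normals:
  assumes "x \<in> carrier G" "y \<in> carrier G" "\<And>N. open_normal N G T \<Longrightarrow> x \<in> N #> y"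
  shows "x = y"
proof (rule ccontr)
  assume "x \<noteq> y"
  then have "x \<otimes> inv y \<noteq> \<one>" using assms(1,2) by (metis inv_solve_right' l_one one_closed)
  then obtain V where V: "open_normal V G T" "x \<otimes> inv y \<notin> V"
    using open_normal_separates[of "x \<otimes> inv y"] assms(1,2) by auto
  then show False
    using subgroup.rcos_module_imp[OF open_normal_subgroup[OF V(1)] is_group assms(2) assms(3)[OF V(1)]] by blast
qed

lemma open_subgroup_contains_open_normal:
  assumes "openin (subtopology T K) U" "\<one> \<in> U"
  obtains V where "open_normal V G T" "V \<inter> K \<subseteq> U"
proof -
  obtain U' where U: "openin T U'" "U = U' \<inter> K" using assms(1) unfolding openin_subtopology by blast
  then obtain V where "open_normal V G T" "V \<subseteq> U'" using open_normal_basis[OF U(1)] assms(2) by blast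
  then show thesis using that U(2) by blast
qed

lemma closedin_rcoset_open_normal:
  assumes N: "open_normal N G T" and x: "x \<in> carrier G"
  shows "closedin T (N #> x)"
proof (rule closedin_saturated[OF N])
  interpret N: normal N G using N by (simp add: open_normal_def)
  show "N #> x \<subseteq> carrier G" using x N.subset by (simp add: r_coset_subset_G)
  fix a v assume "a \<in> N #> x" and v: "v \<in> N"
  then obtain n where n: "n \<in> N" "a = n \<otimes> x" unfolding r_coset_def by blast
  have "a \<otimes> v = (n \<otimes> (x \<otimes> v \<otimes> inv x)) \<otimes> x" using n v x by (simp add: m_assoc)
  moreover have "n \<otimes> (x \<otimes> v \<otimes> inv x) \<in> N" using n v N.inv_op_closed2[OF x] by blast
  ultimately show "a \<otimes> v \<in> N #> x" unfolding r_coset_def by blast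
qed

end

section \<open>The factors of \<open>H\<close>, and extension to pro-\<open>p\<close>
  targets\<close>

context subgroup_with_representatives
begin

lemma H_pro_p_group: "pro_p_group p (G\<lparr>carrier := H\<rparr>) (subtopology T H)"
  by (rule pro_p_group_closed_subgroup[OF prime H])

text \<open>A normal \<open>V\<close> containing \<open>S i\<close> contains all its conjugates. So
  the pairs that fail involve finitely many \<open>i\<close>, each with a finite
  \<open>D i\<close>.\<close>

lemma L_converges: "converges_to_1 (G\<lparr>carrier := H\<rparr>) (subtopology T H) (SIGMA i:I. D i) (\<lambda>(i, x). L i x)"
  unfolding converges_to_1_def
proof (intro allI impI)
  fix U assume U: "subgroup U (G\<lparr>carrier := H\<rparr>)" "openin (subtopology T H) U"
  have "\<one> \<in> U" using subgroup.one_closed[OF U(1)] by simp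
  then obtain V where V: "open_normal V G T" "V \<inter> H \<subseteq> U"
    by (rule open_subgroup_contains_open_normal[OF U(2)])
  interpret V: normal V G using V by (simp add: open_normal_def)
  have J: "finite {i \<in> I. \<not> S i \<subseteq> V}"
    using converges V(1) V.subgroup_axioms unfolding converges_to_1_def open_normal_def by simp
  have sub: "L i x \<subseteq> U" if i: "i \<in> I" "S i \<subseteq> V" and x: "x \<in> D i" for i x
  proof
    fix y assume y: "y \<in> L i x"
    have c: "x \<in> carrier G" "y \<in> carrier G" using D_in_carrier[OF i(1) x] H_carrier y by auto
    have "inv x \<otimes> y \<otimes> x \<in> V" using y mem_conjugate[OF i(1) x] i(2) by blast
    then have "x \<otimes> (inv x \<otimes> y \<otimes> x) \<otimes> inv x \<in> V" by (rule V.inv_op_closed2[OF c(1)])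
    then have "y \<in> V" using c by (simp add: m_assoc)
    then show "y \<in> U" using V(2) y by blast
  qed
  have "{z \<in> SIGMA i:I. D i. \<not> (case z of (i, x) \<Rightarrow> L i x) \<subseteq> U} \<subseteq> (SIGMA i:{i \<in> I. \<not> S i \<subseteq> V}. D i)"
    using sub by auto
  moreover have "finite (SIGMA i:{i \<in> I. \<not> S i \<subseteq> V}. D i)"
    using J D_finite by (intro finite_SigmaI) auto
  ultimately show "finite {z \<in> SIGMA i:I. D i. \<not> (case z of (i, x) \<Rightarrow> L i x) \<subseteq> U}"
    by (rule finite_subset)
qed

lemma L_closed_subgroup:
  assumes "i \<in> I" "x \<in> D i"
  shows "closed_subgroup (L i x) (G\<lparr>carrier := H\<rparr>) (subtopology T H)"
proof -
  have "subgroup (L i x) (G\<lparr>carrier := H\<rparr>)"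
    using subgroup_incl[OF L_subgroup[OF assms] H_subgroup] by simp
  moreover have "closedin (subtopology T H) (L i x)"
    using conjugate_closed[OF assms] closedin_subtopology_Int_closed by metis
  ultimately show ?thesis unfolding closed_subgroup_def by simp
qed

text \<open>A common element \<open>z\<close> other than 1 survives in a finite quotient
  \<open>G Mod V\<close>, which serves as the target of the extension. Two representatives for the
  same \<open>i\<close> are treated exactly like different \<open>i\<close>.\<close>

lemma L_Int_trivial:
  assumes free: "restricted_free_pro_p_product TYPE('u::infinite) p G T I S"
    and ix: "i \<in> I" "x \<in> D i" and jy: "j \<in> I" "y \<in> D j" and ne: "(i, x) \<noteq> (j, y)"
  shows "L i x \<inter> L j y = {\<one>}"
proof
  show "{\<one>} \<subseteq> L i x \<inter> L j y"
    using subgroup.one_closed[OF L_subgroup[OF ix]] subgroup.one_closed[OF L_subgroup[OF jy]] by blast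
  show "L i x \<inter> L j y \<subseteq> {\<one>}"
  proof
    fix z assume z: "z \<in> L i x \<inter> L j y"
    then have zc: "z \<in> carrier G" using H_carrier by blast
    show "z \<in> {\<one>}"
    proof (rule ccontr)
      assume "z \<notin> {\<one>}"
      then have "z \<noteq> \<one>" by simp
      then obtain V where V: "open_normal V G T" "z \<notin> V" by (rule open_normal_separates[OF zc])
      interpret V: normal V G using V by (simp add: open_normal_def)
      interpret B: finite_p_group p "G Mod V" by (rule finite_p_group_Mod[OF prime V(1)])
      define u where "u i' x' w = (if (i', x') = (i, x) then V #> w else \<one>\<^bsub>G Mod V\<^esub>)" for i' x' w
      have "u i' x' \<in> hom (G\<lparr>carrier := L i' x'\<rparr>) (G Mod V)" if "i' \<in> I" "x' \<in> D i'" for i' x'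
      proof (cases "(i', x') = (i, x)")
        case True
        have "(\<lambda>w. V #> w) \<in> hom (G\<lparr>carrier := L i' x'\<rparr>) (G Mod V)"
          using V.r_coset_hom_Mod H_carrier by (simp add: hom_def Pi_iff)
        then show ?thesis using True by (simp add: u_def hom_def Pi_iff)
      next
        case False
        then have "u i' x' = (\<lambda>_. \<one>\<^bsub>G Mod V\<^esub>)" by (auto simp: u_def fun_eq_iff)
        then show ?thesis using B.one_closed B.r_one[OF B.one_closed] by (simp add: hom_def)
      qed
      moreover have "u i' x' v = \<one>\<^bsub>G Mod V\<^esub>" if "v \<in> V \<inter> L i' x'" for i' x' v
        using that coset_join2[OF _ V.subgroup_axioms, of v] by (simp add: u_def)
      ultimately have "\<exists>g W. g \<in> hom (G\<lparr>carrier := H\<rparr>) (G Mod V) \<and> open_normal W G T \<and>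
          (\<forall>w\<in>W \<inter> H. g w = \<one>\<^bsub>G Mod V\<^esub>) \<and> (\<forall>i\<in>I. \<forall>x\<in>D i. \<forall>y\<in>L i x. g y = u i x y)"
        by (intro finite_extension[OF free B.finite_p_group_axioms V(1)])
      then obtain g where g: "\<forall>i\<in>I. \<forall>x\<in>D i. \<forall>y\<in>L i x. g y = u i x y" by (elim exE conjE)
      have "g z = u i x z" "g z = u j y z"
        using g[rule_format, OF ix, of z] g[rule_format, OF jy, of z] z by blast+
      then have "V #> z = V" using ne by (simp add: u_def split: if_splits)
      then show False using V(2) rcos_self[OF zc V.subgroup_axioms] by simp
    qed
  qed
qed

text \<open>The extension \<open>g N\<close> modulo an open normal \<open>N\<close> takes cosets of
  \<open>N\<close> as values, that is, closed subsets of \<open>P\<close>. The value at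
  \<open>h\<close> of the extension to \<open>P\<close> is the common point of all the
  \<open>g N h\<close>: it exists by compactness and is unique because the subgroups
  \<open>N\<close> separate points.\<close>

lemma pro_p_extension:
  fixes P :: "('v, 'w) monoid_scheme"
  assumes free: "restricted_free_pro_p_product TYPE('u::infinite) p G T I S"
    and P: "pro_p_group p P TP"
    and gen: "topologically_generated_by (G\<lparr>carrier := H\<rparr>) (subtopology T H) (\<Union>i\<in>I. \<Union>x\<in>D i. L i x)"
    and f: "\<And>i x. i \<in> I \<Longrightarrow> x \<in> D i \<Longrightarrow> f i x \<in> continuous_hom (G\<lparr>carrier := L i x\<rparr>) (subtopology T (L i x)) P TP"
    and conv: "converges_to_1 P TP (SIGMA i:I. D i) (\<lambda>(i, x). f i x ` L i x)"
  shows "\<exists>g. g \<in> continuous_hom (G\<lparr>carrier := H\<rparr>) (subtopology T H) P TP \<and>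
    (\<forall>i\<in>I. \<forall>x\<in>D i. \<forall>y\<in>L i x. g y = f i x y)"
proof -
  interpret P: pro_p_group p P TP by fact
  interpret Hp: pro_p_group p "G\<lparr>carrier := H\<rparr>" "subtopology T H" by (rule H_pro_p_group)
  have Lsub: "(\<Union>i\<in>I. \<Union>x\<in>D i. L i x) \<subseteq> carrier (G\<lparr>carrier := H\<rparr>)" by auto
  have f_hom: "f i x \<in> hom (G\<lparr>carrier := L i x\<rparr>) P" if "i \<in> I" "x \<in> D i" for i x
    using f[OF that] by (simp add: continuous_hom_def)
  have f_car: "f i x y \<in> carrier P" if "i \<in> I" "x \<in> D i" "y \<in> L i x" for i x y
    using hom_in_carrier[OF f_hom[OF that(1,2)], of y] that(3) by simp
  have "\<exists>g W. g \<in> hom (G\<lparr>carrier := H\<rparr>) (P Mod N) \<and> open_normal W G T \<and> (\<forall>w\<in>W \<inter> H. g w = N) \<and>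
      (\<forall>i\<in>I. \<forall>x\<in>D i. \<forall>y\<in>L i x. g y = N #>\<^bsub>P\<^esub> f i x y)" if N: "open_normal N P TP" for N
  proof -
    interpret N: normal N P using N by (simp add: open_normal_def)
    interpret Q: finite_p_group p "P Mod N" by (rule P.finite_p_group_Mod[OF prime N])
    \<comment> \<open>By convergence only finitely many \<open>f i x\<close> have an image outside
      \<open>N\<close>; continuity of these few yields one \<open>V\<close> that serves the whole
      family.\<close>
    define F where "F = {z \<in> SIGMA i:I. D i. \<not> (case z of (i, x) \<Rightarrow> f i x ` L i x) \<subseteq> N}"
    have F: "finite F"
      using conv N N.subgroup_axioms unfolding F_def converges_to_1_def open_normal_def by simp
    have "\<exists>V. open_normal V G T \<and> V \<subseteq> carrier G \<and>
        (\<forall>z\<in>F. case z of (i, x) \<Rightarrow> \<forall>v\<in>V \<inter> L i x. f i x v \<in> N)"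
    proof (rule open_normal_finite_refine[OF F open_normal_carrier])
      fix z assume "z \<in> F"
      then obtain i x where z: "z = (i, x)" "i \<in> I" "x \<in> D i" unfolding F_def by auto
      obtain V where "open_normal V G T" "\<And>v. v \<in> V \<inter> L i x \<Longrightarrow> f i x v \<in> N"
        using continuous_hom_kernel_nbhd[OF f[OF z(2,3)] L_subgroup[OF z(2,3)] P.is_group _ N.one_closed] N
        unfolding open_normal_def by metis
      then show "\<exists>V. open_normal V G T \<and> (case z of (i, x) \<Rightarrow> \<forall>v\<in>V \<inter> L i x. f i x v \<in> N)"
        using z(1) by auto
    qed (auto split: prod.splits)
    then obtain V where V: "open_normal V G T" "\<forall>z\<in>F. case z of (i, x) \<Rightarrow> \<forall>v\<in>V \<inter> L i x. f i x v \<in> N"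
      by (elim exE conjE)
    have fN: "f i x v \<in> N" if "i \<in> I" "x \<in> D i" "v \<in> V \<inter> L i x" for i x v
    proof (cases "(i, x) \<in> F")
      case True
      then show ?thesis using V(2) that(3) by fastforce
    next
      case False
      then show ?thesis using that unfolding F_def by auto
    qed
    have "\<exists>g W. g \<in> hom (G\<lparr>carrier := H\<rparr>) (P Mod N) \<and> open_normal W G T \<and>
        (\<forall>w\<in>W \<inter> H. g w = \<one>\<^bsub>P Mod N\<^esub>) \<and> (\<forall>i\<in>I. \<forall>x\<in>D i. \<forall>y\<in>L i x. g y = N #>\<^bsub>P\<^esub> f i x y)"
    proof (rule finite_extension[OF free Q.finite_p_group_axioms V(1)])
      fix i x assume ix: "i \<in> I" "x \<in> D i"
      show "(\<lambda>y. N #>\<^bsub>P\<^esub> f i x y) \<in> hom (G\<lparr>carrier := L i x\<rparr>) (P Mod N)"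
        by (rule hom_comp[OF f_hom[OF ix] N.r_coset_hom_Mod])
      fix v assume v: "v \<in> V \<inter> L i x"
      show "N #>\<^bsub>P\<^esub> f i x v = \<one>\<^bsub>P Mod N\<^esub>"
        using P.coset_join2[OF _ N.subgroup_axioms fN[OF ix v]] f_car[OF ix] v by simp
    qed
    then show ?thesis by simp
  qed
  then have "\<exists>gW. \<forall>N. open_normal N P TP \<longrightarrow> fst (gW N) \<in> hom (G\<lparr>carrier := H\<rparr>) (P Mod N) \<and>
      open_normal (snd (gW N)) G T \<and> (\<forall>w\<in>snd (gW N) \<inter> H. fst (gW N) w = N) \<and>
      (\<forall>i\<in>I. \<forall>x\<in>D i. \<forall>y\<in>L i x. fst (gW N) y = N #>\<^bsub>P\<^esub> f i x y)"
    by (intro choice allI) simp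
  then obtain gW where gW: "\<forall>N. open_normal N P TP \<longrightarrow> fst (gW N) \<in> hom (G\<lparr>carrier := H\<rparr>) (P Mod N) \<and>
      open_normal (snd (gW N)) G T \<and> (\<forall>w\<in>snd (gW N) \<inter> H. fst (gW N) w = N) \<and>
      (\<forall>i\<in>I. \<forall>x\<in>D i. \<forall>y\<in>L i x. fst (gW N) y = N #>\<^bsub>P\<^esub> f i x y)" by (rule exE)
  define g where "g N = fst (gW N)" for N
  define W where "W N = snd (gW N)" for N
  have g_hom: "g N \<in> hom (G\<lparr>carrier := H\<rparr>) (P Mod N)" and W: "open_normal (W N) G T"
    and gW1: "\<forall>w\<in>W N \<inter> H. g N w = N" and g_f: "\<forall>i\<in>I. \<forall>x\<in>D i. \<forall>y\<in>L i x. g N y = N #>\<^bsub>P\<^esub> f i x y"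
    if "open_normal N P TP" for N
    using gW that unfolding g_def W_def by simp_all
  have g_coset: "\<exists>a\<in>carrier P. g N h = N #>\<^bsub>P\<^esub> a" if "open_normal N P TP" "h \<in> H" for N h
    using hom_in_carrier[OF g_hom[OF that(1)], of h] that(2) by (auto simp: carrier_FactGroup)
  \<comment> \<open>Generation of \<open>H\<close> makes the separately chosen extensions
    compatible: projected to \<open>P Mod M\<close>, they agree on every \<open>L i x\<close>.
    Cosets being sets, the projection is multiplication by \<open>M\<close>.\<close>
  have mono: "g N h \<subseteq> g M h" if N: "open_normal N P TP" and M: "open_normal M P TP" and NM: "N \<subseteq> M" and h: "h \<in> H" for N M h
  proof -
    interpret N: normal N P using N by (simp add: open_normal_def)
    interpret M: normal M P using M by (simp add: open_normal_def)
    interpret Q: finite_p_group p "P Mod M" by (rule P.finite_p_group_Mod[OF prime M])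
    have proj: "M <#>\<^bsub>P\<^esub> (N #>\<^bsub>P\<^esub> a) = M #>\<^bsub>P\<^esub> a" if a: "a \<in> carrier P" for a
    proof -
      have "M <#>\<^bsub>P\<^esub> (N #>\<^bsub>P\<^esub> a) = (M <#>\<^bsub>P\<^esub> N) #>\<^bsub>P\<^esub> a"
        using a M.subset N.subset by (simp add: P.setmult_rcos_assoc)
      moreover have "M <#>\<^bsub>P\<^esub> N = M"
      proof
        show "M <#>\<^bsub>P\<^esub> N \<subseteq> M" using NM M.m_closed unfolding set_mult_def by blast
        show "M \<subseteq> M <#>\<^bsub>P\<^esub> N"
        proof
          fix m assume m: "m \<in> M"
          then show "m \<in> M <#>\<^bsub>P\<^esub> N" using P.set_multI[OF m N.one_closed] M.subset by auto
        qed
      qed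
      ultimately show ?thesis by simp
    qed
    have proj_hom: "(\<lambda>A. M <#>\<^bsub>P\<^esub> A) \<in> hom (P Mod N) (P Mod M)"
    proof (rule homI)
      fix A assume "A \<in> carrier (P Mod N)"
      then obtain a where a: "a \<in> carrier P" "A = N #>\<^bsub>P\<^esub> a" by (auto simp: carrier_FactGroup)
      then show "M <#>\<^bsub>P\<^esub> A \<in> carrier (P Mod M)" by (auto simp: carrier_FactGroup proj)
      fix B assume "B \<in> carrier (P Mod N)"
      then obtain b where b: "b \<in> carrier P" "B = N #>\<^bsub>P\<^esub> b" by (auto simp: carrier_FactGroup)
      show "M <#>\<^bsub>P\<^esub> (A \<otimes>\<^bsub>P Mod N\<^esub> B) = (M <#>\<^bsub>P\<^esub> A) \<otimes>\<^bsub>P Mod M\<^esub> (M <#>\<^bsub>P\<^esub> B)"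
        using a b by (simp add: N.rcos_sum M.rcos_sum proj)
    qed
    have "M <#>\<^bsub>P\<^esub> g N h = g M h"
    proof (rule Hp.homs_eq_if_eq_on_generators[OF gen Lsub Q.is_group hom_comp[OF g_hom[OF N] proj_hom] g_hom[OF M]
          open_normal_Int_subgroup[OF open_normal_Int[OF W[OF N] W[OF M]] H_subgroup]])
      show "M <#>\<^bsub>P\<^esub> g N v = g M v" if "v \<in> W N \<inter> W M \<inter> H" for v
        using that gW1[OF N] gW1[OF M] proj[OF P.one_closed] M.subset N.subset by simp
      show "M <#>\<^bsub>P\<^esub> g N y = g M y" if y: "y \<in> (\<Union>i\<in>I. \<Union>x\<in>D i. L i x)" for y
      proof -
        obtain i x where "i \<in> I" "x \<in> D i" "y \<in> L i x" using y by blast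
        then show ?thesis using g_f[OF N] g_f[OF M] proj f_car by simp
      qed
    qed (simp add: h)
    moreover obtain a where a: "a \<in> carrier P" "g N h = N #>\<^bsub>P\<^esub> a" using g_coset[OF N h] by blast
    ultimately have "g M h = M #>\<^bsub>P\<^esub> a" using proj by simp
    then show ?thesis using a NM unfolding r_coset_def by auto
  qed
  have ex: "\<exists>y\<in>carrier P. \<forall>N. open_normal N P TP \<longrightarrow> y \<in> g N h" if h: "h \<in> H" for h
  proof -
    let ?\<U> = "(\<lambda>N. g N h) ` {N. open_normal N P TP}"
    have "\<forall>C\<in>?\<U>. closedin TP C"
    proof
      fix C assume "C \<in> ?\<U>"
      then obtain N where N: "open_normal N P TP" "C = g N h" by blast
      then show "closedin TP C" using g_coset[OF N(1) h] P.closedin_rcoset_open_normal[OF N(1)] by auto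
    qed
    \<comment> \<open>Finitely many \<open>N\<close> contain a common open normal \<open>M\<close>,
      and by \<open>mono\<close> each point of \<open>g M h\<close> lies in all the corresponding
      \<open>g N h\<close>.\<close>
    moreover have "\<Inter>\<F> \<noteq> {}" if \<F>: "finite \<F>" "\<F> \<subseteq> ?\<U>" for \<F>
    proof -
      obtain E where E: "finite E" "E \<subseteq> {N. open_normal N P TP}" "\<F> = (\<lambda>N. g N h) ` E"
        using finite_subset_image[OF \<F>] by blast
      have "\<exists>M. open_normal M P TP \<and> M \<subseteq> carrier P \<and> (\<forall>N\<in>E. M \<subseteq> N)"
      proof (rule P.open_normal_finite_refine[OF E(1) P.open_normal_carrier])
        show "\<exists>V. open_normal V P TP \<and> V \<subseteq> N" if "N \<in> E" for N using that E(2) by blast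
      qed (rule subset_trans)
      then obtain M where M: "open_normal M P TP" "\<forall>N\<in>E. M \<subseteq> N" by (elim exE conjE)
      obtain a where a: "a \<in> carrier P" "g M h = M #>\<^bsub>P\<^esub> a" using g_coset[OF M(1) h] by blast
      have "a \<in> g M h" unfolding a(2) by (rule P.rcos_self[OF a(1) P.open_normal_subgroup[OF M(1)]])
      then have "a \<in> g N h" if "N \<in> E" for N
        using mono[OF M(1) _ _ h, of N] that M(2) E(2) by auto
      then show ?thesis unfolding E(3) by auto
    qed
    ultimately have "\<Inter>?\<U> \<noteq> {}" using P.compact unfolding compact_space_fip by simp
    then obtain y where y: "\<forall>N. open_normal N P TP \<longrightarrow> y \<in> g N h" by auto
    \<comment> \<open>The whole group is one of the open normal subgroups; its coset shows that
      \<open>y\<close> lies in \<open>P\<close>.\<close>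
    obtain a where "a \<in> carrier P" "g (carrier P) h = carrier P #>\<^bsub>P\<^esub> a"
      using g_coset[OF P.open_normal_carrier h] by blast
    then have "y \<in> carrier P"
      using y P.open_normal_carrier P.r_coset_subset_G[OF subset_refl] by blast
    then show ?thesis using y by blast
  qed
  have uniq: "y = y'" if h: "h \<in> H" and y: "y \<in> carrier P" "\<And>N. open_normal N P TP \<Longrightarrow> y \<in> g N h"
    and y': "y' \<in> carrier P" "\<And>N. open_normal N P TP \<Longrightarrow> y' \<in> g N h" for h y y'
  proof (rule P.eq_if_eq_mod_open_normals[OF y(1) y'(1)])
    fix N assume N: "open_normal N P TP"
    obtain a where a: "a \<in> carrier P" "g N h = N #>\<^bsub>P\<^esub> a" using g_coset[OF N h] by blast
    have "N #>\<^bsub>P\<^esub> a = N #>\<^bsub>P\<^esub> y'"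
      using y'(2)[OF N] a by (intro P.repr_independence[OF _ _ P.open_normal_subgroup[OF N]]) simp_all
    then show "y \<in> N #>\<^bsub>P\<^esub> y'" using y(2)[OF N] a by simp
  qed
  define G' where "G' h = (SOME y. y \<in> carrier P \<and> (\<forall>N. open_normal N P TP \<longrightarrow> y \<in> g N h))" for h
  have G': "G' h \<in> carrier P \<and> (\<forall>N. open_normal N P TP \<longrightarrow> G' h \<in> g N h)" if "h \<in> H" for h
    unfolding G'_def by (rule someI_ex) (use ex[OF that] in blast)
  have G'_eq: "G' h = y" if "h \<in> H" "y \<in> carrier P" "\<And>N. open_normal N P TP \<Longrightarrow> y \<in> g N h" for h y
    using uniq[OF that(1) _ _ that(2,3)] G'[OF that(1)] by simp
  have "G' \<in> hom (G\<lparr>carrier := H\<rparr>) P"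
  proof (rule homI)
    fix h assume "h \<in> carrier (G\<lparr>carrier := H\<rparr>)"
    then have h: "h \<in> H" by simp
    then show "G' h \<in> carrier P" using G' by simp
    fix k assume "k \<in> carrier (G\<lparr>carrier := H\<rparr>)"
    then have k: "k \<in> H" by simp
    have "G' (h \<otimes> k) = G' h \<otimes>\<^bsub>P\<^esub> G' k"
    proof (rule G'_eq)
      show "h \<otimes> k \<in> H" using h k by (simp add: subgroup.m_closed[OF H_subgroup])
      show "G' h \<otimes>\<^bsub>P\<^esub> G' k \<in> carrier P" using G' h k by simp
      fix N assume N: "open_normal N P TP"
      have "g N (h \<otimes> k) = g N h <#>\<^bsub>P\<^esub> g N k" using hom_mult[OF g_hom[OF N], of h k] h k by simp
      then show "G' h \<otimes>\<^bsub>P\<^esub> G' k \<in> g N (h \<otimes> k)" using G' h k N by (simp add: P.set_multI)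
    qed
    then show "G' (h \<otimes>\<^bsub>G\<lparr>carrier := H\<rparr>\<^esub> k) = G' h \<otimes>\<^bsub>P\<^esub> G' k" by simp
  qed
  then have "G' \<in> continuous_hom (G\<lparr>carrier := H\<rparr>) (subtopology T H) P TP"
  proof (rule Hp.continuous_homI[OF P.profinite_group_axioms])
    fix N assume N: "open_normal N P TP"
    have "G' w \<in> N" if "w \<in> W N \<inter> H" for w
      using G'[of w] gW1[OF N] that N by auto
    then show "\<exists>V. open_normal V (G\<lparr>carrier := H\<rparr>) (subtopology T H) \<and> G' ` V \<subseteq> N"
      by (intro exI[of _ "W N \<inter> H"] conjI open_normal_Int_subgroup[OF W[OF N] H_subgroup]) auto
  qed
  moreover have "G' y = f i x y" if "i \<in> I" "x \<in> D i" "y \<in> L i x" for i x y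
  proof (rule G'_eq)
    show "y \<in> H" using that by blast
    show "f i x y \<in> carrier P" by (rule f_car[OF that])
    fix N assume N: "open_normal N P TP"
    show "f i x y \<in> g N y"
      using P.rcos_self[OF f_car[OF that] P.open_normal_subgroup[OF N]] g_f[OF N] that by simp
  qed
  ultimately show ?thesis by blast
qed

text \<open>Modulo an open normal \<open>N\<close> of \<open>P\<close>, both maps are trivial on a
  common open normal subgroup, so \<open>homs_eq_if_eq_on_generators\<close> applies in the finite
  quotient; letting \<open>N\<close> vary separates the values in \<open>P\<close>.\<close>

lemma continuous_homs_eq:
  assumes P: "pro_p_group p P TP"
    and gen: "topologically_generated_by (G\<lparr>carrier := H\<rparr>) (subtopology T H) X" and X: "X \<subseteq> H"
    and g: "g \<in> continuous_hom (G\<lparr>carrier := H\<rparr>) (subtopology T H) P TP"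
    and g': "g' \<in> continuous_hom (G\<lparr>carrier := H\<rparr>) (subtopology T H) P TP"
    and eq: "\<And>x. x \<in> X \<Longrightarrow> g x = g' x" and h: "h \<in> H"
  shows "g h = g' h"
proof -
  interpret P: pro_p_group p P TP by fact
  interpret Hp: pro_p_group p "G\<lparr>carrier := H\<rparr>" "subtopology T H" by (rule H_pro_p_group)
  have hom: "g \<in> hom (G\<lparr>carrier := H\<rparr>) P" "g' \<in> hom (G\<lparr>carrier := H\<rparr>) P"
    using g g' by (simp_all add: continuous_hom_def)
  have car: "g h \<in> carrier P" "g' h \<in> carrier P"
    using hom_in_carrier[OF hom(1), of h] hom_in_carrier[OF hom(2), of h] h by simp_all
  show ?thesis
  proof (rule P.eq_if_eq_mod_open_normals[OF car])
    fix N assume N: "open_normal N P TP"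
    interpret N: normal N P using N by (simp add: open_normal_def)
    interpret Q: finite_p_group p "P Mod N" by (rule P.finite_p_group_Mod[OF prime N])
    have oN: "openin TP N" using N by (simp add: open_normal_def)
    obtain V where V: "open_normal V G T" "\<forall>v\<in>V \<inter> H. g v \<in> N"
      using continuous_hom_kernel_nbhd[OF g H_subgroup P.is_group oN N.one_closed] by metis
    obtain V' where V': "open_normal V' G T" "\<forall>v\<in>V' \<inter> H. g' v \<in> N"
      using continuous_hom_kernel_nbhd[OF g' H_subgroup P.is_group oN N.one_closed] by metis
    have "N #>\<^bsub>P\<^esub> g h = N #>\<^bsub>P\<^esub> g' h"
    proof (rule Hp.homs_eq_if_eq_on_generators[OF gen _ Q.is_group hom_comp[OF hom(1) N.r_coset_hom_Mod]
          hom_comp[OF hom(2) N.r_coset_hom_Mod] open_normal_Int_subgroup[OF open_normal_Int[OF V(1) V'(1)] H_subgroup]])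
      fix v assume v: "v \<in> V \<inter> V' \<inter> H"
      then have "g v \<in> N" "g' v \<in> N" using V(2) V'(2) by auto
      then show "N #>\<^bsub>P\<^esub> g v = N #>\<^bsub>P\<^esub> g' v"
        using P.coset_join2[OF _ N.subgroup_axioms] N.subset by auto
    qed (simp_all add: X h eq)
    then show "g h \<in> N #>\<^bsub>P\<^esub> g' h" using P.rcos_self[OF car(1) N.subgroup_axioms] by simp
  qed
qed

end

theorem mainTheorem1:
  fixes p :: nat
    and G :: "('a, 'm) monoid_scheme"
    and T :: "'a topology"
    and I :: "'i set"
    and S :: "'i \<Rightarrow> 'a set"
    and H :: "'a set"
    and D :: "'i \<Rightarrow> 'a set"
  assumes "prime p"
    and "restricted_free_pro_p_product TYPE('u::infinite) p G T I S"
    and "closed_subgroup H G T"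
    and "\<forall>i\<in>I. finite (double_cosets G H (S i))"
    and "\<forall>i\<in>I. double_coset_representatives G H (S i) (D i)"
    and "topologically_generated_by (G\<lparr>carrier := H\<rparr>) (subtopology T H)
           (\<Union>i\<in>I. \<Union>x\<in>D i. H \<inter> conjugate G x (S i))"
  shows "converges_to_1 (G\<lparr>carrier := H\<rparr>) (subtopology T H) (SIGMA i:I. D i)
           (\<lambda>(i, x). H \<inter> conjugate G x (S i))
       \<and> restricted_free_pro_p_product TYPE('v) p (G\<lparr>carrier := H\<rparr>) (subtopology T H)
           (SIGMA i:I. D i) (\<lambda>(i, x). H \<inter> conjugate G x (S i))"
proof -
  interpret G: pro_p_group p G T using assms(2) by (simp add: restricted_free_pro_p_product_def)
  have S: "closed_subgroup (S i) G T" if "i \<in> I" for i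
    using assms(2) that by (simp add: restricted_free_pro_p_product_def)
  have sH: "subgroup H G" using assms(3) by (simp add: closed_subgroup_def)
  have sS: "subgroup (S i) G" if "i \<in> I" for i using S[OF that] by (simp add: closed_subgroup_def)
  interpret subgroup_with_representatives p G T I S H D
  proof (unfold_locales)
    show "prime p" "closed_subgroup H G T" by fact+
    show "closed_subgroup (S i) G T" if "i \<in> I" for i by (rule S[OF that])
    show "converges_to_1 G T I S" "topologically_generated_by G T (\<Union>i\<in>I. S i)"
      using assms(2) by (simp_all add: restricted_free_pro_p_product_def)
    fix i assume i: "i \<in> I"
    have rep: "double_coset_representatives G H (S i) (D i)" using assms(5) i by simp
    then show "finite (D i)" "D i \<subseteq> carrier G"
      using assms(4) i bij_betw_finite unfolding double_coset_representatives_def by blast+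
    show "\<exists>x\<in>D i. \<exists>h\<in>H. \<exists>k\<in>S i. g = h \<otimes>\<^bsub>G\<^esub> x \<otimes>\<^bsub>G\<^esub> k" if "g \<in> carrier G" for g
      by (rule G.double_coset_representatives_cover[OF sH sS[OF i] rep that])
    show "x = y" if "x \<in> D i" "y \<in> D i" "h \<in> H" "k \<in> S i" "y = h \<otimes>\<^bsub>G\<^esub> x \<otimes>\<^bsub>G\<^esub> k" for x y h k
      by (rule G.double_coset_representatives_unique[OF sH sS[OF i] rep that])
  qed
  let ?H = "G\<lparr>carrier := H\<rparr>" and ?T = "subtopology T H"
  let ?I = "SIGMA i:I. D i" and ?L = "\<lambda>(i, x). H \<inter> conjugate G x (S i)"
  have Un: "(\<Union>z\<in>?I. ?L z) = (\<Union>i\<in>I. \<Union>x\<in>D i. L i x)" by auto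
  have "restricted_free_pro_p_product TYPE('v) p ?H ?T ?I ?L"
    unfolding restricted_free_pro_p_product_def
  proof (intro conjI allI impI)
    show "pro_p_group p ?H ?T" by (rule H_pro_p_group)
    show "\<forall>z\<in>?I. closed_subgroup (?L z) ?H ?T" using L_closed_subgroup by auto
    show "converges_to_1 ?H ?T ?I ?L" by (rule L_converges)
    show "\<forall>z\<in>?I. \<forall>w\<in>?I. z \<noteq> w \<longrightarrow> ?L z \<inter> ?L w = {\<one>\<^bsub>?H\<^esub>}"
    proof (intro ballI impI)
      fix z w assume "z \<in> ?I" "w \<in> ?I" "z \<noteq> w"
      moreover obtain i x j y where "z = (i, x)" "w = (j, y)" by (metis surj_pair)
      ultimately show "?L z \<inter> ?L w = {\<one>\<^bsub>?H\<^esub>}"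
        using L_Int_trivial[OF assms(2), of i x j y] by simp
    qed
    show "topologically_generated_by ?H ?T (\<Union>z\<in>?I. ?L z)" unfolding Un by (rule assms(6))
  next
    fix P :: "'v monoid" and TP and f :: "'i \<times> 'a \<Rightarrow> 'a \<Rightarrow> 'v"
    assume P: "pro_p_group p P TP"
      and f: "\<forall>z\<in>?I. f z \<in> continuous_hom (?H\<lparr>carrier := ?L z\<rparr>) (subtopology ?T (?L z)) P TP"
      and conv: "converges_to_1 P TP ?I (\<lambda>z. f z ` ?L z)"
    have f': "f (i, x) \<in> continuous_hom (G\<lparr>carrier := L i x\<rparr>) (subtopology T (L i x)) P TP" if "i \<in> I" "x \<in> D i" for i x
      using f that by (auto simp: subtopology_subtopology Int_absorb1)
    have "(\<lambda>z. f z ` ?L z) = (\<lambda>(i, x). f (i, x) ` L i x)" by auto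
    then have conv': "converges_to_1 P TP ?I (\<lambda>(i, x). f (i, x) ` L i x)" using conv by simp
    obtain g where g: "g \<in> continuous_hom ?H ?T P TP"
      "\<forall>i\<in>I. \<forall>x\<in>D i. \<forall>y\<in>L i x. g y = f (i, x) y"
      using pro_p_extension[OF assms(2) P assms(6), of "\<lambda>i x. f (i, x)", OF f' conv'] by blast
    show "\<exists>!g. g \<in> continuous_hom ?H ?T P TP \<and> g \<in> extensional (carrier ?H) \<and> (\<forall>z\<in>?I. \<forall>x\<in>?L z. g x = f z x)"
    proof (rule ex1I)
      \<comment> \<open>The values of \<open>g\<close> outside \<open>H\<close> are unspecified,
        while existence and uniqueness are demanded among extensional functions.\<close>
      have "restrict g H \<in> continuous_hom ?H ?T P TP"
        using g(1) subgroup.m_closed[OF sH] H_pro_p_group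
        unfolding continuous_hom_def hom_def
        by (auto simp: Pi_iff intro: continuous_map_eq)
      then show "restrict g H \<in> continuous_hom ?H ?T P TP \<and> restrict g H \<in> extensional (carrier ?H) \<and>
          (\<forall>z\<in>?I. \<forall>x\<in>?L z. restrict g H x = f z x)"
        using g(2) by auto
    next
      fix g' assume g': "g' \<in> continuous_hom ?H ?T P TP \<and> g' \<in> extensional (carrier ?H) \<and> (\<forall>z\<in>?I. \<forall>x\<in>?L z. g' x = f z x)"
      show "g' = restrict g H"
      proof
        fix h show "g' h = restrict g H h"
        proof (cases "h \<in> H")
          case True
          have "g' h = g h"
          proof (rule continuous_homs_eq[OF P assms(6) _ _ g(1) _ True])
            show "g' x = g x" if x: "x \<in> (\<Union>i\<in>I. \<Union>x\<in>D i. L i x)" for x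
            proof -
              obtain i y where iy: "i \<in> I" "y \<in> D i" "x \<in> L i y" using x by blast
              then have "(i, y) \<in> ?I" "x \<in> ?L (i, y)" by auto
              then have "g' x = f (i, y) x" using g' by blast
              then show ?thesis using g(2) iy by simp
            qed
          qed (use g' in auto)
          then show ?thesis using True by simp
        next
          case False
          then show ?thesis using g' by (simp add: extensional_def)
        qed
      qed
    qed
  qed
  then show ?thesis using L_converges by simp
qed

end
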